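(* Let $(\mathcal W\cup\mathcal W',\mathcal Y\cup\mathcal Y')$ be a globally blocked $m$-triangular labyrinth patterns system with white path matrix $M_w$ and yellow path matrix $M_y$, and let $I_3$ be the $3\times3$ identity matrix. Then the arc in $L^{w}_\infty$ between any two distinct exits $\mathbf E^{w}_i$ and $\mathbf E^{w}_j$ (and also the arc in $L^{y}_\infty$ between any two distinct exits $\mathbf E^{y}_i$ and $\mathbf E^{y}_j$) has Hausdorff dimension $\log_m(\theta)>1$, where $\theta$ is the dominant eigenvalue of $M_w+M_y-I_3$.
   Context: **Triangles.** Let $H=\{(\alpha_1,\alpha_2,\alpha_3)\in[0,1]^3:\alpha_1+\alpha_2+\alpha_3=1\}$, $\mathbb N=\{0,1,2,\dots\}$, $\mathbf P_1=(0,0)$, $\mathbf P_2=(1,0)$, $\mathbf P_3=(1/2,\sqrt3/2)$. $\Delta(\mathbf A_1,\mathbf A_2,\mathbf A_3)$ denotes the full closed triangle with (ordered) vertices $\mathbf A_1,\mathbf A_2,\mathbf A_3$, and $T_1=\Delta(\mathbf P_1,\mathbf P_2,\mathbf P_3)$. For $\Delta=\Delta(\mathbf A_1,\mathbf A_2,\mathbf A_3)\subset T_1$ let $P_\Delta:T_1\to T_1$, $\sum\alpha_i\mathbf P_i\mapsto\sum\alpha_i\mathbf A_i$ for $(\alpha_1,\alpha_2,\alpha_3)\in H$. For $m\ge2$ and $(k_1,k_2,k_3)\in\mathbb Z^3$, $T_m(k_1,k_2,k_3)$ is the triangle with ordered vertices $\mathbf A_i=\frac1m\big(k_1\mathbf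 P_1+k_2\mathbf P_2+k_3\mathbf P_3+\mathbf P_i\big)$ and $T'_m(k_1,k_2,k_3)$ is the triangle with ordered vertices $\mathbf A_i=\frac1m\big(k_1\mathbf P_1+k_2\mathbf P_2+k_3\mathbf P_3+\mathbf P_1+\mathbf P_2+\mathbf P_3-\mathbf P_i\big)$, $i=1,2,3$. Put $\mathcal T_m=\{T_m(k_1,k_2,k_3):k_i\in\mathbb N,\ k_1+k_2+k_3=m-1\}$ and $\mathcal T'_m=\{T'_m(k_1,k_2,k_3):k_i\in\mathbb N,\ k_1+k_2+k_3=m-2\}$. $T_m(k_1,k_2,k_3)$ and $T'_m(k'_1,k'_2,k'_3)$ are $j$-neighbours if $k_j=k'_j+1$ and $k_i=k'_i$ for $i\ne j$ (they then share a side). For $i\in\{1,2,3\}$ and $K\in\{0,\dots,m-1\}$, the set of all $T_m(k_1,k_2,k_3)\in\mathcal T_m$ and $T'_m(k_1,k_2,k_3)\in\mathcal T'_m$ with $k_i=K$ is called a strip of type $i$. **Patterns systems.** An $m$-triangular patterns system is a pair $(\mathcal W\cup\mathcal W',\mathcal Y\cup\mathcal Y')$ with $\mathcal W,\mathcal Y\subset\mathcal T_m$ and $\mathcal W',\mathcal Y'\subset\mathcal T'_m$. Put $\mathcal W_1=\mathcal W$, $\mathcal W'_1=\mathcal W'$, $\mathcal Y_1=\mathcal Y$, $\mathcal Y'_1=\mathcal Y'$, and for $n\ge2$ $\mathcal W_n=\{P_{U}(V):U\in\mathcal W_{n-1},V\in\mathcal W_1\}\cup\{P_{U}(V):U\in\mathcal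 W'_{n-1},V\in\mathcal Y'_1\}$, $\mathcal W'_n=\{P_{U}(V):U\in\mathcal W_{n-1},V\in\mathcal W'_1\}\cup\{P_{U}(V):U\in\mathcal W'_{n-1},V\in\mathcal Y_1\}$, $\mathcal Y_n=\{P_{U}(V):U\in\mathcal Y_{n-1},V\in\mathcal Y_1\}\cup\{P_{U}(V):U\in\mathcal Y'_{n-1},V\in\mathcal W'_1\}$, $\mathcal Y'_n=\{P_{U}(V):U\in\mathcal Y_{n-1},V\in\mathcal Y'_1\}\cup\{P_{U}(V):U\in\mathcal Y'_{n-1},V\in\mathcal W_1\}$. Then $\mathcal W_n,\mathcal Y_n\subset\mathcal T_{m^n}$, $\mathcal W'_n,\mathcal Y'_n\subset\mathcal T'_{m^n}$. $\mathcal G(\mathcal W_n\cup\mathcal W'_n)$ is the undirected graph with vertex set $\mathcal W_n\cup\mathcal W'_n$ in which two vertices are joined by an edge labelled $j$ iff they are $j$-neighbours; $\mathcal G(\mathcal Y_n\cup\mathcal Y'_n)$ is defined analogously. **Labyrinth patterns systems.** The system is an $m$-triangular labyrinth patterns system if: (1) (tree property) $\mathcal G(\mathcal W\cup\mathcal W')$ and $\mathcal G(\mathcal Y\cup\mathcal Y')$ are trees; (2) (exits property) there is exactly one triple $(k_1,k_2,k_3)$ of integers in $\{0,\dots,m-1\}$ with $T_m(0,k_1,m-1-k_1)\in\mathcal W$, $T_m(0,m-1-k_1,k_1)\in\mathcal Y$, $T_m(k_2,0,m-1-k_2)\in\mathcal W$, $T_m(m-1-k_2,0,k_2)\in\mathcal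 Y$, $T_m(k_3,m-1-k_3,0)\in\mathcal W$, $T_m(m-1-k_3,k_3,0)\in\mathcal Y$; (3) (corners property) the sets $\mathcal C(\mathcal W)$, $\mathcal C(\mathcal Y)$ of elements of $\mathcal W$, resp. $\mathcal Y$, that contain one of $\mathbf P_1,\mathbf P_2,\mathbf P_3$ are disjoint and each has at most one element. The exits of the patterns are $e^w_1=T_m(0,k_1,m-1-k_1)$, $e^w_2=T_m(k_2,0,m-1-k_2)$, $e^w_3=T_m(k_3,m-1-k_3,0)$ and $e^y_1=T_m(0,m-1-k_1,k_1)$, $e^y_2=T_m(m-1-k_2,0,k_2)$, $e^y_3=T_m(m-1-k_3,k_3,0)$. For each $n\ge1$ the pair $(\mathcal W_n\cup\mathcal W'_n,\mathcal Y_n\cup\mathcal Y'_n)$ is an $m^n$-triangular labyrinth patterns system; its exits are denoted $e^w_i(n)$, $e^y_i(n)$. **Fractals.** $L^{w}_n$ (resp. $L^{y}_n$) is the union of all triangles in $\mathcal W_n\cup\mathcal W'_n$ (resp. $\mathcal Y_n\cup\mathcal Y'_n$); $L^{w}_\infty=\bigcap_{n\ge1}L^{w}_n$ and $L^{y}_\infty=\bigcap_{n\ge1}L^{y}_n$ are the white and yellow triangular labyrinth fractals. They are dendrites, so any two distinct points are joined by a unique arc inside the fractal. The exits of the fractals are the points $\mathbf E^w_i,\mathbf E^y_i$ with $\{\mathbf E^w_i\}=\bigcap_{n\ge1}e^w_i(n)$, $\{\mathbf E^y_i\}=\bigcap_{n\ge1}e^y_i(n)$, $i=1,2,3$. **Paths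 and path matrices.** Let $\mathcal P=\{\{1,2\},\{1,3\},\{2,3\}\}$. For $\{i,j\}\in\mathcal P$ the white (yellow) path of type $\{i,j\}$ is the unique path in the tree $\mathcal G(\mathcal W\cup\mathcal W')$ (resp. $\mathcal G(\mathcal Y\cup\mathcal Y')$) from $e^w_i$ to $e^w_j$ (resp. $e^y_i$ to $e^y_j$). If $V_1,\dots,V_r$ is this path and $l_h$ is the label of the edge between $V_h$ and $V_{h+1}$, then (with respect to the path) $V_h$ has type $\{l_{h-1},l_h\}$ for $1<h<r$, $V_1$ has type $\{i,l_1\}$ and $V_r$ has type $\{l_{r-1},j\}$. The white path matrix $M_w$ is the $3\times3$ matrix, rows and columns indexed by $\{1,2\},\{1,3\},\{2,3\}$ in this order, whose $(\pi,\gamma)$ entry is the number of triangles from $\mathcal W$ of type $\gamma$ in the white path of type $\pi$; the yellow path matrix $M_y$ has as $(\pi,\gamma)$ entry the number of triangles from $\mathcal Y$ of type $\gamma$ in the yellow path of type $\pi$. **Blocked.** For $\{i,j\}\in\mathcal P$ and $\{k\}=\{1,2,3\}\setminus\{i,j\}$, the white (yellow) path of type $\{i,j\}$ is blocked if it contains two triangles that are not contained in the same strip of type $k$. The system is $\pi$-blocked ($\pi\in\mathcal P$) if the white or the yellow path of type $\pi$ is blocked, and globally blocked if it is $\pi$-blocked for all $\pi\in\mathcal P$. *)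

theory Defs
  imports "Jordan_Normal_Form.Char_Poly" "HOL-Analysis.Analysis"
begin

no_notation vec_index (infixl "$" 100)

section \<open>Hausdorff dimension\<close>

text \<open>\<open>diam_powr s U\<close> is the \<open>s\<close>-th power of the diameter, with the conventions \<open>0\<^sup>0 = 1\<close> for nonempty
  sets and value \<open>0\<close> for the empty set. Covers are required to consist of bounded sets because
  \<^const>\<open>diameter\<close> is meaningless on unbounded ones.\<close>

definition diam_powr :: "real \<Rightarrow> 'a::metric_space set \<Rightarrow> real" where
  "diam_powr s U = (if U = {} then 0 else if s = 0 then 1 else diameter U powr s)"

definition hausdorff_pre_measure :: "real \<Rightarrow> real \<Rightarrow> 'a::metric_space set \<Rightarrow> ennreal" where
  "hausdorff_pre_measure s \<delta> A =
     (INF U \<in> {U :: nat \<Rightarrow> 'a set. A \<subseteq> (\<Union>i. U i) \<and> (\<forall>i. bounded (U i) \<and> diameter (U i) \<le> \<delta>)}.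
        (\<Sum>i. ennreal (diam_powr s (U i))))"

definition hausdorff_measure :: "real \<Rightarrow> 'a::metric_space set \<Rightarrow> ennreal" where
  "hausdorff_measure s A = (SUP \<delta> \<in> {0<..}. hausdorff_pre_measure s \<delta> A)"

definition hausdorff_dim :: "'a::metric_space set \<Rightarrow> ereal" where
  "hausdorff_dim A = (INF s \<in> {s. 0 \<le> s \<and> hausdorff_measure s A = 0}. ereal s)"

section \<open>Trees\<close>

text \<open>Simple undirected graphs are given by a vertex set and a symmetric adjacency relation; the
  graph meant is the one induced on the vertex set. The library of digraphs is not
  used: there an undirected edge is a pair of opposite arcs, which already is a directed cycle.\<close>

definition simple_path :: "'a set \<Rightarrow> ('a \<Rightarrow> 'a \<Rightarrow> bool) \<Rightarrow> 'a list \<Rightarrow> bool" where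
  "simple_path V E p \<longleftrightarrow> p \<noteq> [] \<and> set p \<subseteq> V \<and> distinct p \<and> successively E p"

definition path_from_to :: "'a set \<Rightarrow> ('a \<Rightarrow> 'a \<Rightarrow> bool) \<Rightarrow> 'a \<Rightarrow> 'a \<Rightarrow> 'a list \<Rightarrow> bool" where
  "path_from_to V E u v p \<longleftrightarrow> simple_path V E p \<and> hd p = u \<and> last p = v"

definition graph_connected :: "'a set \<Rightarrow> ('a \<Rightarrow> 'a \<Rightarrow> bool) \<Rightarrow> bool" where
  "graph_connected V E \<longleftrightarrow> (\<forall>u\<in>V. \<forall>v\<in>V. \<exists>p. path_from_to V E u v p)"

definition graph_cycle :: "'a set \<Rightarrow> ('a \<Rightarrow> 'a \<Rightarrow> bool) \<Rightarrow> 'a list \<Rightarrow> bool" where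
  "graph_cycle V E p \<longleftrightarrow> simple_path V E p \<and> 3 \<le> length p \<and> E (last p) (hd p)"

definition graph_tree :: "'a set \<Rightarrow> ('a \<Rightarrow> 'a \<Rightarrow> bool) \<Rightarrow> bool" where
  "graph_tree V E \<longleftrightarrow> V \<noteq> {} \<and> graph_connected V E \<and> (\<nexists>p. graph_cycle V E p)"

definition tree_path :: "'a set \<Rightarrow> ('a \<Rightarrow> 'a \<Rightarrow> bool) \<Rightarrow> 'a \<Rightarrow> 'a \<Rightarrow> 'a list" where
  "tree_path V E u v = (THE p. path_from_to V E u v p)"

section \<open>Triangles\<close>

text \<open>The index set \<open>{1, 2, 3}\<close> is the numeral type \<^typ>\<open>3\<close> (in which \<open>3 = 0\<close>). A triangle is its
  family of ordered vertices; \<open>region\<close> is the corresponding full closed triangle.\<close>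

type_synonym triangle = "(real^2)^3"

definition P :: "3 \<Rightarrow> real^2" where
  "P i = (if i = 1 then vector [0, 0] else if i = 2 then vector [1, 0]
          else vector [1/2, sqrt 3 / 2])"

definition region :: "triangle \<Rightarrow> (real^2) set" where
  "region D = convex hull (range (\<lambda>i. D $ i))"

definition H :: "(real^3) set" where
  "H = {a. (\<forall>i. a $ i \<in> {0..1}) \<and> (\<Sum>i\<in>UNIV. a $ i) = 1}"

definition barycentric :: "real^2 \<Rightarrow> real^3" where
  "barycentric x = (THE a. a \<in> H \<and> x = (\<Sum>i\<in>UNIV. (a $ i) *\<^sub>R P i))"

definition tri_map :: "triangle \<Rightarrow> real^2 \<Rightarrow> real^2" where
  "tri_map D x = (\<Sum>i\<in>UNIV. (barycentric x $ i) *\<^sub>R (D $ i))"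

definition tri_image :: "triangle \<Rightarrow> triangle \<Rightarrow> triangle" where
  "tri_image U V = (\<chi> i. tri_map U (V $ i))"

definition T :: "nat \<Rightarrow> nat^3 \<Rightarrow> triangle" where
  "T m k = (\<chi> i. (1 / real m) *\<^sub>R ((\<Sum>l\<in>UNIV. real (k $ l) *\<^sub>R P l) + P i))"

definition T' :: "nat \<Rightarrow> nat^3 \<Rightarrow> triangle" where
  "T' m k = (\<chi> i. (1 / real m) *\<^sub>R ((\<Sum>l\<in>UNIV. real (k $ l) *\<^sub>R P l) + (\<Sum>l\<in>UNIV. P l) - P i))"

text \<open>Since \<open>P 1 = 0\<close>, \<open>T m k\<close> determines \<open>k\<close> only together with the sum of its components; the
  definitions below that recover \<open>k\<close> from a triangle therefore always impose these sums.\<close>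

definition T_index :: "nat \<Rightarrow> (nat^3) set" where
  "T_index m = {k. (\<Sum>i\<in>UNIV. k $ i) = m - 1}"

definition T'_index :: "nat \<Rightarrow> (nat^3) set" where
  "T'_index m = {k. (\<Sum>i\<in>UNIV. k $ i) = m - 2}"

definition TT :: "nat \<Rightarrow> triangle set" where
  "TT m = T m ` T_index m"

definition TT' :: "nat \<Rightarrow> triangle set" where
  "TT' m = T' m ` T'_index m"

definition neighbours_TT' :: "nat \<Rightarrow> 3 \<Rightarrow> triangle \<Rightarrow> triangle \<Rightarrow> bool" where
  "neighbours_TT' m j U V \<longleftrightarrow> (\<exists>k\<in>T_index m. \<exists>k'\<in>T'_index m. U = T m k \<and> V = T' m k' \<and>
     k $ j = k' $ j + 1 \<and> (\<forall>i. i \<noteq> j \<longrightarrow> k $ i = k' $ i))"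

definition neighbours :: "nat \<Rightarrow> 3 \<Rightarrow> triangle \<Rightarrow> triangle \<Rightarrow> bool" where
  "neighbours m j U V \<longleftrightarrow> neighbours_TT' m j U V \<or> neighbours_TT' m j V U"

definition adjacent :: "nat \<Rightarrow> triangle \<Rightarrow> triangle \<Rightarrow> bool" where
  "adjacent m U V \<longleftrightarrow> (\<exists>j. neighbours m j U V)"

definition edge_label :: "nat \<Rightarrow> triangle \<Rightarrow> triangle \<Rightarrow> 3" where
  "edge_label m U V = (THE j. neighbours m j U V)"

definition strip :: "nat \<Rightarrow> 3 \<Rightarrow> nat \<Rightarrow> triangle set" where
  "strip m i K = {T m k | k. k \<in> T_index m \<and> k $ i = K} \<union> {T' m k | k. k \<in> T'_index m \<and> k $ i = K}"

section \<open>Patterns systems\<close>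

text \<open>The selectors \<open>white\<close>, \<open>white'\<close>, \<open>yellow\<close>, \<open>yellow'\<close> stand for
  \<open>\<W>\<close>, \<open>\<W>'\<close>, \<open>\<Y>\<close>, \<open>\<Y>'\<close>.\<close>

datatype patterns = Patterns
  (white: "triangle set") (white': "triangle set") (yellow: "triangle set") (yellow': "triangle set")

definition patterns_system :: "nat \<Rightarrow> patterns \<Rightarrow> bool" where
  "patterns_system m S \<longleftrightarrow> m \<ge> 2 \<and>
     white S \<subseteq> TT m \<and> yellow S \<subseteq> TT m \<and> white' S \<subseteq> TT' m \<and> yellow' S \<subseteq> TT' m"

definition substitute :: "triangle set \<Rightarrow> triangle set \<Rightarrow> triangle set" where
  "substitute A B = {tri_image U V | U V. U \<in> A \<and> V \<in> B}"

definition refine :: "patterns \<Rightarrow> patterns \<Rightarrow> patterns" where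
  "refine S R = Patterns
     (substitute (white R) (white S) \<union> substitute (white' R) (yellow' S))
     (substitute (white R) (white' S) \<union> substitute (white' R) (yellow S))
     (substitute (yellow R) (yellow S) \<union> substitute (yellow' R) (white' S))
     (substitute (yellow R) (yellow' S) \<union> substitute (yellow' R) (white S))"

text \<open>\<open>level S n = (\<W>\<^sub>n, \<W>'\<^sub>n, \<Y>\<^sub>n, \<Y>'\<^sub>n)\<close> for \<open>n \<ge> 1\<close>; the value at \<open>n = 0\<close> is never used.\<close>

definition level :: "patterns \<Rightarrow> nat \<Rightarrow> patterns" where
  "level S n = (refine S ^^ (n - 1)) S"

abbreviation white_all :: "patterns \<Rightarrow> triangle set" where
  "white_all S \<equiv> white S \<union> white' S"

abbreviation yellow_all :: "patterns \<Rightarrow> triangle set" where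
  "yellow_all S \<equiv> yellow S \<union> yellow' S"

section \<open>Labyrinth patterns systems\<close>

definition white_exit_at :: "nat \<Rightarrow> nat^3 \<Rightarrow> 3 \<Rightarrow> triangle" where
  "white_exit_at m k i = T m
     (if i = 1 then vector [0, k $ 1, m - 1 - k $ 1]
      else if i = 2 then vector [k $ 2, 0, m - 1 - k $ 2]
      else vector [k $ 3, m - 1 - k $ 3, 0])"

definition yellow_exit_at :: "nat \<Rightarrow> nat^3 \<Rightarrow> 3 \<Rightarrow> triangle" where
  "yellow_exit_at m k i = T m
     (if i = 1 then vector [0, m - 1 - k $ 1, k $ 1]
      else if i = 2 then vector [m - 1 - k $ 2, 0, k $ 2]
      else vector [m - 1 - k $ 3, k $ 3, 0])"

definition exit_triple :: "nat \<Rightarrow> patterns \<Rightarrow> nat^3 \<Rightarrow> bool" where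
  "exit_triple m S k \<longleftrightarrow> (\<forall>i. k $ i \<in> {0..m - 1} \<and>
     white_exit_at m k i \<in> white S \<and> yellow_exit_at m k i \<in> yellow S)"

definition corner_triangles :: "triangle set \<Rightarrow> triangle set" where
  "corner_triangles A = {D \<in> A. \<exists>i. P i \<in> region D}"

definition labyrinth_patterns_system :: "nat \<Rightarrow> patterns \<Rightarrow> bool" where
  "labyrinth_patterns_system m S \<longleftrightarrow> patterns_system m S \<and>
     graph_tree (white_all S) (adjacent m) \<and> graph_tree (yellow_all S) (adjacent m) \<and>
     (\<exists>!k. exit_triple m S k) \<and>
     corner_triangles (white S) \<inter> corner_triangles (yellow S) = {} \<and>
     card (corner_triangles (white S)) \<le> 1 \<and> card (corner_triangles (yellow S)) \<le> 1"

definition white_exit :: "nat \<Rightarrow> patterns \<Rightarrow> 3 \<Rightarrow> triangle" where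
  "white_exit m S i = white_exit_at m (THE k. exit_triple m S k) i"

definition yellow_exit :: "nat \<Rightarrow> patterns \<Rightarrow> 3 \<Rightarrow> triangle" where
  "yellow_exit m S i = yellow_exit_at m (THE k. exit_triple m S k) i"

section \<open>Labyrinth fractals\<close>

definition white_fractal :: "patterns \<Rightarrow> (real^2) set" where
  "white_fractal S = (\<Inter>n\<in>{1..}. \<Union>D\<in>white_all (level S n). region D)"

definition yellow_fractal :: "patterns \<Rightarrow> (real^2) set" where
  "yellow_fractal S = (\<Inter>n\<in>{1..}. \<Union>D\<in>yellow_all (level S n). region D)"

definition white_exit_point :: "nat \<Rightarrow> patterns \<Rightarrow> 3 \<Rightarrow> real^2" where
  "white_exit_point m S i =
     (THE x. (\<Inter>n\<in>{1..}. region (white_exit (m ^ n) (level S n) i)) = {x})"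

definition yellow_exit_point :: "nat \<Rightarrow> patterns \<Rightarrow> 3 \<Rightarrow> real^2" where
  "yellow_exit_point m S i =
     (THE x. (\<Inter>n\<in>{1..}. region (yellow_exit (m ^ n) (level S n) i)) = {x})"

definition arc_between :: "'a::topological_space set \<Rightarrow> 'a \<Rightarrow> 'a \<Rightarrow> 'a set \<Rightarrow> bool" where
  "arc_between L x y A \<longleftrightarrow>
     A \<subseteq> L \<and> (\<exists>g. arc g \<and> pathstart g = x \<and> pathfinish g = y \<and> path_image g = A)"

section \<open>Paths, path matrices and blocked systems\<close>

definition white_path :: "nat \<Rightarrow> patterns \<Rightarrow> 3 \<times> 3 \<Rightarrow> triangle list" where
  "white_path m S = (\<lambda>(i, j).
     tree_path (white_all S) (adjacent m) (white_exit m S i) (white_exit m S j))"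

definition yellow_path :: "nat \<Rightarrow> patterns \<Rightarrow> 3 \<times> 3 \<Rightarrow> triangle list" where
  "yellow_path m S = (\<lambda>(i, j).
     tree_path (yellow_all S) (adjacent m) (yellow_exit m S i) (yellow_exit m S j))"

text \<open>For a path \<open>V\<^sub>1, \<dots>, V\<^sub>r\<close> of type \<open>{i, j}\<close> with edge labels \<open>l\<^sub>1, \<dots>, l\<^bsub>r-1\<^esub>\<close>, the type of \<open>V\<^sub>h\<close> is
  the set of the two consecutive entries at \<open>V\<^sub>h\<close> of the list \<open>i, l\<^sub>1, \<dots>, l\<^bsub>r-1\<^esub>, j\<close>. List positions
  \<open>h\<close> start at \<open>0\<close>.\<close>

definition path_labels :: "nat \<Rightarrow> 3 \<times> 3 \<Rightarrow> triangle list \<Rightarrow> 3 list" where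
  "path_labels m = (\<lambda>(i, j) p. i # map2 (edge_label m) (butlast p) (tl p) @ [j])"

definition path_vertex_type :: "nat \<Rightarrow> 3 \<times> 3 \<Rightarrow> triangle list \<Rightarrow> nat \<Rightarrow> 3 set" where
  "path_vertex_type m ij p h = {path_labels m ij p ! h, path_labels m ij p ! Suc h}"

definition path_types :: "(3 \<times> 3) list" where
  "path_types = [(1, 2), (1, 3), (2, 3)]"

definition count_type :: "nat \<Rightarrow> triangle set \<Rightarrow> 3 \<times> 3 \<Rightarrow> triangle list \<Rightarrow> 3 \<times> 3 \<Rightarrow> nat" where
  "count_type m A ij p = (\<lambda>(a, b).
     card {h. h < length p \<and> p ! h \<in> A \<and> path_vertex_type m ij p h = {a, b}})"

text \<open>The path matrices are given complex entries, so that their eigenvalues are the complex ones.\<close>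

definition white_path_matrix :: "nat \<Rightarrow> patterns \<Rightarrow> complex mat" where
  "white_path_matrix m S = Matrix.mat 3 3 (\<lambda>(r, c).
     of_nat (count_type m (white S) (path_types ! r) (white_path m S (path_types ! r))
       (path_types ! c)))"

definition yellow_path_matrix :: "nat \<Rightarrow> patterns \<Rightarrow> complex mat" where
  "yellow_path_matrix m S = Matrix.mat 3 3 (\<lambda>(r, c).
     of_nat (count_type m (yellow S) (path_types ! r) (yellow_path m S (path_types ! r))
       (path_types ! c)))"

definition dominant_eigenvalue :: "complex mat \<Rightarrow> complex \<Rightarrow> bool" where
  "dominant_eigenvalue A z \<longleftrightarrow> eigenvalue A z \<and> (\<forall>w. eigenvalue A w \<and> w \<noteq> z \<longrightarrow> cmod w < cmod z)"

definition blocked_path :: "nat \<Rightarrow> 3 \<times> 3 \<Rightarrow> triangle list \<Rightarrow> bool" where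
  "blocked_path m = (\<lambda>(i, j) p. \<exists>k. {k} = {1, 2, 3} - {i, j} \<and>
     (\<exists>U\<in>set p. \<exists>V\<in>set p. \<not> (\<exists>K\<in>{0..m - 1}. U \<in> strip m k K \<and> V \<in> strip m k K)))"

definition blocked :: "nat \<Rightarrow> patterns \<Rightarrow> 3 \<times> 3 \<Rightarrow> bool" where
  "blocked m S ij \<longleftrightarrow>
     blocked_path m ij (white_path m S ij) \<or> blocked_path m ij (yellow_path m S ij)"

definition globally_blocked :: "nat \<Rightarrow> patterns \<Rightarrow> bool" where
  "globally_blocked m S \<longleftrightarrow> (\<forall>ij\<in>set path_types. blocked m S ij)"

end

theory Submission
  imports Defs
begin

text \<open>
Every level of the fractal is a tree of triangles in which two triangles meet only in a common exit:
a contact in a vertex would give the patterns too many corner triangles, and a contact across a side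
is pushed by self-similarity into the unique pair of matching exits. An injective path between two
exits therefore has to follow the tree path, and its pieces are similar images of arcs of the same
kind. Contraction makes the arc unique, and it remains to parametrise it.

Along a tree path upright and inverted triangles alternate. The upright triangles of each type
outnumber the inverted ones by one for the type of the path itself and by none otherwise, hence the
inverted triangles are counted by \<open>M\<^sub>w - I\<close> and \<open>M\<^sub>y - I\<close>. A positive eigenvector \<open>z\<close> of
\<open>M\<^sub>w + M\<^sub>y - I\<close> then splits into durations \<open>(M\<^sub>w - I) z / (\<theta> - 1)\<close> and \<open>(M\<^sub>y - I) z / (\<theta> - 1)\<close> for
the white and the yellow arcs. Run with these durations, the arc spends time at most a constant times
\<open>\<theta>\<^sup>-\<^sup>n\<close> in a cell of level \<open>n\<close>, so the image of Lebesgue measure is a mass distribution of dimension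
\<open>log\<^sub>m \<theta>\<close>.

White and yellow exits are mirror images, so the displacements of the white and the yellow path of
type \<open>{i, j}\<close> add up to \<open>m - 1\<close> steps from side \<open>i\<close> to side \<open>j\<close>. If the third label occurs at all,
which is what blocking means, both paths together need an additional step, and no type can be absent from
both paths; so the matrix is positive with row sums exceeding \<open>m\<close>.
\<close>

section \<open>Paths in trees and arcs in tree-like unions\<close>

text \<open>The two fractals are treated as one recursive pair: recursion on the outermost cell
  reduces every question to the trees of the first level. An inverted cell continues in the other
  colour, so the arcs of both colours and all types form a single system, whose matrix has the
  blocks \<open>M\<^sub>w\<close>, \<open>M\<^sub>w - I\<close> in the white row and
  \<open>M\<^sub>y - I\<close>, \<open>M\<^sub>y\<close> in the yellow one. If it multiplies the
  durations \<open>a\<close> (white) and \<open>b\<close> (yellow) by \<theta>, adding the two rows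
  shows that \<open>z = a + b\<close> is an eigenvector of \<open>M\<^sub>w + M\<^sub>y - I\<close>,
  and the white row alone becomes \<open>(\<theta> - 1) a = (M\<^sub>w - I) z\<close>. This is the
  origin of the reduced matrix and of the divisor \<theta> - 1.

  The obstacle to existence is that the parametrised curve is not visibly injective. Uniqueness
  therefore comes first: any arc between two exits obeys the same contracting recursion as the image
  of the curve, hence equals it. Every path contains an arc between its ends, and by uniqueness that
  arc is the whole image. In the lower dimension bound, injectivity of the cell maps on interior
  points takes the place of injectivity of the curve.\<close>

lemma successively_rev_sym:
  assumes "\<And>x y. E x y \<Longrightarrow> E y x" "successively E p"
  shows "successively E (rev p)"
  unfolding successively_rev by (rule successively_mono[OF assms(2)]) (rule assms(1))

lemma path_from_to_rev:
  assumes "\<And>x y. E x y \<Longrightarrow> E y x" "path_from_to V E u v p"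
  shows "path_from_to V E v u (rev p)"
  using assms successively_rev_sym[OF assms(1)]
  by (auto simp: path_from_to_def simple_path_def hd_rev last_rev)

lemma path_from_to_suffix:
  assumes "path_from_to V E u v (xs @ w # ys)"
  shows "path_from_to V E w v (w # ys)"
  using assms by (auto simp: path_from_to_def simple_path_def successively_append_iff)

lemma path_from_to_prefix:
  assumes "path_from_to V E u v (xs @ w # ys)"
  shows "path_from_to V E u w (xs @ [w])"
  using assms successively_append_iff[of E "xs @ [w]" ys]
  by (cases xs) (auto simp: path_from_to_def simple_path_def)

text \<open>Two distinct paths with the same ends branch at some vertex; following them to the first
  common vertex afterwards closes a cycle.\<close>

lemma acyclic_unique_path:
  assumes sym: "\<And>x y. E x y \<Longrightarrow> E y x" and acyc: "\<nexists>p. graph_cycle V E p"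
    and "path_from_to V E u v p" "path_from_to V E u v q"
  shows "p = q"
  using assms(3,4)
proof (induction "length p" arbitrary: u p q rule: less_induct)
  case less
  note p = less.prems(1) and q = less.prems(2)
  obtain p' where p': "p = u # p'"
    using p by (cases p) (auto simp: path_from_to_def simple_path_def)
  obtain q' where q': "q = u # q'"
    using q by (cases q) (auto simp: path_from_to_def simple_path_def)
  show ?case
  proof (cases "u = v")
    case True
    then show ?thesis using p q p' q'
      by (auto simp: path_from_to_def simple_path_def split: if_splits)
  next
    case False
    have ne: "p' \<noteq> []" "q' \<noteq> []" using p q p' q' False by (auto simp: path_from_to_def)
    have vin: "v \<in> set p'" "v \<in> set q'"
      using p q p' q' ne last_in_set[of p'] last_in_set[of q'] by (auto simp: path_from_to_def)
    from vin obtain p1 w p2 where p1: "p' = p1 @ w # p2" "w \<in> set q'" "\<forall>y\<in>set p1. y \<notin> set q'"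
      using split_list_first_prop[of p' "\<lambda>x. x \<in> set q'"] by blast
    then obtain q1 q2 where q1: "q' = q1 @ w # q2"
      by (meson split_list)
    show ?thesis
    \<comment> \<open>If the paths agree in their second vertex, induction applies; otherwise
      \<open>?c\<close> has the third vertex that \<open>graph_cycle\<close> demands.\<close>
    proof (cases "p1 = [] \<and> q1 = []")
      case True
      have "path_from_to V E w v p'" "path_from_to V E w v q'"
        using path_from_to_suffix[of V E u v "[u]" w p2] path_from_to_suffix[of V E u v "[u]" w q2]
          p q p' q' p1 q1 True by auto
      then have "p' = q'" using less.hyps[of p' w q'] p' by auto
      then show ?thesis using p' q' by simp
    next
      case c: False
      let ?c = "u # p1 @ w # rev q1"
      have sp: "successively E (u # p1 @ w # p2)" "successively E (u # q1 @ w # q2)"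
        and dp: "distinct (u # p1 @ w # p2)" "distinct (u # q1 @ w # q2)"
        and sv: "set (u # p1 @ w # p2) \<subseteq> V" "set (u # q1 @ w # q2) \<subseteq> V"
        using p q p' q' p1 q1 by (auto simp: path_from_to_def simple_path_def)
      have s1: "successively E (u # p1 @ [w])" and s2: "successively E (u # q1 @ [w])"
        using sp successively_append_iff[of E "u # p1 @ [w]" p2] successively_append_iff[of E
          "u # q1 @ [w]" q2]
        by simp_all
      have s3: "successively E (w # rev q1 @ [u])"
        using successively_rev_sym[OF sym s2] by simp
      have "successively E ((u # p1 @ [w]) @ rev q1)"
        using s1 s3 successively_append_iff[of E "w # rev q1" "[u]"]
          successively_append_iff[of E "u # p1 @ [w]" "rev q1"]
        by (cases "q1 = []") (auto simp: successively_Cons)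
      then have "successively E ?c" by simp
      moreover have "distinct ?c" using dp p1 q1 by auto
      moreover have "set ?c \<subseteq> V" using sv by auto
      moreover have "E (last ?c) (hd ?c)"
        using s3 by (cases q1) (auto simp: successively_append_iff successively_Cons)
      moreover have "3 \<le> length ?c" using c by (cases p1; cases q1) auto
      ultimately have "graph_cycle V E ?c" by (simp add: graph_cycle_def simple_path_def)
      then show ?thesis using acyc by blast
    qed
  qed
qed

locale tree_graph =
  fixes V :: "'a set" and E
  assumes tree: "graph_tree V E" and sym: "\<And>x y. E x y \<Longrightarrow> E y x"
begin

lemma path_unique: "path_from_to V E u v p \<Longrightarrow> path_from_to V E u v q \<Longrightarrow> p = q"
  using acyclic_unique_path[of E V u v p q] sym tree by (auto simp: graph_tree_def)

lemma tree_path_eq: "path_from_to V E u v p \<Longrightarrow> tree_path V E u v = p"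
  unfolding tree_path_def using path_unique by blast

lemma tree_path: "u \<in> V \<Longrightarrow> v \<in> V \<Longrightarrow> path_from_to V E u v (tree_path V E u v)"
  using tree tree_path_eq by (fastforce simp: graph_tree_def graph_connected_def)

lemma tree_path_step:
  assumes "u \<in> V" "w \<in> V" "w' \<in> V" "E w w'" "w \<noteq> w'" "w' \<notin> set (tree_path V E u w)"
  shows "tree_path V E u w' = tree_path V E u w @ [w']"
  using tree_path[OF assms(1,2)] assms
  by (intro tree_path_eq)
    (auto simp: path_from_to_def simple_path_def successively_append_iff hd_append)

text \<open>With the tree rooted at \<open>u\<close>, one end of an edge is the parent of the other.
  If \<open>w'\<close> already lies on the path to \<open>w\<close>, uniqueness reduces the stretch
  from \<open>w'\<close> to \<open>w\<close> to the edge itself.\<close>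

lemma tree_path_parent:
  assumes u: "u \<in> V" "w \<in> V" "w' \<in> V" "E w w'" "w \<noteq> w'"
  shows "tree_path V E u w' = tree_path V E u w @ [w'] \<or>
         tree_path V E u w = tree_path V E u w' @ [w]"
proof (cases "w' \<in> set (tree_path V E u w)")
  case True
  then obtain p1 p2 where p: "tree_path V E u w = p1 @ w' # p2" by (meson split_list)
  note P = tree_path[OF u(1,2), unfolded p]
  have 1: "tree_path V E u w' = p1 @ [w']"
    by (rule tree_path_eq[OF path_from_to_prefix[OF P]])
  have "path_from_to V E w' w [w', w]"
    using u sym[OF u(4)] by (auto simp: path_from_to_def simple_path_def)
  from path_unique[OF path_from_to_suffix[OF P] this] p 1 show ?thesis by auto
next
  case False
  then show ?thesis using tree_path_step[OF u(1-4)] u by auto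
qed

end

section \<open>Injective paths in unions of closed sets with one-point contacts\<close>

lemma cont_meets_both:
  fixes g :: "real \<Rightarrow> 'a::t2_space"
  assumes "continuous_on {a..b} g" "a \<le> b" "g ` {a..b} \<subseteq> A \<union> B" "closed A" "closed B"
    "g a \<in> A" "g b \<in> B"
  shows "\<exists>t\<in>{a..b}. g t \<in> A \<inter> B"
proof (rule ccontr)
  assume *: "\<not> ?thesis"
  have "connected (g ` {a..b})" by (rule connected_continuous_image[OF assms(1)]) simp
  moreover have "A \<inter> B \<inter> g ` {a..b} = {}" using * by blast
  moreover have "A \<inter> g ` {a..b} \<noteq> {}" "B \<inter> g ` {a..b} \<noteq> {}" using assms(2,6,7) by auto
  ultimately show False using assms(3-5) unfolding connected_closed by blast
qed

text \<open>An excursion into \<open>B\<close> would leave and re-enter \<open>A\<close> through the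
  single point \<open>J\<close>, at two times that injectivity makes equal.\<close>

lemma arc_stays:
  fixes g :: "real \<Rightarrow> 'a::t2_space"
  assumes g: "continuous_on {a..b} g" "inj_on g {a..b}" "g ` {a..b} \<subseteq> A \<union> B" "closed A" "closed B"
    and AB: "A \<inter> B \<subseteq> {J}" and ends: "g a \<in> A" "g b \<in> A"
  shows "g ` {a..b} \<subseteq> A"
proof (rule ccontr)
  assume "\<not> ?thesis"
  then obtain p where p: "p \<in> {a..b}" "g p \<notin> A" by blast
  then have pB: "g p \<in> B" using g(3) by blast
  have "\<exists>t\<in>{a..p}. g t \<in> A \<inter> B"
  proof (rule cont_meets_both[OF continuous_on_subset[OF g(1)]])
    show "g ` {a..p} \<subseteq> A \<union> B" using p g(3) by (force simp: image_subset_iff)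
  qed (use p pB ends g in auto)
  then obtain t where t: "t \<in> {a..p}" "g t \<in> A \<inter> B" by auto
  have "\<exists>t\<in>{p..b}. g t \<in> B \<inter> A"
  proof (rule cont_meets_both[OF continuous_on_subset[OF g(1)]])
    show "g ` {p..b} \<subseteq> B \<union> A" using p g(3) by (force simp: image_subset_iff)
  qed (use p pB ends g in auto)
  then obtain s where s: "s \<in> {p..b}" "g s \<in> B \<inter> A" by auto
  have "g t = g s" using t s AB by auto
  then have "t = s" using g(2) t s p by (auto simp: inj_on_def)
  then have "t = p" using t s by auto
  then show False using t p by auto
qed

lemma arc_splits:
  fixes g :: "real \<Rightarrow> 'a::t2_space"
  assumes g: "continuous_on {a..b} g" "inj_on g {a..b}" "g ` {a..b} \<subseteq> A \<union> B" "closed A" "closed B"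
    and AB: "A \<inter> B \<subseteq> {J}" and ends: "g a \<in> A" "g b \<in> B" "a \<le> b"
  shows "\<exists>t\<in>{a..b}. g t = J \<and> J \<in> A \<inter> B \<and> g ` {a..t} \<subseteq> A \<and> g ` {t..b} \<subseteq> B"
proof -
  obtain t where t: "t \<in> {a..b}" "g t \<in> A \<inter> B"
    using cont_meets_both[OF g(1) ends(3) g(3-5) ends(1,2)] by blast
  have sub: "{a..t} \<subseteq> {a..b}" "{t..b} \<subseteq> {a..b}" using t by auto
  have "g ` {a..t} \<subseteq> A"
    by (rule arc_stays[OF continuous_on_subset[OF g(1) sub(1)] inj_on_subset[OF g(2) sub(1)] _ g(4,5) AB])
      (use g(3) sub t ends in blast)+
  moreover have "g ` {t..b} \<subseteq> B"
    by (rule arc_stays[OF continuous_on_subset[OF g(1) sub(2)] inj_on_subset[OF g(2) sub(2)] _ g(5,4)])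
      (use g(3) sub t ends AB in blast)+
  ultimately show ?thesis using t AB by auto
qed

text \<open>Induction along the chain with \<open>arc_splits\<close>, the head against the union of
  the other cells. Of these only the second meets the head, so the splitting point is the junction
  of the two.\<close>

lemma arc_chain:
  fixes g :: "real \<Rightarrow> 'a::t2_space"
  assumes "p \<noteq> []" "distinct p" "continuous_on {a..b} g" "inj_on g {a..b}" "a \<le> b"
    "g ` {a..b} \<subseteq> (\<Union>v\<in>set p. F v)" "\<And>v. v \<in> set p \<Longrightarrow> closed (F v)"
    "\<And>h k. h < k \<Longrightarrow> k < length p \<Longrightarrow> k \<noteq> Suc h \<Longrightarrow> F (p ! h) \<inter> F (p ! k) = {}"
    "\<And>h. Suc h < length p \<Longrightarrow> F (p ! h) \<inter> F (p ! Suc h) \<subseteq> {J (p ! h) (p ! Suc h)}"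
    "g a \<in> F (hd p)" "g b \<in> F (last p)"
  shows "\<exists>t. t 0 = a \<and> t (length p) = b \<and>
    (\<forall>h<length p. a \<le> t h \<and> t h \<le> t (Suc h) \<and> t (Suc h) \<le> b \<and> g ` {t h..t (Suc h)} \<subseteq> F (p ! h)) \<and>
    (\<forall>h. Suc h < length p \<longrightarrow> g (t (Suc h)) = J (p ! h) (p ! Suc h) \<and>
       g (t (Suc h)) \<in> F (p ! h) \<inter> F (p ! Suc h))"
  using assms
proof (induction p arbitrary: a)
  case Nil
  then show ?case by simp
next
  case (Cons v p)
  show ?case
  proof (cases "p = []")
    case True
    show ?thesis
      by (rule exI[of _ "\<lambda>n. if n = 0 then a else b"]) (use Cons.prems True in auto)
  next
    case False
    let ?B = "\<Union>w\<in>set p. F w"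
    obtain w p' where p': "p = w # p'" using False by (cases p) auto
    have clB: "closed ?B" using Cons.prems by (intro closed_UN) auto
    have AB: "F v \<inter> ?B \<subseteq> {J v w}"
    proof
      fix x assume x: "x \<in> F v \<inter> ?B"
      then obtain k where k: "k < length p" "x \<in> F (p ! k)" by (auto simp: in_set_conv_nth)
      show "x \<in> {J v w}"
      proof (cases k)
        case 0
        then show ?thesis using Cons.prems(9)[of 0] x k p' by auto
      next
        case (Suc k')
        then show ?thesis using Cons.prems(8)[of 0 "Suc k"] x k by auto
      qed
    qed
    obtain t1 where t1: "t1 \<in> {a..b}" "g t1 = J v w" "J v w \<in> F v \<inter> ?B" "g ` {a..t1} \<subseteq> F v"
      "g ` {t1..b} \<subseteq> ?B"
    proof -
      have "g ` {a..b} \<subseteq> F v \<union> ?B" "closed (F v)" "g a \<in> F v" "g b \<in> ?B"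
        using Cons.prems(6,7,10,11) False by (simp_all, metis last_in_set)
      from arc_splits[OF Cons.prems(3,4) this(1,2) clB AB this(3,4) Cons.prems(5)] that
      show ?thesis by blast
    qed
    obtain k where k: "k < length p" "J v w \<in> F (p ! k)" using t1(3) by (auto simp: in_set_conv_nth)
    \<comment> \<open>The cells from the third on are disjoint from the head; hence the splitting
      point lies in \<open>F w\<close>, as the induction hypothesis requires of the new starting
      point.\<close>
    have "k = 0"
      using Cons.prems(8)[of 0 "Suc k"] k t1(3) by (cases k) auto
    then have gw: "g t1 \<in> F w" using k t1 p' by auto
    have "\<exists>t. t 0 = t1 \<and> t (length p) = b \<and>
      (\<forall>h<length p. t1 \<le> t h \<and> t h \<le> t (Suc h) \<and> t (Suc h) \<le> b \<and> g ` {t h..t (Suc h)} \<subseteq> F (p ! h)) \<and>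
      (\<forall>h. Suc h < length p \<longrightarrow> g (t (Suc h)) = J (p ! h) (p ! Suc h) \<and>
       g (t (Suc h)) \<in> F (p ! h) \<inter> F (p ! Suc h))"
    proof (rule Cons.IH)
      fix h k assume "h < k" "k < length p" "k \<noteq> Suc h"
      then show "F (p ! h) \<inter> F (p ! k) = {}" using Cons.prems(8)[of "Suc h" "Suc k"] by auto
    next
      fix h assume "Suc h < length p"
      then show "F (p ! h) \<inter> F (p ! Suc h) \<subseteq> {J (p ! h) (p ! Suc h)}"
        using Cons.prems(9)[of "Suc h"] by simp
    next
      have sub: "{t1..b} \<subseteq> {a..b}" using t1 by simp
      show "continuous_on {t1..b} g" by (rule continuous_on_subset[OF Cons.prems(3) sub])
      show "inj_on g {t1..b}" by (rule inj_on_subset[OF Cons.prems(4) sub])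
    qed (use Cons.prems(2,7,11) t1 False gw p' in simp_all)
    then obtain t where t: "t 0 = t1" "t (length p) = b"
      "\<And>h. h < length p \<Longrightarrow> t1 \<le> t h \<and> t h \<le> t (Suc h) \<and> t (Suc h) \<le> b \<and> g ` {t h..t (Suc h)} \<subseteq> F (p ! h)"
      "\<And>h. Suc h < length p \<Longrightarrow> g (t (Suc h)) = J (p ! h) (p ! Suc h) \<and>
       g (t (Suc h)) \<in> F (p ! h) \<inter> F (p ! Suc h)" by blast
    show ?thesis
    proof (intro exI[of _ "case_nat a t"] conjI allI impI)
      fix h assume h: "h < length (v # p)"
      show "a \<le> case_nat a t h" "case_nat a t h \<le> case_nat a t (Suc h)"
        "case_nat a t (Suc h) \<le> b"
        "g ` {case_nat a t h..case_nat a t (Suc h)} \<subseteq> F ((v # p) ! h)"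
        using h t(1) t(3)[of "h - 1"] t1 t(2) by (cases h; auto)+
    next
      fix h assume h: "Suc h < length (v # p)"
      show "g (case_nat a t (Suc h)) = J ((v # p) ! h) ((v # p) ! Suc h)"
        using h t(1) t(4)[of "h - 1"] t1 p' by (cases h) auto
      show "g (case_nat a t (Suc h)) \<in> F ((v # p) ! h) \<inter> F ((v # p) ! Suc h)"
        using h t(1) t(4)[of "h - 1"] t1 p' gw by (cases h) auto
    qed (use t in auto)
  qed
qed

context tree_graph
begin

text \<open>A branch off the path from \<open>u\<close> to \<open>v\<close> is attached in at most
  one point, so by \<open>arc_stays\<close> every point of the injective path that lies in a side
  cell also lies in the parent cell. Climbing up the tree puts the image into the cells of the path,
  where \<open>arc_chain\<close> takes over.\<close>

lemma tree_arc:
  fixes g :: "real \<Rightarrow> 'b::t2_space"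
  assumes fin: "finite V" and irr: "\<And>x. \<not> E x x"
    and cl: "\<And>v. v \<in> V \<Longrightarrow> closed (F v)"
    and adj: "\<And>v w. v \<in> V \<Longrightarrow> w \<in> V \<Longrightarrow> E v w \<Longrightarrow> F v \<inter> F w \<subseteq> {J v w}"
    and nonadj: "\<And>v w. v \<in> V \<Longrightarrow> w \<in> V \<Longrightarrow> v \<noteq> w \<Longrightarrow> \<not> E v w \<Longrightarrow> F v \<inter> F w = {}"
    and p: "path_from_to V E u v p"
    and g: "continuous_on {a..b} g" "inj_on g {a..b}" "a \<le> b" "g ` {a..b} \<subseteq> (\<Union>w\<in>V. F w)"
      "g a \<in> F u" "g b \<in> F v"
  shows "\<exists>t. t 0 = a \<and> t (length p) = b \<and>
    (\<forall>h<length p. a \<le> t h \<and> t h \<le> t (Suc h) \<and> t (Suc h) \<le> b \<and> g ` {t h..t (Suc h)} \<subseteq> F (p ! h)) \<and>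
    (\<forall>h. Suc h < length p \<longrightarrow> g (t (Suc h)) = J (p ! h) (p ! Suc h) \<and>
       g (t (Suc h)) \<in> F (p ! h) \<inter> F (p ! Suc h))"
proof -
  have pV: "set p \<subseteq> V" "p \<noteq> []" "distinct p" "hd p = u" "last p = v" "successively E p"
    using p by (auto simp: path_from_to_def simple_path_def)
  then have u: "u \<in> V" and v: "v \<in> V" by (meson hd_in_set last_in_set subsetD)+
  let ?tp = "tree_path V E u"
  have tpv: "?tp v = p" by (rule tree_path_eq[OF p])
  have tp: "path_from_to V E u w (?tp w)" if "w \<in> V" for w by (rule tree_path[OF u that])
  have tpset: "set (?tp w) \<subseteq> V" "w \<in> set (?tp w)" "distinct (?tp w)" "?tp w \<noteq> []"
    if "w \<in> V" for w
    using tp[OF that] last_in_set by (force simp: path_from_to_def simple_path_def)+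
  have tph: "?tp (p ! h) = take (Suc h) p" if "h < length p" for h
  proof -
    have "p = take h p @ p ! h # drop (Suc h) p" using that by (simp add: id_take_nth_drop)
    then have "path_from_to V E u (p ! h) (take h p @ [p ! h])"
      using path_from_to_prefix[of V E u v "take h p" "p ! h" "drop (Suc h) p"] p by metis
    then show ?thesis using tree_path_eq that by (metis take_Suc_conv_app_nth)
  qed
  \<comment> \<open>The part of the tree behind \<open>w\<close> hangs on it by the edge to its parent only.\<close>
  have prune: "\<exists>x\<in>V. E x w \<and> ?tp w = ?tp x @ [w] \<and> z \<in> F x"
    if w: "w \<in> V" "w \<notin> set p" and z: "z \<in> F w" "z \<in> g ` {a..b}" for w z
  proof -
    let ?B = "{y\<in>V. w \<in> set (?tp y)}" and ?A = "{y\<in>V. w \<notin> set (?tp y)}"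
    \<comment> \<open>A contact between the inside and the outside of the branch is an edge of the
      tree; as \<open>w\<close> lies on only one of the two tree paths, it is the edge from the
      parent of \<open>w\<close> to \<open>w\<close>.\<close>
    have key: "y = w \<and> E x w \<and> ?tp w = ?tp x @ [w]" if "x \<in> ?A" "y \<in> ?B" "F x \<inter> F y \<noteq> {}" for x y
    proof -
      have "x \<noteq> y" using that by auto
      then have "E x y" using nonadj that by blast
      then show ?thesis using tree_path_parent[OF u, of x y] that \<open>x \<noteq> y\<close> by auto
    qed
    let ?FA = "\<Union>x\<in>?A. F x" and ?FB = "\<Union>x\<in>?B. F x"
    obtain J0 where J0: "?FA \<inter> ?FB \<subseteq> {J0}"
    proof (cases "?FA \<inter> ?FB = {}")
      case True
      then show ?thesis using that by auto
    next
      case False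
      then obtain x y where xy: "x \<in> ?A" "y \<in> ?B" "F x \<inter> F y \<noteq> {}" by blast
      have "?FA \<inter> ?FB \<subseteq> {J x w}"
      proof
        fix z assume "z \<in> ?FA \<inter> ?FB"
        then obtain x' y' where xy': "x' \<in> ?A" "y' \<in> ?B" "z \<in> F x'" "z \<in> F y'" by blast
        then have k: "y' = w" "E x' w" "?tp w = ?tp x' @ [w]" using key[of x' y'] by blast+
        have "?tp w = ?tp x @ [w]" using key[OF xy] by blast
        then have "?tp x = ?tp x'" using k(3) by (metis butlast_snoc)
        moreover have "last (?tp x) = x" "last (?tp x') = x'"
          using tp[of x] tp[of x'] xy(1) xy'(1) unfolding path_from_to_def by blast+
        ultimately have "x = x'" by metis
        moreover have "z \<in> F x'" "z \<in> F w" "x' \<in> V"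
          using xy'(1,3,4) k(1) by blast+
        ultimately show "z \<in> {J x w}" using adj[of x' w] k(2) w(1) by blast
      qed
      then show ?thesis using that by blast
    qed
    have tpu: "?tp u = [u]"
      by (rule tree_path_eq) (use u in \<open>auto simp: path_from_to_def simple_path_def\<close>)
    have uA: "u \<in> ?A" "v \<in> ?A" using u v w tpv tpu pV(1,2,4) hd_in_set[of p] by auto
    have "g ` {a..b} \<subseteq> ?FA"
    proof (rule arc_stays[OF g(1,2) _ _ _ J0])
      show "g ` {a..b} \<subseteq> ?FA \<union> ?FB" using g(4) by blast
      show "closed ?FA" "closed ?FB" using fin cl by (auto intro!: closed_UN)
      show "g a \<in> ?FA" "g b \<in> ?FA" using uA g(5,6) by blast+
    qed
    then obtain x where x: "x \<in> ?A" "z \<in> F x" using z by blast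
    then have "E x w \<and> ?tp w = ?tp x @ [w]" using key[of x w] z w tpset by blast
    then show ?thesis using x by blast
  qed
  have "g ` {a..b} \<subseteq> (\<Union>w\<in>set p. F w)"
  proof
    fix z assume z: "z \<in> g ` {a..b}"
    have "z \<in> (\<Union>w\<in>set p. F w)" if "w \<in> V" "z \<in> F w" for w
      using that
    proof (induction "length (?tp w)" arbitrary: w rule: less_induct)
      case less
      show ?case
      proof (cases "w \<in> set p")
        case False
        then obtain x where x: "x \<in> V" "?tp w = ?tp x @ [w]" "z \<in> F x"
          using prune[of w z] z less by blast
        then have "length (?tp x) < length (?tp w)" by simp
        then show ?thesis using less.hyps x by blast
      qed (use less in auto)
    qed
    then show "z \<in> (\<Union>w\<in>set p. F w)" using g(4) z by blast
  qed
  moreover have "F (p ! h) \<inter> F (p ! k) = {}" if hk: "h < k" "k < length p" "k \<noteq> Suc h" for h k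
  proof -
    have pn: "p ! h \<in> V" "p ! k \<in> V" "p ! h \<noteq> p ! k"
      using hk pV by (auto simp: nth_eq_iff_index_eq subset_iff)
    \<comment> \<open>Along the path the depth below \<open>u\<close> is given by the position, and
      by \<open>tree_path_parent\<close> the depths of adjacent vertices differ by one.\<close>
    have "\<not> E (p ! h) (p ! k)"
    proof
      assume "E (p ! h) (p ! k)"
      then have "length (?tp (p ! k)) = Suc (length (?tp (p ! h))) \<or>
        length (?tp (p ! h)) = Suc (length (?tp (p ! k)))"
        using tree_path_parent[OF u pn(1,2) _ pn(3)] by (metis length_append_singleton)
      moreover have "length (?tp (p ! h)) = Suc h" "length (?tp (p ! k)) = Suc k"
        using tph[of h] tph[of k] hk by simp_all
      ultimately show False using hk by auto
    qed
    then show ?thesis using nonadj pn by blast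
  qed
  moreover have "F (p ! h) \<inter> F (p ! Suc h) \<subseteq> {J (p ! h) (p ! Suc h)}" if "Suc h < length p" for h
  proof -
    have "E (p ! h) (p ! Suc h)" using pV(6) that by (simp add: successively_conv_nth)
    then show ?thesis using adj[of "p ! h" "p ! Suc h"] pV that by (auto simp: subset_iff)
  qed
  ultimately show ?thesis
    using pV(1) cl by (intro arc_chain[OF pV(2,3) g(1-3)]) (auto simp: pV(4,5) g(5,6))
qed

end

section \<open>Bounds for the Hausdorff dimension\<close>

text \<open>For \<open>s\<close> above the claimed dimension the \<open>s\<close>-sum of the
  \<open>n\<close>-th cover is at most \<open>C * c powr s * (\<theta> / b powr s)^n\<close>, a null
  sequence.\<close>

lemma hausdorff_dim_le:
  fixes A :: "'a::metric_space set"
  assumes b: "b > 1" and \<theta>: "\<theta> \<ge> 1" and c: "c > 0" and C: "C \<ge> 0"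
    and cover: "\<And>n. \<exists>Us. A \<subseteq> \<Union>(set Us) \<and> (\<forall>U\<in>set Us. bounded U \<and> diameter U \<le> c * (1/b)^n)
      \<and> real (length Us) \<le> C * \<theta>^n"
  shows "hausdorff_dim A \<le> ereal (log b \<theta>)"
proof (rule ereal_le_epsilon2)
  fix e :: real assume e: "e > 0"
  define s where "s = log b \<theta> + e"
  have L: "log b \<theta> \<ge> 0" using b \<theta> by simp
  then have s: "s > 0" using e by (simp add: s_def)
  define x where "x = \<theta> / (b powr s)"
  have "b powr s = \<theta> * b powr e" using b \<theta> by (simp add: s_def powr_add)
  moreover have "b powr e > 1" using b e by simp
  ultimately have x: "0 < x" "x < 1" using \<theta> b by (simp_all add: x_def)
  have pre: "hausdorff_pre_measure s \<delta> A = 0" if \<delta>: "\<delta> > 0" for \<delta>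
  proof -
    have "(\<lambda>n. c * (1/b)^n) \<longlonglongrightarrow> c * 0"
      using b by (intro tendsto_mult_left LIMSEQ_realpow_zero) auto
    then have ev: "eventually (\<lambda>n. c * (1/b)^n < \<delta>) sequentially"
      using \<delta> by (intro order_tendstoD(2)) auto
    have le: "hausdorff_pre_measure s \<delta> A \<le> ennreal (C * c powr s * x^n)"
      if n: "c * (1/b)^n < \<delta>" for n
    proof -
      obtain Us where Us: "A \<subseteq> \<Union>(set Us)" "\<forall>U\<in>set Us. bounded U \<and> diameter U \<le> c * (1/b)^n"
        "real (length Us) \<le> C * \<theta>^n" using cover by blast
      \<comment> \<open>Padding with empty sets costs nothing, since \<open>diam_powr\<close>
        vanishes on the empty set.\<close>
      define U where "U i = (if i < length Us then Us ! i else {})" for i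
      have U: "A \<subseteq> (\<Union>i. U i)" "\<forall>i. bounded (U i) \<and> diameter (U i) \<le> \<delta>"
      proof -
        show "A \<subseteq> (\<Union>i. U i)"
        proof
          fix a assume "a \<in> A"
          then obtain V where "V \<in> set Us" "a \<in> V" using Us by blast
          then obtain i where "i < length Us" "a \<in> Us ! i" by (auto simp: in_set_conv_nth)
          then show "a \<in> (\<Union>i. U i)" by (auto simp: U_def intro!: exI[of _ i])
        qed
        show "\<forall>i. bounded (U i) \<and> diameter (U i) \<le> \<delta>"
        proof
          fix i show "bounded (U i) \<and> diameter (U i) \<le> \<delta>"
          proof (cases "i < length Us")
            case True
            then have "bounded (Us ! i) \<and> diameter (Us ! i) \<le> c * (1/b)^n" using Us(2) nth_mem by blast
            then show ?thesis using n True by (simp add: U_def)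
          next
            case False
            then show ?thesis using \<delta> by (simp add: U_def)
          qed
        qed
      qed
      have dp: "diam_powr s (U i) \<le> (c * (1/b)^n) powr s" if "i < length Us" for i
        using Us(2) that s nth_mem[of i Us]
        by (auto simp: diam_powr_def U_def intro!: powr_mono2 diameter_ge_0)
      have "hausdorff_pre_measure s \<delta> A \<le> (\<Sum>i. ennreal (diam_powr s (U i)))"
        unfolding hausdorff_pre_measure_def by (rule INF_lower) (use U in auto)
      also have "\<dots> = (\<Sum>i<length Us. ennreal (diam_powr s (U i)))"
        by (rule suminf_finite) (auto simp: U_def diam_powr_def)
      also have "\<dots> \<le> (\<Sum>i<length Us. ennreal ((c * (1/b)^n) powr s))"
        using dp by (intro sum_mono ennreal_leI) auto
      also have "\<dots> = ennreal (real (length Us) * (c * (1/b)^n) powr s)"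
        by (simp add: ennreal_mult' ennreal_of_nat_eq_real_of_nat)
      also have "\<dots> \<le> ennreal (C * \<theta>^n * (c * (1/b)^n) powr s)"
        using Us(3) by (intro ennreal_leI mult_right_mono) auto
      also have "C * \<theta>^n * (c * (1/b)^n) powr s = C * c powr s * x^n"
      proof -
        have "((1/b)^n) powr s = (1 / (b powr s))^n"
          using b by (simp add: powr_realpow[symmetric] powr_powr powr_divide mult.commute)
        moreover have "(c * (1/b)^n) powr s = c powr s * ((1/b)^n) powr s"
          by (rule powr_mult)
        ultimately show ?thesis by (simp add: x_def power_divide)
      qed
      finally show ?thesis .
    qed
    have "(\<lambda>n. ennreal (C * c powr s * x^n)) \<longlonglongrightarrow> ennreal (C * c powr s * 0)"
      using x by (intro tendsto_ennrealI tendsto_mult_left LIMSEQ_realpow_zero) auto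
    then have "hausdorff_pre_measure s \<delta> A \<le> ennreal (C * c powr s * 0)"
      by (rule tendsto_lowerbound) (use ev le in \<open>auto elim: eventually_mono\<close>)
    then show ?thesis by simp
  qed
  have "hausdorff_measure s A = 0"
    unfolding hausdorff_measure_def using pre by (intro antisym SUP_least) auto
  then have "hausdorff_dim A \<le> ereal s"
    unfolding hausdorff_dim_def by (intro INF_lower) (use s in auto)
  then show "hausdorff_dim A \<le> ereal (log b \<theta>) + ereal e" by (simp add: s_def)
qed

lemma power_bracket:
  fixes b r :: real
  assumes "b > 1" "0 < r" "r \<le> 1"
  shows "\<exists>n. (1/b)^(Suc n) < r \<and> r \<le> (1/b)^n"
proof -
  have "\<exists>n. (1/b)^n < r" using assms real_arch_pow_inv[of r "1/b"] by auto
  then obtain k where k: "(1/b)^k < r" "\<And>j. j < k \<Longrightarrow> \<not> (1/b)^j < r"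
    using exists_least_iff[of "\<lambda>n. (1/b)^n < r"] by blast
  then obtain n where "k = Suc n" using assms by (cases k) auto
  then show ?thesis using k by (intro exI[of _ n]) (auto simp: not_less)
qed

text \<open>The image of Lebesgue measure under the parametrisation serves as the mass distribution.\<close>

lemma hausdorff_dim_ge:
  fixes A :: "'a::metric_space set" and f :: "real \<Rightarrow> 'a"
  assumes b: "b > 1" and \<theta>: "\<theta> > 1" and d: "d > 0" and w: "w > 0" and f: "f ` {0..d} \<subseteq> A"
    and cover: "\<And>n U. \<lbrakk>bounded U; diameter U \<le> (1/b)^n\<rbrakk> \<Longrightarrow> \<exists>Z. finite Z \<and> card Z \<le> N \<and>
      {t\<in>{0..d}. f t \<in> U} \<subseteq> (\<Union>z\<in>Z. {z - w/\<theta>^n..z + w/\<theta>^n})"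
  shows "ereal (log b \<theta>) \<le> hausdorff_dim A"
  unfolding hausdorff_dim_def
proof (rule INF_greatest, clarsimp)
  fix s :: real assume s: "0 \<le> s" and H0: "hausdorff_measure s A = 0"
  show "log b \<theta> \<le> s"
  proof (rule ccontr)
    assume "\<not> ?thesis"
    then have "b powr s \<le> b powr (log b \<theta>)" using b by (intro powr_mono) auto
    then have bs: "b powr s \<le> \<theta>" using b \<theta> by simp
    \<comment> \<open>The factor \<theta> pays for rounding a diameter up to a power of
      \<open>1/b\<close>; the summand \<open>1\<close> keeps \<open>C\<close> positive when
      \<open>N = 0\<close>.\<close>
    define C where "C = real N * (2 * w) * \<theta> + 1"
    have C: "C > 0" using w \<theta> by (auto simp: C_def intro!: add_nonneg_pos)
    \<comment> \<open>Preimages under \<open>f\<close> are not known to be measurable, so a finite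
      union of intervals around them is measured instead.\<close>
    have J: "\<exists>J\<in>sets lborel. {t\<in>{0..d}. f t \<in> U} \<subseteq> J \<and> emeasure lborel J \<le> ennreal (real N * (2*w/\<theta>^n))"
      if U: "bounded U" "diameter U \<le> (1/b)^n" for n U
    proof -
      obtain Z where Z: "finite Z" "card Z \<le> N"
        "{t\<in>{0..d}. f t \<in> U} \<subseteq> (\<Union>z\<in>Z. {z - w/\<theta>^n..z + w/\<theta>^n})" using cover[OF U] by blast
      let ?J = "\<Union>z\<in>Z. {z - w/\<theta>^n..z + w/\<theta>^n}"
      have "emeasure lborel ?J \<le> (\<Sum>z\<in>Z. emeasure lborel {z - w/\<theta>^n..z + w/\<theta>^n})"
        using Z by (intro emeasure_subadditive_finite) auto
      also have "\<dots> = (\<Sum>z\<in>Z. ennreal (2*w/\<theta>^n))"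
      proof (rule sum.cong)
        fix z have "z - w/\<theta>^n \<le> z + w/\<theta>^n" using w \<theta> by simp
        then show "emeasure lborel {z - w/\<theta>^n..z + w/\<theta>^n} = ennreal (2*w/\<theta>^n)" by simp
      qed simp
      also have "\<dots> = ennreal (\<Sum>z\<in>Z. 2*w/\<theta>^n)"
        using w \<theta> by (intro sum_ennreal) auto
      also have "\<dots> = ennreal (real (card Z) * (2*w/\<theta>^n))" by simp
      also have "\<dots> \<le> ennreal (real N * (2*w/\<theta>^n))"
        using Z w \<theta> by (intro ennreal_leI mult_right_mono) auto
      finally have "emeasure lborel ?J \<le> ennreal (real N * (2*w/\<theta>^n))" .
      moreover have "?J \<in> sets lborel" using Z(1) by (intro sets.finite_UN) auto
      ultimately show ?thesis using Z(3) by blast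
    qed
    have key: "\<exists>J\<in>sets lborel. {t\<in>{0..d}. f t \<in> U} \<subseteq> J \<and> emeasure lborel J \<le> ennreal (C * diam_powr s U)"
      if U: "bounded U" "diameter U \<le> 1" for U
    proof -
      consider "U = {}" | "U \<noteq> {}" "s = 0" | "U \<noteq> {}" "s > 0" "diameter U = 0"
        | "U \<noteq> {}" "s > 0" "diameter U > 0"
        using s diameter_ge_0[OF U(1)] by fastforce
      then show ?thesis
      proof cases
        case 1
        then show ?thesis by (intro bexI[of _ "{}"]) auto
      next
        case 2
        \<comment> \<open>For \<open>s = 0\<close> every nonempty set counts \<open>1\<close>, and
          the cover at level \<open>0\<close> is enough as the diameter is at most
          \<open>1\<close>.\<close>
        have "real N * (2 * w / \<theta>^0) \<le> C"
        proof -
          have "real N * (2 * w) \<le> real N * (2 * w) * \<theta>"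
            using mult_left_mono[of 1 \<theta> "real N * (2 * w)"] w \<theta> by simp
          then have "real N * (2 * w) \<le> C" unfolding C_def by linarith
          then show ?thesis by simp
        qed
        then have "ennreal (real N * (2 * w / \<theta>^0)) \<le> ennreal (C * diam_powr s U)"
          using 2 by (intro ennreal_leI) (simp add: diam_powr_def)
        moreover obtain J where "J \<in> sets lborel" "{t\<in>{0..d}. f t \<in> U} \<subseteq> J"
          "emeasure lborel J \<le> ennreal (real N * (2*w/\<theta>^0))" using J[of U 0] U by auto
        ultimately show ?thesis by (meson order_trans)
      next
        case 3
        \<comment> \<open>A set of diameter \<open>0\<close> contributes nothing when
          \<open>s > 0\<close>, so its preimage has to be null: the covers of all levels are
          intersected.\<close>
        have "\<forall>n. \<exists>J. J\<in>sets lborel \<and> {t\<in>{0..d}. f t \<in> U} \<subseteq> J \<and> emeasure lborel J \<le> ennreal (real N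
          * (2*w/\<theta>^n))"
        proof
          fix n have "diameter U \<le> (1/b)^n" using 3 b by simp
          from J[OF U(1) this] show "\<exists>J. J\<in>sets lborel \<and> {t\<in>{0..d}. f t \<in> U} \<subseteq> J \<and> emeasure lborel J
            \<le> ennreal (real N * (2*w/\<theta>^n))"
            by blast
        qed
        from choice[OF this] obtain I where "\<forall>n. I n \<in> sets lborel \<and> {t\<in>{0..d}. f t \<in> U} \<subseteq> I n \<and>
          emeasure lborel (I n) \<le> ennreal (real N * (2*w/\<theta>^n))" by (elim exE)
        then have I: "\<And>n. I n \<in> sets lborel" "\<And>n. {t\<in>{0..d}. f t \<in> U} \<subseteq> I n"
          "\<And>n. emeasure lborel (I n) \<le> ennreal (real N * (2*w/\<theta>^n))" by simp_all
        have "emeasure lborel (\<Inter>n. I n) \<le> ennreal (real N * (2*w) * (1/\<theta>)^n)" for n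
        proof -
          have "emeasure lborel (\<Inter>n. I n) \<le> emeasure lborel (I n)"
            using I(1) by (intro emeasure_mono) auto
          also have "\<dots> \<le> ennreal (real N * (2*w/\<theta>^n))" by (rule I)
          finally show ?thesis by (simp add: power_divide)
        qed
        moreover have "(\<lambda>n. ennreal (real N * (2*w) * (1/\<theta>)^n)) \<longlonglongrightarrow> ennreal (real N * (2*w) * 0)"
          using \<theta> by (intro tendsto_ennrealI tendsto_mult_left LIMSEQ_realpow_zero) auto
        ultimately have "emeasure lborel (\<Inter>n. I n) \<le> ennreal (real N * (2*w) * 0)"
          by (intro tendsto_lowerbound[where F = sequentially]) (auto simp del: mult_zero_right)
        then have "emeasure lborel (\<Inter>n. I n) \<le> ennreal (C * diam_powr s U)" by simp
        moreover have "(\<Inter>n. I n) \<in> sets lborel" using I(1) by (intro sets.countable_INT) auto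
        ultimately show ?thesis using I(2) by (intro bexI[of _ "\<Inter>n. I n"]) auto
      next
        case 4
        obtain n where n: "(1/b)^(Suc n) < diameter U" "diameter U \<le> (1/b)^n"
          using power_bracket[OF b 4(3) U(2)] by blast
        obtain J where J': "J \<in> sets lborel" "{t\<in>{0..d}. f t \<in> U} \<subseteq> J"
          "emeasure lborel J \<le> ennreal (real N * (2*w/\<theta>^n))" using J[OF U(1) n(2)] by blast
        have "(1/\<theta>)^(Suc n) \<le> (1 / (b powr s))^(Suc n)"
          using bs b \<theta> by (intro power_mono divide_left_mono) auto
        also have "\<dots> = ((1/b)^(Suc n)) powr s"
          using b by (simp only: powr_realpow[symmetric] zero_less_divide_1_iff powr_gt_zero)
            (simp add: powr_powr powr_divide mult.commute powr_realpow[symmetric] )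
        also have "\<dots> \<le> diameter U powr s" using n(1) s b by (intro powr_mono2) auto
        finally have le: "(1/\<theta>)^(Suc n) \<le> diameter U powr s" .
        have "real N * (2*w/\<theta>^n) = real N * (2*w) * \<theta> * (1/\<theta>)^(Suc n)"
          using \<theta> by (simp add: power_divide)
        also have "\<dots> \<le> C * (1/\<theta>)^(Suc n)"
          using \<theta> by (intro mult_right_mono) (auto simp: C_def)
        also have "\<dots> \<le> C * diam_powr s U"
          using le 4 C by (intro mult_left_mono) (auto simp: diam_powr_def)
        finally have "ennreal (real N * (2*w/\<theta>^n)) \<le> ennreal (C * diam_powr s U)" by (rule ennreal_leI)
        then show ?thesis using J' by (meson order_trans)
      qed
    qed
    have "hausdorff_pre_measure s 1 A \<le> hausdorff_measure s A"
      unfolding hausdorff_measure_def by (rule SUP_upper) auto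
    \<comment> \<open>A cover of total weight below \<open>d / (2 * C)\<close> would cover
      \<open>{0..d}\<close> by sets of total length at most \<open>d / 2\<close>.\<close>
    then have "hausdorff_pre_measure s 1 A < ennreal (d / (2 * C))"
      using H0 d C by (simp add: zero_less_iff_neq_zero)
    then obtain U :: "nat \<Rightarrow> 'a set" where U: "A \<subseteq> (\<Union>i. U i)" "\<And>i. bounded (U i)" "\<And>i. diameter (U i) \<le> 1"
      "(\<Sum>i. ennreal (diam_powr s (U i))) < ennreal (d / (2 * C))"
      unfolding hausdorff_pre_measure_def INF_less_iff by auto
    have "\<forall>i. \<exists>J. J\<in>sets lborel \<and> {t\<in>{0..d}. f t \<in> U i} \<subseteq> J \<and>
      emeasure lborel J \<le> ennreal (C * diam_powr s (U i))"
      using key[OF U(2,3)] by (simp add: Bex_def)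
    from choice[OF this] obtain I where "\<forall>i. I i \<in> sets lborel \<and> {t\<in>{0..d}. f t \<in> U i} \<subseteq> I i \<and>
      emeasure lborel (I i) \<le> ennreal (C * diam_powr s (U i))" by (elim exE)
    then have I: "\<And>i. I i \<in> sets lborel" "\<And>i. {t\<in>{0..d}. f t \<in> U i} \<subseteq> I i"
      "\<And>i. emeasure lborel (I i) \<le> ennreal (C * diam_powr s (U i))" by simp_all
    have "{0..d} \<subseteq> (\<Union>i. I i)"
    proof
      fix t assume t: "t \<in> {0..d}"
      then obtain i where "f t \<in> U i" using f U(1) by blast
      then show "t \<in> (\<Union>i. I i)" using I(2)[of i] t by blast
    qed
    then have "emeasure lborel {0..d} \<le> emeasure lborel (\<Union>i. I i)"
      using I(1) by (intro emeasure_mono) auto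
    also have "\<dots> \<le> (\<Sum>i. emeasure lborel (I i))"
      using I(1) by (intro emeasure_subadditive_countably) auto
    also have "\<dots> \<le> (\<Sum>i. ennreal C * ennreal (diam_powr s (U i)))"
      using I(3) C by (intro suminf_le) (auto simp: ennreal_mult')
    also have "\<dots> = ennreal C * (\<Sum>i. ennreal (diam_powr s (U i)))" by simp
    also have "\<dots> \<le> ennreal C * ennreal (d / (2 * C))"
      using U(4) by (intro mult_left_mono) auto
    also have "\<dots> = ennreal (d / 2)" using C d by (simp add: ennreal_mult'[symmetric])
    finally show False using d by simp
  qed
qed

section \<open>Curves generated by chains of similarities\<close>

text \<open>A junction time belongs to the earlier piece, and the last piece takes all remaining
  times, so no bound on \<open>t\<close> is built in.\<close>

fun glue :: "real list \<Rightarrow> (nat \<Rightarrow> real \<Rightarrow> 'a) \<Rightarrow> real \<Rightarrow> 'a" where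
  "glue [] F t = F 0 t"
| "glue (d # ds) F t = (if t \<le> d \<or> ds = [] then F 0 t else glue ds (\<lambda>h. F (Suc h)) (t - d))"

text \<open>\<open>h\<close> and \<open>s\<close> depend on the time alone; two curves glued with
  the same durations can therefore be compared piece by piece.\<close>

lemma glue_cases:
  assumes "ds \<noteq> []" "0 \<le> t" "t \<le> sum_list ds"
  shows "\<exists>h<length ds. \<exists>s\<in>{0..ds ! h}. t = sum_list (take h ds) + s \<and>
    (\<forall>F :: nat \<Rightarrow> real \<Rightarrow> 'a. glue ds F t = F h s)"
  using assms
proof (induction ds arbitrary: t)
  case Nil
  then show ?case by simp
next
  case (Cons d ds)
  show ?case
  proof (cases "t \<le> d \<or> ds = []")
    case True
    then show ?thesis using Cons.prems by (intro exI[of _ 0]) auto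
  next
    case False
    then obtain h s where "h < length ds" "s \<in> {0..ds ! h}" "t - d = sum_list (take h ds) + s"
      "\<forall>F :: nat \<Rightarrow> real \<Rightarrow> 'a. glue ds F (t - d) = F h s"
      using Cons.IH[of "t - d"] Cons.prems by auto
    then show ?thesis using False by (intro exI[of _ "Suc h"]) (auto intro!: bexI[of _ s])
  qed
qed

lemma glue_0:
  assumes "ds \<noteq> [] \<Longrightarrow> 0 \<le> hd ds"
  shows "glue ds F 0 = F 0 0"
  using assms by (cases ds) auto

lemma glue_at:
  assumes "h < length ds" "0 \<le> s" "s \<le> ds ! h" "\<And>d. d \<in> set ds \<Longrightarrow> 0 \<le> d"
    "\<And>h. Suc h < length ds \<Longrightarrow> F h (ds ! h) = F (Suc h) 0"
  shows "glue ds F (sum_list (take h ds) + s) = F h s"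
  using assms
proof (induction ds arbitrary: h F)
  case Nil
  then show ?case by simp
next
  case (Cons d ds)
  show ?case
  proof (cases h)
    case 0
    then show ?thesis using Cons.prems by auto
  next
    case (Suc k)
    have IH: "glue ds (\<lambda>h. F (Suc h)) (sum_list (take k ds) + s) = F (Suc k) s"
    proof (rule Cons.IH)
      fix h assume "Suc h < length ds"
      then show "F (Suc h) (ds ! h) = F (Suc (Suc h)) 0" using Cons.prems(5)[of "Suc h"] by simp
    qed (use Cons.prems Suc in auto)
    show ?thesis
    \<comment> \<open>At the end time of the first piece \<open>glue\<close> still evaluates that
      piece, and the matching condition is needed to pass to the next one.\<close>
    proof (cases "sum_list (take k ds) + s = 0")
      case True
      have "sum_list (take k ds) \<ge> 0"
        using Cons.prems(4) by (intro sum_list_nonneg) (auto dest: in_set_takeD)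
      then have "s = 0" using True Cons.prems by auto
      have "ds \<noteq> []" using Cons.prems(1) Suc by auto
      then have "F 0 d = F 1 0" using Cons.prems(5)[of 0] by simp
      moreover have "glue ds (\<lambda>h. F (Suc h)) 0 = F 1 0"
        using Cons.prems(4) by (subst glue_0) auto
      ultimately show ?thesis using IH True Suc by (simp add: add.assoc)
    next
      case False
      have "sum_list (take k ds) \<ge> 0"
        using Cons.prems(4) by (intro sum_list_nonneg) (auto dest: in_set_takeD)
      then have "sum_list (take k ds) + s > 0" using False Cons.prems by auto
      then have "\<not> sum_list (take h (d # ds)) + s \<le> d" using Suc by simp
      moreover have "ds \<noteq> []" using Suc Cons.prems by auto
      moreover have "sum_list (take h (d # ds)) + s - d = sum_list (take k ds) + s" using Suc by simp
      ultimately show ?thesis using IH Suc by simp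
    qed
  qed
qed

lemma continuous_on_glue:
  fixes F :: "nat \<Rightarrow> real \<Rightarrow> 'a::topological_space"
  assumes "ds \<noteq> []" "\<And>d. d \<in> set ds \<Longrightarrow> 0 \<le> d"
    "\<And>h. Suc h < length ds \<Longrightarrow> F h (ds ! h) = F (Suc h) 0"
    "\<And>h. h < length ds \<Longrightarrow> continuous_on {0..ds ! h} (F h)"
  shows "continuous_on {0..sum_list ds} (glue ds F)"
  using assms
proof (induction ds arbitrary: F)
  case Nil
  then show ?case by simp
next
  case (Cons d ds)
  show ?case
  proof (cases "ds = []")
    case True
    then show ?thesis using Cons.prems(4)[of 0] by simp
  next
    case False
    have IH: "continuous_on {0..sum_list ds} (glue ds (\<lambda>h. F (Suc h)))"
      using Cons.prems False by (intro Cons.IH) force+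
    have "continuous_on {t \<in> {0..sum_list (d # ds)}. d \<le> t} (\<lambda>t. glue ds (\<lambda>h. F (Suc h)) (t - d))"
      by (rule continuous_on_compose2[OF IH]) (auto intro!: continuous_intros)
    moreover have "continuous_on {t \<in> {0..sum_list (d # ds)}. t \<le> d} (F 0)"
      using Cons.prems(4)[of 0] by (auto intro: continuous_on_subset)
    moreover have "F 0 d = glue ds (\<lambda>h. F (Suc h)) 0"
      using Cons.prems(2) Cons.prems(3)[of 0] False by (subst glue_0) auto
    ultimately have "continuous_on {0..sum_list (d # ds)}
        (\<lambda>t. if t \<le> d then F 0 t else glue ds (\<lambda>h. F (Suc h)) (t - d))"
      by (intro continuous_on_cases_le) auto
    moreover have "glue (d # ds) F = (\<lambda>t. if t \<le> d then F 0 t else glue ds (\<lambda>h. F (Suc h)) (t - d))"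
      using False by (intro ext) auto
    ultimately show ?thesis by simp
  qed
qed

text \<open>Piece \<open>h\<close> of the curve of state \<open>q\<close> is a copy of the curve of state \<open>nxt q h\<close>, run \<open>\<theta>\<close> times
  as fast. The eigenvector equation for \<open>d\<close> makes \<open>d q\<close> a consistent duration for the curve of state
  \<open>q\<close>.\<close>

locale curve_system =
  fixes Q :: "'q set" and len :: "'q \<Rightarrow> nat"
    and \<phi> :: "'q \<Rightarrow> nat \<Rightarrow> 'a::euclidean_space \<Rightarrow> 'a" and nxt :: "'q \<Rightarrow> nat \<Rightarrow> 'q"
    and d :: "'q \<Rightarrow> real" and \<theta> b :: real and X :: "'a set" and sp ep :: "'q \<Rightarrow> 'a" and B :: real
  assumes finQ: "finite Q" and nxtQ: "\<And>q h. q \<in> Q \<Longrightarrow> h < len q \<Longrightarrow> nxt q h \<in> Q"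
    and len: "\<And>q. q \<in> Q \<Longrightarrow> len q > 0" and dpos: "\<And>q. q \<in> Q \<Longrightarrow> d q > 0"
    and dsum: "\<And>q. q \<in> Q \<Longrightarrow> (\<Sum>h<len q. d (nxt q h)) = \<theta> * d q"
    and \<theta>: "\<theta> > 1" and b: "b > 1"
    and X: "closed X" "convex X" and B: "\<And>x y. x \<in> X \<Longrightarrow> y \<in> X \<Longrightarrow> dist x y \<le> B"
    and \<phi>X: "\<And>q h x. q \<in> Q \<Longrightarrow> h < len q \<Longrightarrow> x \<in> X \<Longrightarrow> \<phi> q h x \<in> X"
    and \<phi>dist: "\<And>q h x y. q \<in> Q \<Longrightarrow> h < len q \<Longrightarrow> x \<in> X \<Longrightarrow> y \<in> X \<Longrightarrow>
      dist (\<phi> q h x) (\<phi> q h y) = dist x y / b"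
    and spX: "\<And>q. q \<in> Q \<Longrightarrow> sp q \<in> X" and epX: "\<And>q. q \<in> Q \<Longrightarrow> ep q \<in> X"
    and \<phi>sp: "\<And>q. q \<in> Q \<Longrightarrow> \<phi> q 0 (sp (nxt q 0)) = sp q"
    and \<phi>ep: "\<And>q. q \<in> Q \<Longrightarrow> \<phi> q (len q - 1) (ep (nxt q (len q - 1))) = ep q"
    and \<phi>match: "\<And>q h. q \<in> Q \<Longrightarrow> Suc h < len q \<Longrightarrow>
      \<phi> q h (ep (nxt q h)) = \<phi> q (Suc h) (sp (nxt q (Suc h)))"
begin

definition durs :: "'q \<Rightarrow> real list" where
  "durs q = map (\<lambda>h. d (nxt q h) / \<theta>) [0..<len q]"

definition \<Phi> :: "('q \<Rightarrow> real \<Rightarrow> 'a) \<Rightarrow> 'q \<Rightarrow> real \<Rightarrow> 'a" where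
  "\<Phi> f q = glue (durs q) (\<lambda>h s. \<phi> q h (f (nxt q h) (\<theta> * s)))"

definition inX :: "('q \<Rightarrow> real \<Rightarrow> 'a) \<Rightarrow> bool" where
  "inX f \<longleftrightarrow> (\<forall>q\<in>Q. \<forall>t\<in>{0..d q}. f q t \<in> X)"

lemma inXD: "inX f \<Longrightarrow> q \<in> Q \<Longrightarrow> t \<in> {0..d q} \<Longrightarrow> f q t \<in> X"
  by (simp add: inX_def)

text \<open>Kept apart from \<open>inX\<close> because the contraction estimate needs
  \<open>inX\<close> alone: it is later applied to a constant function, which in general is not
  matched.\<close>

definition matched :: "('q \<Rightarrow> real \<Rightarrow> 'a) \<Rightarrow> bool" where
  "matched f \<longleftrightarrow> (\<forall>q\<in>Q. f q 0 = sp q \<and> f q (d q) = ep q)"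

lemma durs: "q \<in> Q \<Longrightarrow> durs q \<noteq> []" "length (durs q) = len q"
  "h < len q \<Longrightarrow> durs q ! h = d (nxt q h) / \<theta>"
  "q \<in> Q \<Longrightarrow> x \<in> set (durs q) \<Longrightarrow> 0 < x"
  using len[of q] dpos nxtQ \<theta> by (auto simp: durs_def)

lemma sum_durs: "q \<in> Q \<Longrightarrow> sum_list (durs q) = d q"
  using dsum[of q] \<theta>
  by (simp add: durs_def sum_set_upt_conv_sum_list_nat[symmetric] sum_divide_distrib[symmetric]
    atLeast0LessThan)

lemma step_cases:
  assumes "q \<in> Q" "t \<in> {0..d q}"
  obtains h s where "h < len q" "s \<in> {0..d (nxt q h)}" "t = sum_list (take h (durs q)) + s / \<theta>"
    "\<And>f. \<Phi> f q t = \<phi> q h (f (nxt q h) s)"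
proof -
  obtain h s where h: "h < len q" "s \<in> {0..durs q ! h}" "t = sum_list (take h (durs q)) + s"
    "\<And>F :: nat \<Rightarrow> real \<Rightarrow> 'a. glue (durs q) F t = F h s"
    using glue_cases[of "durs q" t, where 'a = 'a] assms durs sum_durs by auto
  show ?thesis
    by (rule that[of h "\<theta> * s"]) (use h \<theta> durs(3)[of h q] in \<open>auto simp: \<Phi>_def field_simps\<close>)
qed

text \<open>Unlike in \<open>step_cases\<close> the piece is prescribed here, and at a junction time
  \<open>glue\<close> chooses the earlier one; matching makes both values agree.\<close>

lemma step_at:
  assumes "q \<in> Q" "matched f" "h < len q" "s \<in> {0..d (nxt q h)}"
  shows "sum_list (take h (durs q)) + s / \<theta> \<in> {0..d q}"
    "\<Phi> f q (sum_list (take h (durs q)) + s / \<theta>) = \<phi> q h (f (nxt q h) s)"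
proof -
  have nn: "\<And>x. x \<in> set (durs q) \<Longrightarrow> 0 \<le> x" using durs(4)[OF assms(1)] by force
  have sl: "s / \<theta> \<le> durs q ! h" "0 \<le> s / \<theta>"
    using assms \<theta> durs(3)[of h q] by (auto simp: divide_right_mono)
  have "sum_list (durs q) = sum_list (take h (durs q)) + durs q ! h + sum_list (drop (Suc h) (durs q))"
    using assms(3) durs(2)[of q]
    by (metis append_take_drop_id sum_list_append Cons_nth_drop_Suc sum_list.Cons add.assoc)
  moreover have "sum_list (drop (Suc h) (durs q)) \<ge> 0" "sum_list (take h (durs q)) \<ge> 0"
    using nn by (auto intro!: sum_list_nonneg dest: in_set_dropD in_set_takeD)
  ultimately show "sum_list (take h (durs q)) + s / \<theta> \<in> {0..d q}"
    using sl sum_durs[OF assms(1)] by auto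
  have "glue (durs q) (\<lambda>h s. \<phi> q h (f (nxt q h) (\<theta> * s))) (sum_list (take h (durs q)) + s / \<theta>) =
    \<phi> q h (f (nxt q h) (\<theta> * (s / \<theta>)))"
  proof (rule glue_at)
    fix h assume h: "Suc h < length (durs q)"
    then show "\<phi> q h (f (nxt q h) (\<theta> * durs q ! h)) = \<phi> q (Suc h) (f (nxt q (Suc h)) (\<theta> * 0))"
      using assms(1,2) \<phi>match[of q h] \<theta> nxtQ[of q] by (auto simp: durs matched_def)
  qed (use assms nn sl durs in auto)
  then show "\<Phi> f q (sum_list (take h (durs q)) + s / \<theta>) = \<phi> q h (f (nxt q h) s)"
    using \<theta> by (simp add: \<Phi>_def)
qed

lemma matched_\<Phi>: "matched f \<Longrightarrow> matched (\<Phi> f)"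
  unfolding matched_def[of "\<Phi> f"]
proof (intro ballI conjI)
  fix q assume f: "matched f" and q: "q \<in> Q"
  show "\<Phi> f q 0 = sp q"
    using step_at(2)[OF q f, of 0 0] len[OF q] \<phi>sp[OF q] f nxtQ[OF q] dpos
    by (simp add: matched_def less_imp_le)
  let ?l = "len q - 1"
  have l: "?l < len q" using len[OF q] by simp
  have "sum_list (take ?l (durs q)) + d (nxt q ?l) / \<theta> = d q"
  proof -
    have "durs q = take ?l (durs q) @ [durs q ! ?l]"
      using l durs(2)[of q] by (metis Suc_diff_1 len q take_Suc_conv_app_nth take_all order_refl)
    then have "sum_list (durs q) = sum_list (take ?l (durs q)) + durs q ! ?l"
      by (metis add.right_neutral sum_list.Cons sum_list.Nil sum_list_append)
    then show ?thesis using sum_durs[OF q] durs(3)[OF l] by simp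
  qed
  then show "\<Phi> f q (d q) = ep q"
    using step_at(2)[OF q f l, of "d (nxt q ?l)"] \<phi>ep[OF q] f nxtQ[OF q l] dpos
    by (simp add: matched_def less_imp_le)
qed

lemma inX_\<Phi>: "inX f \<Longrightarrow> inX (\<Phi> f)"
  unfolding inX_def[of "\<Phi> f"]
proof (intro ballI)
  fix q t assume f: "inX f" and q: "q \<in> Q" and t: "t \<in> {0..d q}"
  obtain h s where "h < len q" "s \<in> {0..d (nxt q h)}" "\<And>f. \<Phi> f q t = \<phi> q h (f (nxt q h) s)"
    using step_cases[OF q t] by metis
  then show "\<Phi> f q t \<in> X" using \<phi>X[OF q] inXD[OF f nxtQ[OF q]] by simp
qed

lemma continuous_\<Phi>:
  assumes f: "matched f" "inX f" "\<And>q. q \<in> Q \<Longrightarrow> continuous_on {0..d q} (f q)" and q: "q \<in> Q"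
  shows "continuous_on {0..d q} (\<Phi> f q)"
proof -
  have "continuous_on X (\<phi> q h)" if "h < len q" for h
  proof (rule continuous_onI)
    fix x e :: real and y assume "0 < e" "y \<in> X"
    then show "\<exists>d>0. \<forall>x'\<in>X. dist x' y < d \<longrightarrow> dist (\<phi> q h x') (\<phi> q h y) \<le> e"
      using \<phi>dist[OF q that] b by (intro exI[of _ "e * b"]) (auto simp: divide_le_eq)
  qed
  then have "continuous_on {0..durs q ! h} (\<lambda>s. \<phi> q h (f (nxt q h) (\<theta> * s)))" if "h < len q" for h
  proof (rule continuous_on_compose2[OF _ continuous_on_compose2[OF f(3)]])
    show "nxt q h \<in> Q" "h < len q" using that nxtQ[OF q] by auto
    have *: "\<theta> * s \<in> {0..d (nxt q h)}" if "s \<in> {0..durs q ! h}" for s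
      using that durs(3)[OF \<open>h < len q\<close>] \<theta> by (auto simp: field_simps)
    then show "(\<lambda>s. f (nxt q h) (\<theta> * s)) ` {0..durs q ! h} \<subseteq> X"
      using inXD[OF f(2) nxtQ[OF q that]] by auto
    show "(*) \<theta> ` {0..durs q ! h} \<subseteq> {0..d (nxt q h)}" using * by auto
  qed (auto intro!: continuous_intros)
  then have "continuous_on {0..sum_list (durs q)} (\<Phi> f q)"
    unfolding \<Phi>_def
    using f(1) q \<phi>match[OF q] \<theta> nxtQ[OF q] durs(4)[OF q]
    by (intro continuous_on_glue) (auto simp: durs matched_def less_imp_le)
  then show ?thesis using sum_durs[OF q] by simp
qed

lemma \<Phi>_contracts:
  assumes "inX f" "inX g" "\<And>q t. q \<in> Q \<Longrightarrow> t \<in> {0..d q} \<Longrightarrow> dist (f q t) (g q t) \<le> e"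
    and q: "q \<in> Q" "t \<in> {0..d q}"
  shows "dist (\<Phi> f q t) (\<Phi> g q t) \<le> e / b"
proof -
  obtain h s where h: "h < len q" "s \<in> {0..d (nxt q h)}" "\<And>f. \<Phi> f q t = \<phi> q h (f (nxt q h) s)"
    using step_cases[OF q] by metis
  have "dist (\<phi> q h (f (nxt q h) s)) (\<phi> q h (g (nxt q h) s)) = dist (f (nxt q h) s) (g (nxt q h) s) / b"
    using h nxtQ[OF q(1)] by (intro \<phi>dist inXD[OF assms(1)] inXD[OF assms(2)] q) auto
  then show ?thesis using assms(3)[OF nxtQ[OF q(1) h(1)] h(2)] b h by (simp add: divide_right_mono)
qed

lemma inX_iter: "inX f \<Longrightarrow> inX ((\<Phi> ^^ n) f)"
  by (induction n) (auto intro: inX_\<Phi>)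

lemma iter_contracts:
  assumes "inX f" "inX g" and q: "q \<in> Q" "t \<in> {0..d q}"
  shows "dist ((\<Phi> ^^ n) f q t) ((\<Phi> ^^ n) g q t) \<le> B * (1/b)^n"
  using q
proof (induction n arbitrary: q t)
  case 0
  then show ?case using inXD[OF assms(1)] inXD[OF assms(2)] by (auto intro!: B)
next
  case (Suc n)
  have "dist (\<Phi> ((\<Phi> ^^ n) f) q t) (\<Phi> ((\<Phi> ^^ n) g) q t) \<le> B * (1/b)^n / b"
    using Suc assms inX_iter by (intro \<Phi>_contracts) auto
  then show ?case by simp
qed

section \<open>The limit curve of the iteration\<close>

definition curve0 :: "'q \<Rightarrow> real \<Rightarrow> 'a" where
  "curve0 q t = (1 - t / d q) *\<^sub>R sp q + (t / d q) *\<^sub>R ep q"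

definition curve :: "'q \<Rightarrow> real \<Rightarrow> 'a" where
  "curve q t = lim (\<lambda>n. (\<Phi> ^^ n) curve0 q t)"

lemma inX_curve0: "inX curve0"
proof -
  have "curve0 q t \<in> X" if "q \<in> Q" "0 \<le> t" "t \<le> d q" for q t
    unfolding curve0_def using that dpos[of q] spX epX
    by (intro convexD[OF X(2)]) auto
  then show ?thesis by (auto simp: inX_def)
qed

lemma curve0_iter: "matched ((\<Phi> ^^ n) curve0)"
  "q \<in> Q \<Longrightarrow> continuous_on {0..d q} ((\<Phi> ^^ n) curve0 q)"
proof -
  have *: "matched ((\<Phi> ^^ n) curve0) \<and> (\<forall>q\<in>Q. continuous_on {0..d q} ((\<Phi> ^^ n) curve0 q))"
  proof (induction n)
    case 0
    have "\<forall>q\<in>Q. continuous_on {0..d q} (curve0 q)"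
      unfolding curve0_def using dpos by (force intro!: continuous_intros)
    then show ?case using dpos by (force simp: matched_def curve0_def)
  next
    case (Suc n)
    then show ?case using matched_\<Phi> continuous_\<Phi> inX_iter[OF inX_curve0] by auto
  qed
  show "matched ((\<Phi> ^^ n) curve0)" "q \<in> Q \<Longrightarrow> continuous_on {0..d q} ((\<Phi> ^^ n) curve0 q)"
    using * by auto
qed

lemma bpow_tendsto: "(\<lambda>n. B * (1/b)^n) \<longlonglongrightarrow> 0"
  using tendsto_mult_left[OF LIMSEQ_realpow_zero[of "1/b"], of B] b by simp

lemma B_nonneg: "q \<in> Q \<Longrightarrow> B \<ge> 0"
  using B[of "sp q" "sp q"] spX by simp

text \<open>The iterates \<open>n + k\<close> and \<open>n\<close> are both images under
  \<open>\<Phi> ^^ n\<close> of functions with values in \<open>X\<close>, which makes the sequence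
  Cauchy.\<close>

lemma curve_tendsto:
  assumes q: "q \<in> Q" "t \<in> {0..d q}"
  shows "(\<lambda>n. (\<Phi> ^^ n) curve0 q t) \<longlonglongrightarrow> curve q t"
proof -
  have le: "dist ((\<Phi> ^^ (n + k)) curve0 q t) ((\<Phi> ^^ n) curve0 q t) \<le> B * (1/b)^n" for n k
    using iter_contracts[OF inX_iter[OF inX_curve0] inX_curve0 q, of n k] by (simp add: funpow_add)
  have "Cauchy (\<lambda>n. (\<Phi> ^^ n) curve0 q t)"
  proof (rule metric_CauchyI)
    fix e :: real assume "e > 0"
    then obtain N where N: "\<And>n. n \<ge> N \<Longrightarrow> B * (1/b)^n < e / 2"
      using order_tendstoD(2)[OF bpow_tendsto, of "e / 2"] by (auto simp: eventually_sequentially)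
    have "dist ((\<Phi> ^^ n) curve0 q t) ((\<Phi> ^^ N) curve0 q t) < e / 2" if "n \<ge> N" for n
      using le[of N "n - N"] N[of N] that by simp
    then show "\<exists>M. \<forall>m\<ge>M. \<forall>n\<ge>M. dist ((\<Phi> ^^ m) curve0 q t) ((\<Phi> ^^ n) curve0 q t) < e"
      using dist_triangle_half_l by blast
  qed
  then show ?thesis by (simp add: curve_def Cauchy_convergent_iff convergent_LIMSEQ_iff)
qed

lemma inX_curve: "inX curve"
proof -
  have "curve q t \<in> X" if "q \<in> Q" "t \<in> {0..d q}" for q t
    by (rule closed_sequentially[OF X(1) _ curve_tendsto[OF that]])
      (rule inXD[OF inX_iter[OF inX_curve0] that])
  then show ?thesis by (auto simp: inX_def)
qed

lemma matched_curve: "matched curve"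
  unfolding matched_def
proof (intro ballI conjI)
  fix q assume q: "q \<in> Q"
  show "curve q 0 = sp q"
    using curve_tendsto[OF q, of 0] curve0_iter(1) dpos[OF q] q
    by (simp add: matched_def less_imp_le) (metis LIMSEQ_const_iff)
  show "curve q (d q) = ep q"
    using curve_tendsto[OF q, of "d q"] curve0_iter(1) dpos[OF q] q
    by (simp add: matched_def less_imp_le) (metis LIMSEQ_const_iff)
qed

lemma curve_approx:
  assumes q: "q \<in> Q" "t \<in> {0..d q}"
  shows "dist (curve q t) ((\<Phi> ^^ n) curve0 q t) \<le> B * (1/b)^n"
  unfolding dist_commute[of "curve q t"]
proof (rule Lim_dist_ubound[OF trivial_limit_sequentially curve_tendsto[OF q]])
  have "dist ((\<Phi> ^^ k) curve0 q t) ((\<Phi> ^^ n) curve0 q t) \<le> B * (1/b)^n" if "k \<ge> n" for k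
    using iter_contracts[OF inX_iter[OF inX_curve0] inX_curve0 q, of n "k - n"] that
      funpow_add[of n "k - n" \<Phi>] by simp
  then show "\<forall>\<^sub>F k in sequentially. dist ((\<Phi> ^^ n) curve0 q t) ((\<Phi> ^^ k) curve0 q t) \<le> B * (1/b)^n"
    by (auto simp: eventually_sequentially dist_commute)
qed

lemma curve_fixed:
  assumes q: "q \<in> Q" "t \<in> {0..d q}"
  shows "\<Phi> curve q t = curve q t"
proof (rule LIMSEQ_unique)
  have "dist (\<Phi> ((\<Phi> ^^ n) curve0) q t) (\<Phi> curve q t) \<le> B * (1/b)^n / b" for n
    using curve_approx inX_curve inX_iter[OF inX_curve0] q
    by (intro \<Phi>_contracts) (auto simp: dist_commute)
  then have "\<forall>n. norm (dist ((\<Phi> ^^ Suc n) curve0 q t) (\<Phi> curve q t)) \<le> B * (1/b)^n / b" by simp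
  moreover have "(\<lambda>n. B * (1/b)^n / b) \<longlonglongrightarrow> 0" using tendsto_divide[OF bpow_tendsto tendsto_const, of
    b] b by simp
  ultimately have "(\<lambda>n. dist ((\<Phi> ^^ Suc n) curve0 q t) (\<Phi> curve q t)) \<longlonglongrightarrow> 0"
    by (rule Lim_null_comparison[OF always_eventually])
  then show "(\<lambda>n. (\<Phi> ^^ Suc n) curve0 q t) \<longlonglongrightarrow> \<Phi> curve q t" by (subst tendsto_dist_iff)
  show "(\<lambda>n. (\<Phi> ^^ Suc n) curve0 q t) \<longlonglongrightarrow> curve q t"
    using curve_tendsto[OF q] by (rule LIMSEQ_Suc)
qed

text \<open>\<open>curve_fixed\<close> is confined to states in \<open>Q\<close> and times in their
  intervals, so it cannot be iterated as an equation between functions; the induction descends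
  through the pieces instead.\<close>

lemma curve_iter_fixed:
  assumes q: "q \<in> Q" "t \<in> {0..d q}"
  shows "(\<Phi> ^^ n) curve q t = curve q t"
  using q
proof (induction n arbitrary: q t)
  case (Suc n)
  obtain h s where h: "h < len q" "s \<in> {0..d (nxt q h)}" "\<And>f. \<Phi> f q t = \<phi> q h (f (nxt q h) s)"
    using step_cases[OF Suc.prems] by metis
  then show ?case using Suc.IH[of "nxt q h" s] nxtQ[OF Suc.prems(1)] curve_fixed[OF Suc.prems] by simp
qed simp

lemma continuous_curve:
  assumes q: "q \<in> Q"
  shows "continuous_on {0..d q} (curve q)"
proof (rule uniform_limit_theorem[OF _ _ trivial_limit_sequentially])
  show "\<forall>\<^sub>F n in sequentially. continuous_on {0..d q} ((\<Phi> ^^ n) curve0 q)"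
    using curve0_iter(2)[OF q] by simp
  show "uniform_limit {0..d q} (\<lambda>n. (\<Phi> ^^ n) curve0 q) (curve q) sequentially"
  proof (rule uniform_limitI)
    fix e :: real assume "e > 0"
    then have "\<forall>\<^sub>F n in sequentially. B * (1/b)^n < e"
      using order_tendstoD(2)[OF bpow_tendsto] by blast
    then show "\<forall>\<^sub>F n in sequentially. \<forall>t\<in>{0..d q}. dist ((\<Phi> ^^ n) curve0 q t) (curve q t) < e"
    proof eventually_elim
      case (elim n)
      show ?case
      proof
        fix t assume "t \<in> {0..d q}"
        from curve_approx[OF q this, of n] elim
        show "dist ((\<Phi> ^^ n) curve0 q t) (curve q t) < e" by (simp add: dist_commute)
      qed
    qed
  qed
qed

definition curve_set :: "'q \<Rightarrow> 'a set" where
  "curve_set q = curve q ` {0..d q}"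

lemma curve_set_rec:
  assumes q: "q \<in> Q"
  shows "curve_set q = (\<Union>h<len q. \<phi> q h ` curve_set (nxt q h))"
proof (intro equalityI subsetI)
  fix x assume "x \<in> curve_set q"
  then obtain t where t: "t \<in> {0..d q}" "x = curve q t" by (auto simp: curve_set_def)
  obtain h s where "h < len q" "s \<in> {0..d (nxt q h)}" "\<And>f. \<Phi> f q t = \<phi> q h (f (nxt q h) s)"
    using step_cases[OF q t(1)] by metis
  then have "x = \<phi> q h (curve (nxt q h) s)" "curve (nxt q h) s \<in> curve_set (nxt q h)" "h < len q"
    using curve_fixed[OF q t(1)] t by (auto simp: curve_set_def)
  then show "x \<in> (\<Union>h<len q. \<phi> q h ` curve_set (nxt q h))" by blast
next
  fix x assume "x \<in> (\<Union>h<len q. \<phi> q h ` curve_set (nxt q h))"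
  then obtain h s where h: "h < len q" "s \<in> {0..d (nxt q h)}" "x = \<phi> q h (curve (nxt q h) s)"
    by (auto simp: curve_set_def)
  from step_at[OF q matched_curve h(1,2)] curve_fixed[OF q] h show "x \<in> curve_set q"
    by (auto simp: curve_set_def intro!: image_eqI)
qed

lemma curve_set_X: "q \<in> Q \<Longrightarrow> curve_set q \<subseteq> X"
  using inX_curve by (auto simp: curve_set_def inX_def)

lemma curve_set_closed: "q \<in> Q \<Longrightarrow> closed (curve_set q)"
  unfolding curve_set_def
  by (intro compact_imp_closed compact_continuous_image continuous_curve) auto

text \<open>Bounding the number of sets by a multiple of \<open>d q\<close> turns the induction step
  into the eigenvector equation \<open>dsum\<close>; \<open>d q / dmin \<ge> 1\<close> starts the
  induction.\<close>

lemma curve_set_cover: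
  assumes dmin: "dmin > 0" "\<And>q. q \<in> Q \<Longrightarrow> dmin \<le> d q" and q: "q \<in> Q"
  shows "\<exists>Us. curve_set q \<subseteq> \<Union>(set Us) \<and> \<Union>(set Us) \<subseteq> X \<and>
    (\<forall>U\<in>set Us. \<forall>x\<in>U. \<forall>y\<in>U. dist x y \<le> B * (1/b)^n) \<and> real (length Us) \<le> d q / dmin * \<theta>^n"
  using q
proof (induction n arbitrary: q)
  case 0
  have "1 \<le> d q / dmin" using dmin(1) dmin(2)[OF 0] by simp
  then show ?case using curve_set_X[OF 0] B
    by (intro exI[of _ "[curve_set q]"]) auto
next
  case (Suc n)
  have "\<forall>h. \<exists>Us. h < len q \<longrightarrow> (curve_set (nxt q h) \<subseteq> \<Union>(set Us) \<and> \<Union>(set Us) \<subseteq> X \<and>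
    (\<forall>U\<in>set Us. \<forall>x\<in>U. \<forall>y\<in>U. dist x y \<le> B * (1/b)^n) \<and> real (length Us) \<le> d (nxt q h) / dmin * \<theta>^n)"
    using Suc.IH[OF nxtQ[OF Suc.prems]] by blast
  from choice[OF this] obtain Us where "\<forall>h. h < len q \<longrightarrow> (curve_set (nxt q h) \<subseteq> \<Union>(set (Us h)) \<and> \<Union>(set
    (Us h)) \<subseteq> X \<and>
    (\<forall>U\<in>set (Us h). \<forall>x\<in>U. \<forall>y\<in>U. dist x y \<le> B * (1/b)^n) \<and> real (length (Us h)) \<le> d (nxt q h) / dmin * \<theta>^n)"
    by (elim exE)
  then have Us: "\<And>h. h < len q \<Longrightarrow> curve_set (nxt q h) \<subseteq> \<Union>(set (Us h))"
    "\<And>h. h < len q \<Longrightarrow> \<Union>(set (Us h)) \<subseteq> X"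
    "\<And>h. h < len q \<Longrightarrow> \<forall>U\<in>set (Us h). \<forall>x\<in>U. \<forall>y\<in>U. dist x y \<le> B * (1/b)^n"
    "\<And>h. h < len q \<Longrightarrow> real (length (Us h)) \<le> d (nxt q h) / dmin * \<theta>^n" by simp_all
  let ?Vs = "concat (map (\<lambda>h. map (\<lambda>U. \<phi> q h ` U) (Us h)) [0..<len q])"
  have "curve_set q \<subseteq> \<Union>(set ?Vs)"
    unfolding curve_set_rec[OF Suc.prems] using Us(1) by fastforce
  moreover have "\<Union>(set ?Vs) \<subseteq> X"
    using Us(2) \<phi>X[OF Suc.prems] by (force simp: subset_iff)
  moreover have "\<forall>U\<in>set ?Vs. \<forall>x\<in>U. \<forall>y\<in>U. dist x y \<le> B * (1/b)^Suc n"
  proof (intro ballI)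
    fix V x y assume "V \<in> set ?Vs" "x \<in> V" "y \<in> V"
    then obtain h U x' y' where h: "h < len q" "U \<in> set (Us h)" "x' \<in> U" "y' \<in> U"
      "x = \<phi> q h x'" "y = \<phi> q h y'" by auto
    then have "dist x y = dist x' y' / b" using Us(2)[OF h(1)] by (auto intro!: \<phi>dist Suc.prems)
    also have "\<dots> \<le> B * (1/b)^n / b" using Us(3)[OF h(1)] h b by (intro divide_right_mono) auto
    finally show "dist x y \<le> B * (1/b)^Suc n" by simp
  qed
  moreover have "real (length ?Vs) \<le> d q / dmin * \<theta>^Suc n"
  proof -
    have "real (length ?Vs) = (\<Sum>h<len q. real (length (Us h)))"
      by (simp add: length_concat comp_def sum_set_upt_conv_sum_list_nat[symmetric] atLeast0LessThan)
    also have "\<dots> \<le> (\<Sum>h<len q. d (nxt q h) / dmin * \<theta>^n)" by (intro sum_mono Us(4)) auto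
    also have "\<dots> = (\<Sum>h<len q. d (nxt q h)) / dmin * \<theta>^n"
      by (simp add: sum_divide_distrib sum_distrib_right)
    finally show ?thesis using dsum[OF Suc.prems] by (simp add: mult_ac)
  qed
  ultimately show ?case by blast
qed

lemma hausdorff_dim_curve_le:
  assumes q: "q \<in> Q"
  shows "hausdorff_dim (curve_set q) \<le> ereal (log b \<theta>)"
\<comment> \<open>\<open>B\<close> is only known to be nonnegative, while a positive constant is
  required.\<close>
proof (rule hausdorff_dim_le[where c = "B + 1"])
  define dmin where "dmin = Min (d ` Q)"
  have "dmin > 0" unfolding dmin_def using finQ q dpos by (subst Min_gr_iff) auto
  moreover have "\<And>q. q \<in> Q \<Longrightarrow> dmin \<le> d q" using finQ by (simp add: dmin_def)
  ultimately have dmin: "dmin > 0" "\<And>q. q \<in> Q \<Longrightarrow> dmin \<le> d q" by auto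
  show "b > 1" "\<theta> \<ge> 1" using b \<theta> by auto
  show "B + 1 > 0" using B_nonneg[OF q] by simp
  show "d q / dmin \<ge> 0" using dmin dpos[OF q] by simp
  fix n
  obtain Us where Us: "curve_set q \<subseteq> \<Union>(set Us)" "\<Union>(set Us) \<subseteq> X"
    "\<forall>U\<in>set Us. \<forall>x\<in>U. \<forall>y\<in>U. dist x y \<le> B * (1/b)^n" "real (length Us) \<le> d q / dmin * \<theta>^n"
    using curve_set_cover[OF dmin q] by blast
  have "bounded U \<and> diameter U \<le> (B + 1) * (1/b)^n" if U: "U \<in> set Us" for U
  proof
    have "B * (1/b)^n \<le> (B + 1) * (1/b)^n" using b by (intro mult_right_mono) auto
    then have le: "dist x y \<le> (B + 1) * (1/b)^n" if "x \<in> U" "y \<in> U" for x y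
      using Us(3) U that by fastforce
    then show "bounded U" unfolding bounded_two_points by blast
    show "diameter U \<le> (B + 1) * (1/b)^n"
      using le B_nonneg[OF q] b by (intro diameter_le) (auto simp: dist_norm)
  qed
  then show "\<exists>Us. curve_set q \<subseteq> \<Union>(set Us) \<and> (\<forall>U\<in>set Us. bounded U \<and> diameter U \<le> (B + 1) * (1/b)^n)
      \<and> real (length Us) \<le> d q / dmin * \<theta>^n"
    using Us by blast
qed

end

text \<open>The points \<open>(\<Phi> ^^ n) (\<lambda>_ _. c) q t\<close> are the centres of the cells of level \<open>n\<close>; that they
  belong to the sparse set \<open>\<Lambda> n\<close> bounds the number of cells near a small set.\<close>

locale separated_curve_system = curve_system +
  fixes c :: 'b and G :: "'b set" and \<Lambda> :: "nat \<Rightarrow> 'b set" and N :: nat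
  assumes G: "c \<in> G" "G \<subseteq> X" and \<phi>G: "\<And>q h x. q \<in> Q \<Longrightarrow> h < len q \<Longrightarrow> x \<in> G \<Longrightarrow> \<phi> q h x \<in> G"
    and \<phi>inj: "\<And>q h h' x y. q \<in> Q \<Longrightarrow> h < len q \<Longrightarrow> h' < len q \<Longrightarrow> x \<in> G \<Longrightarrow> y \<in> G \<Longrightarrow>
      \<phi> q h x = \<phi> q h' y \<Longrightarrow> h = h' \<and> x = y"
    and \<Lambda>0: "c \<in> \<Lambda> 0" and \<Lambda>Suc: "\<And>q h n x. q \<in> Q \<Longrightarrow> h < len q \<Longrightarrow> x \<in> G \<Longrightarrow> x \<in> \<Lambda> n \<Longrightarrow> \<phi> q h x \<in> \<Lambda> (Suc n)"
    and sparse: "\<And>W n. W \<subseteq> \<Lambda> n \<Longrightarrow> (\<And>x y. x \<in> W \<Longrightarrow> y \<in> W \<Longrightarrow> dist x y \<le> (2 * B + 1) * (1/b)^n) \<Longrightarrow>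
      finite W \<and> card W \<le> N"
begin

abbreviation centre :: "nat \<Rightarrow> 'a \<Rightarrow> real \<Rightarrow> 'b" where
  "centre n \<equiv> (\<Phi> ^^ n) (\<lambda>_ _. c)"

lemma centre_in: "q \<in> Q \<Longrightarrow> t \<in> {0..d q} \<Longrightarrow> centre n q t \<in> G \<inter> \<Lambda> n"
proof (induction n arbitrary: q t)
  case 0
  then show ?case using G \<Lambda>0 by simp
next
  case (Suc n)
  obtain h s where h: "h < len q" "s \<in> {0..d (nxt q h)}" "\<And>f. \<Phi> f q t = \<phi> q h (f (nxt q h) s)"
    using step_cases[OF Suc.prems] by metis
  then show ?case using Suc.IH[OF nxtQ[OF Suc.prems(1) h(1)] h(2)] \<phi>G \<Lambda>Suc Suc.prems by simp
qed

text \<open>By \<open>\<phi>inj\<close> a centre of level \<open>n\<close> determines the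
  \<open>n\<close> pieces that lead to it, and the times that run through the same pieces fill an
  interval of length at most \<open>dmax / \<theta>^n\<close>.\<close>

lemma centre_fibre:
  assumes dmax: "\<And>q. q \<in> Q \<Longrightarrow> d q \<le> dmax"
  shows "q \<in> Q \<Longrightarrow> t \<in> {0..d q} \<Longrightarrow> t' \<in> {0..d q} \<Longrightarrow> centre n q t = centre n q t' \<Longrightarrow>
    \<bar>t - t'\<bar> \<le> dmax / \<theta>^n"
proof (induction n arbitrary: q t t')
  case 0
  then show ?case using dmax[OF 0(1)] by auto
next
  case (Suc n)
  obtain h s where h: "h < len q" "s \<in> {0..d (nxt q h)}" "t = sum_list (take h (durs q)) + s / \<theta>"
    "\<And>f. \<Phi> f q t = \<phi> q h (f (nxt q h) s)"
    using step_cases[OF Suc.prems(1,2)] by metis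
  obtain h' s' where h': "h' < len q" "s' \<in> {0..d (nxt q h')}" "t' = sum_list (take h' (durs q)) + s' / \<theta>"
    "\<And>f. \<Phi> f q t' = \<phi> q h' (f (nxt q h') s')"
    using step_cases[OF Suc.prems(1,3)] by metis
  have "h = h' \<and> centre n (nxt q h) s = centre n (nxt q h') s'"
  proof (rule \<phi>inj[OF Suc.prems(1) h(1) h'(1)])
    show "centre n (nxt q h) s \<in> G" "centre n (nxt q h') s' \<in> G"
      using centre_in nxtQ[OF Suc.prems(1)] h h' by auto
    show "\<phi> q h (centre n (nxt q h) s) = \<phi> q h' (centre n (nxt q h') s')"
      using Suc.prems(4) h(4) h'(4) by simp
  qed
  then have "h = h'" "\<bar>s - s'\<bar> \<le> dmax / \<theta>^n"
    using Suc.IH[OF nxtQ[OF Suc.prems(1) h(1)] h(2), of s'] h'(2) by auto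
  moreover have "\<bar>t - t'\<bar> = \<bar>s - s'\<bar> / \<theta>"
    using \<open>h = h'\<close> h(3) h'(3) \<theta> by (simp add: diff_divide_distrib[symmetric])
  moreover have "\<bar>s - s'\<bar> / \<theta> \<le> dmax / \<theta>^n / \<theta>"
    using \<open>\<bar>s - s'\<bar> \<le> dmax / \<theta>^n\<close> \<theta> by (intro divide_right_mono) auto
  ultimately show ?case by (simp add: mult.commute)
qed

lemma hausdorff_dim_curve:
  assumes q: "q \<in> Q"
  shows "hausdorff_dim (curve_set q) = ereal (log b \<theta>)"
proof (rule antisym[OF hausdorff_dim_curve_le[OF q]])
  define dmax where "dmax = Max (d ` Q)"
  have dmax: "\<And>q. q \<in> Q \<Longrightarrow> d q \<le> dmax" using finQ by (auto simp: dmax_def)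
  show "ereal (log b \<theta>) \<le> hausdorff_dim (curve_set q)"
  proof (rule hausdorff_dim_ge[OF b \<theta> dpos[OF q], of dmax "curve q"])
    show "dmax > 0" using dmax[OF q] dpos[OF q] by simp
    show "curve q ` {0..d q} \<subseteq> curve_set q" by (simp add: curve_set_def)
    fix n and U :: "'b set"
    assume U: "bounded U" "diameter U \<le> (1/b)^n"
    let ?I = "{t\<in>{0..d q}. curve q t \<in> U}" and ?g = "centre n q"
    have app: "dist (curve q t) (?g t) \<le> B * (1/b)^n" if "t \<in> {0..d q}" for t
    proof -
      have "inX (\<lambda>_ _. c)" using G by (auto simp: inX_def)
      from iter_contracts[OF inX_curve this q that] show ?thesis
        using curve_iter_fixed[OF q that] by simp
    qed
    have W: "finite (?g ` ?I) \<and> card (?g ` ?I) \<le> N"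
    proof (rule sparse)
      show "?g ` ?I \<subseteq> \<Lambda> n" using centre_in[OF q] by auto
      fix x y assume "x \<in> ?g ` ?I" "y \<in> ?g ` ?I"
      then obtain t u where t: "t \<in> ?I" "x = ?g t" and u: "u \<in> ?I" "y = ?g u" by auto
      have "dist (curve q t) (curve q u) \<le> (1/b)^n"
        using diameter_bounded_bound[OF U(1)] U(2) t u by force
      \<comment> \<open>Each centre is within \<open>B * (1/b)^n\<close> of its point on the curve;
        this is the origin of the constant \<open>2 * B + 1\<close> in
        \<open>sparse\<close>.\<close>
      moreover have "dist x y \<le> dist x (curve q t) + dist (curve q t) (curve q u) + dist (curve q u) y"
        by metric
      ultimately show "dist x y \<le> (2 * B + 1) * (1/b)^n"
        using app[of t] app[of u] t u by (simp add: dist_commute algebra_simps)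
    qed
    \<comment> \<open>One time is chosen for each centre; \<open>centre_fibre\<close> keeps all
      other times with that centre close to it.\<close>
    define r where "r = inv_into ?I ?g"
    have r: "r z \<in> ?I \<and> ?g (r z) = z" if "z \<in> ?g ` ?I" for z
      unfolding r_def using inv_into_into[OF that] f_inv_into_f[OF that] by blast
    have "?I \<subseteq> (\<Union>z\<in>r ` ?g ` ?I. {z - dmax/\<theta>^n..z + dmax/\<theta>^n})"
    proof
      fix t assume t: "t \<in> ?I"
      then have "r (?g t) \<in> ?I \<and> ?g (r (?g t)) = ?g t" using r by blast
      then have "\<bar>t - r (?g t)\<bar> \<le> dmax / \<theta>^n"
        using t by (intro centre_fibre[OF dmax q]) auto
      then have "t \<in> {r (?g t) - dmax/\<theta>^n..r (?g t) + dmax/\<theta>^n}" by auto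
      then show "t \<in> (\<Union>z\<in>r ` ?g ` ?I. {z - dmax/\<theta>^n..z + dmax/\<theta>^n})" using t by blast
    qed
    moreover have "finite (r ` ?g ` ?I)" "card (r ` ?g ` ?I) \<le> N"
      using W card_image_le[of "?g ` ?I" r] by auto
    ultimately show "\<exists>Z. finite Z \<and> card Z \<le> N \<and> ?I \<subseteq> (\<Union>z\<in>Z. {z - dmax/\<theta>^n..z + dmax/\<theta>^n})"
      by blast
  qed
qed

end

section \<open>Barycentric coordinates and triangle maps\<close>

text \<open>The barycentric combination as a linear map on the whole space, so that scaled and
  shifted coordinate vectors can be handled outside \<open>H\<close>.\<close>

definition bc :: "real^3 \<Rightarrow> real^2" where
  "bc a = (\<Sum>i\<in>UNIV. (a $ i) *\<^sub>R P i)"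

definition T1 :: "(real^2) set" where
  "T1 = bc ` H"

definition rv :: "nat^3 \<Rightarrow> real^3" where
  "rv k = (\<chi> i. real (k $ i))"

abbreviation \<beta> :: "real^2 \<Rightarrow> real^3" where
  "\<beta> \<equiv> barycentric"

lemma rv_nth [simp]: "rv k $ i = real (k $ i)"
  by (simp add: rv_def)

lemma linear_bc: "linear bc"
  by (rule linearI) (simp_all add: bc_def scaleR_left_distrib sum.distrib scaleR_sum_right)

lemmas bc_add = linear_add[OF linear_bc] and bc_diff = linear_diff[OF linear_bc]
  and bc_scaleR = linear_scale[OF linear_bc]

lemma P_vals: "P 1 = vector [0, 0]" "P 2 = vector [1, 0]" "P 3 = vector [1/2, sqrt 3 / 2]"
  by (simp_all add: P_def)

lemma bc_nth: "bc a $ 1 = a $ 2 + a $ 3 / 2" "bc a $ 2 = a $ 3 * (sqrt 3 / 2)"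
  by (simp_all add: bc_def sum_3 P_vals)

lemma bc_axis: "bc (axis i 1) = P i"
proof -
  have "bc (axis i 1) = (\<Sum>j\<in>UNIV. if j = i then P j else 0)"
    unfolding bc_def by (intro sum.cong) (auto simp: axis_def)
  then show ?thesis by simp
qed

text \<open>Coordinate sum \<open>0\<close> is what differences of barycentric coordinates have. The
  bound gives the injectivity of \<open>bc\<close> and, later, the factor \<open>6\<close> in
  \<open>lattice_sparse\<close>.\<close>

lemma bc_coeff_bound:
  assumes "a $ 1 + a $ 2 + a $ 3 = 0"
  shows "\<bar>a $ 2\<bar> \<le> 2 * norm (bc a)" "\<bar>a $ 3\<bar> \<le> 2 * norm (bc a)"
proof -
  have s: "1 \<le> sqrt (3::real)" by simp
  have "\<bar>a $ 3\<bar> * 1 \<le> \<bar>a $ 3\<bar> * sqrt 3" using s by (intro mult_left_mono) auto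
  also have "\<dots> = 2 * \<bar>bc a $ 2\<bar>" by (simp add: bc_nth abs_mult)
  also have "\<dots> \<le> 2 * norm (bc a)" using component_le_norm_cart[of "bc a" 2] by simp
  finally show 3: "\<bar>a $ 3\<bar> \<le> 2 * norm (bc a)" by simp
  have "\<bar>bc a $ 1\<bar> \<le> norm (bc a)" by (rule component_le_norm_cart)
  then show "\<bar>a $ 2\<bar> \<le> 2 * norm (bc a)" using 3 unfolding bc_nth by linarith
qed

text \<open>The sum has to be prescribed because \<open>P 1 = 0\<close> makes \<open>bc\<close>
  blind to the first coordinate.\<close>

lemma bc_inj:
  assumes "sum (($) a) UNIV = sum (($) b) UNIV" "bc a = bc b"
  shows "a = b"
proof -
  have s: "(a - b) $ 1 + (a - b) $ 2 + (a - b) $ 3 = 0" using assms(1) by (simp add: sum_3)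
  have "norm (bc (a - b)) = 0" using assms(2) by (simp add: bc_diff)
  then have "(a - b) $ 2 = 0" "(a - b) $ 3 = 0" using bc_coeff_bound[OF s] by auto
  then show ?thesis using s by (simp add: vec_eq_iff forall_3)
qed

lemma H_iff: "a \<in> H \<longleftrightarrow> (\<forall>i. 0 \<le> a $ i) \<and> a $ 1 + a $ 2 + a $ 3 = 1"
  by (auto simp: H_def sum_3 forall_3)

lemma barycentric_bc: "a \<in> H \<Longrightarrow> \<beta> (bc a) = a"
  unfolding barycentric_def bc_def[symmetric]
  by (rule the_equality) (auto intro!: bc_inj simp: H_iff sum_3)

lemma barycentric_H: "x \<in> T1 \<Longrightarrow> \<beta> x \<in> H"
  by (auto simp: T1_def barycentric_bc)

lemma bc_barycentric: "x \<in> T1 \<Longrightarrow> bc (\<beta> x) = x"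
  by (auto simp: T1_def barycentric_bc)

lemma barycentric_inj: "x \<in> T1 \<Longrightarrow> y \<in> T1 \<Longrightarrow> (\<And>i. \<beta> x $ i = \<beta> y $ i) \<Longrightarrow> x = y"
  by (metis bc_barycentric vec_eq_iff)

lemma barycentric_bounds:
  assumes "x \<in> T1"
  shows "0 \<le> \<beta> x $ i" "\<beta> x $ i \<le> 1" "\<beta> x $ 1 + \<beta> x $ 2 + \<beta> x $ 3 = 1"
  using barycentric_H[OF assms] by (auto simp: H_def sum_3)

lemma tri_map_bc: "a \<in> H \<Longrightarrow> tri_map D (bc a) = (\<Sum>i\<in>UNIV. (a $ i) *\<^sub>R (D $ i))"
  by (simp add: tri_map_def barycentric_bc)

lemma axis_H: "axis i 1 \<in> H"
  using exhaust_3[of i] by (auto simp: H_iff axis_def)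

lemma P_T1: "P i \<in> T1"
  by (metis T1_def axis_H bc_axis image_eqI)

lemma barycentric_P: "\<beta> (P i) $ j = (if j = i then 1 else 0)"
  using barycentric_bc[OF axis_H, of i] unfolding bc_axis by (simp add: axis_def)

lemma convex_H: "convex H"
  unfolding convex_alt
proof (intro ballI allI impI)
  fix x y and u :: real assume *: "x \<in> H" "y \<in> H" "0 \<le> u \<and> u \<le> 1"
  have "((1 - u) *\<^sub>R x + u *\<^sub>R y) $ 1 + ((1 - u) *\<^sub>R x + u *\<^sub>R y) $ 2 + ((1 - u) *\<^sub>R x + u *\<^sub>R y) $ 3
    = (1 - u) * (x $ 1 + x $ 2 + x $ 3) + u * (y $ 1 + y $ 2 + y $ 3)"
    by (simp add: algebra_simps)
  also have "\<dots> = 1" using * by (simp add: H_iff)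
  finally show "(1 - u) *\<^sub>R x + u *\<^sub>R y \<in> H"
    using * unfolding H_iff by simp
qed

lemma compact_H: "compact H"
proof -
  have "bounded H"
    by (rule bounded_subset[OF bounded_cbox[of 0 1]]) (auto simp: H_def mem_box_cart)
  moreover have "closed H"
  proof -
    have "H = (\<Inter>i. {a. 0 \<le> a $ i}) \<inter> {a. a $ 1 + a $ 2 + a $ 3 = 1}"
      by (auto simp: H_iff)
    moreover have "closed ((\<Inter>i. {a::real^3. 0 \<le> a $ i}) \<inter> {a. a $ 1 + a $ 2 + a $ 3 = 1})"
      by (intro closed_Int closed_INT ballI closed_Collect_le closed_Collect_eq continuous_intros)
    ultimately show ?thesis by simp
  qed
  ultimately show ?thesis by (simp add: compact_eq_bounded_closed)
qed

lemma convex_T1: "convex T1"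
  unfolding T1_def by (rule convex_linear_image[OF linear_bc convex_H])

lemma compact_T1: "compact T1"
  unfolding T1_def
  by (rule compact_continuous_image[OF _ compact_H])
    (use linear_bc linear_continuous_on linear_conv_bounded_linear in blast)

lemma H_hull: "H = convex hull (range (\<lambda>i. (axis i 1 :: real^3)))"
proof
  show "convex hull (range (\<lambda>i. (axis i 1 :: real^3))) \<subseteq> H"
    using axis_H convex_H by (intro hull_minimal) auto
  show "H \<subseteq> convex hull (range (\<lambda>i. (axis i 1 :: real^3)))"
  proof
    fix a assume a: "a \<in> H"
    have "(\<Sum>i\<in>UNIV. (a $ i) *\<^sub>R (axis i 1 :: real^3)) \<in> convex hull (range (\<lambda>i. (axis i 1 :: real^3)))"
      using a by (intro convex_sum) (auto simp: H_iff sum_3 hull_inc)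
    moreover have "(\<Sum>i\<in>UNIV. (a $ i) *\<^sub>R (axis i 1 :: real^3)) = a"
      by (simp add: vec_eq_iff axis_def if_distrib[of "\<lambda>x. _ * x"] cong: if_cong)
    ultimately show "a \<in> convex hull (range (\<lambda>i. (axis i 1 :: real^3)))" by simp
  qed
qed

lemma region_eq: "region D = tri_map D ` T1"
proof -
  let ?f = "\<lambda>a :: real^3. \<Sum>i\<in>UNIV. (a $ i) *\<^sub>R (D $ i)"
  have lin: "linear ?f"
    by (rule linearI) (simp_all add: scaleR_left_distrib sum.distrib scaleR_sum_right)
  have "?f ((axis i 1 :: real^3)) = D $ i" for i
  proof -
    have "?f ((axis i 1 :: real^3)) = (\<Sum>j\<in>UNIV. if j = i then D $ j else 0)"
      by (intro sum.cong) (auto simp: axis_def)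
    then show ?thesis by simp
  qed
  then have "region D = convex hull (?f ` range (\<lambda>i. (axis i 1 :: real^3)))"
    by (simp add: region_def image_image)
  also have "\<dots> = ?f ` H" unfolding convex_hull_linear_image[OF lin, symmetric] H_hull[symmetric] ..
  also have "\<dots> = tri_map D ` T1"
    unfolding T1_def image_image by (intro image_cong) (auto simp: tri_map_bc)
  finally show ?thesis .
qed

lemma T_nth: "T m k $ i = (1 / real m) *\<^sub>R (bc (rv k) + P i)"
  by (simp add: T_def bc_def)

lemma T'_nth: "T' m k $ i = (1 / real m) *\<^sub>R (bc (rv k + 1) - P i)"
  by (simp add: T'_def bc_def scaleR_left_distrib sum.distrib)

lemma sum_scaleR_H: "a \<in> H \<Longrightarrow> (\<Sum>i\<in>UNIV. (a $ i) *\<^sub>R v) = (v :: 'v::real_vector)"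
  by (simp add: H_iff sum_3 scaleR_left_distrib[symmetric])

lemma tri_map_T_bc:
  assumes "a \<in> H"
  shows "tri_map (T m k) (bc a) = bc ((1 / real m) *\<^sub>R (rv k + a))"
proof -
  have "tri_map (T m k) (bc a) = (1 / real m) *\<^sub>R (\<Sum>i\<in>UNIV. (a $ i) *\<^sub>R (bc (rv k) + P i))"
    unfolding tri_map_bc[OF assms] T_nth scaleR_sum_right scaleR_left_commute[of "1 / real m"] ..
  also have "(\<Sum>i\<in>UNIV. (a $ i) *\<^sub>R (bc (rv k) + P i)) = bc (rv k) + bc a"
    by (simp add: scaleR_right_distrib sum.distrib sum_scaleR_H[OF assms] bc_def[of a])
  finally show ?thesis by (simp add: bc_scaleR bc_add)
qed

lemma tri_map_T'_bc:
  assumes "a \<in> H"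
  shows "tri_map (T' m k) (bc a) = bc ((1 / real m) *\<^sub>R (rv k + 1 - a))"
proof -
  have "tri_map (T' m k) (bc a) = (1 / real m) *\<^sub>R (\<Sum>i\<in>UNIV. (a $ i) *\<^sub>R (bc (rv k + 1) - P i))"
    unfolding tri_map_bc[OF assms] T'_nth scaleR_sum_right scaleR_left_commute[of "1 / real m"] ..
  also have "(\<Sum>i\<in>UNIV. (a $ i) *\<^sub>R (bc (rv k + 1) - P i)) = bc (rv k + 1) - bc a"
    by (simp only: scaleR_right_diff_distrib sum_subtractf sum_scaleR_H[OF assms] bc_def[of a])
  finally show ?thesis by (simp add: bc_scaleR bc_diff)
qed

lemma T_index_iff: "k \<in> T_index m \<longleftrightarrow> k $ 1 + k $ 2 + k $ 3 = m - 1"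
  by (simp add: T_index_def sum_3)

lemma T'_index_iff: "k \<in> T'_index m \<longleftrightarrow> k $ 1 + k $ 2 + k $ 3 = m - 2"
  by (simp add: T'_index_def sum_3)

lemma tri_map_T:
  assumes "m \<ge> 2" "k \<in> T_index m" "x \<in> T1"
  shows "tri_map (T m k) x \<in> T1" "real m * \<beta> (tri_map (T m k) x) $ i = real (k $ i) + \<beta> x $ i"
proof -
  have s: "real (k $ 1) + real (k $ 2) + real (k $ 3) = real m - 1"
    using assms(1,2) unfolding T_index_iff by linarith
  have "(1 / real m) *\<^sub>R (rv k + \<beta> x) \<in> H"
    using s barycentric_bounds[OF assms(3)] assms(1)
    by (auto simp: H_iff add_divide_distrib[symmetric])
  moreover have "tri_map (T m k) x = bc ((1 / real m) *\<^sub>R (rv k + \<beta> x))"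
    using tri_map_T_bc[OF barycentric_H[OF assms(3)]] by (simp add: bc_barycentric assms)
  ultimately show "tri_map (T m k) x \<in> T1" "real m * \<beta> (tri_map (T m k) x) $ i = real (k $ i) + \<beta> x $ i"
    using assms(1) by (auto simp: T1_def barycentric_bc)
qed

lemma tri_map_T':
  assumes "m \<ge> 2" "k \<in> T'_index m" "x \<in> T1"
  shows "tri_map (T' m k) x \<in> T1" "real m * \<beta> (tri_map (T' m k) x) $ i = real (k $ i) + 1 - \<beta> x $ i"
proof -
  have s: "real (k $ 1) + real (k $ 2) + real (k $ 3) = real m - 2"
    using assms(1,2) unfolding T'_index_iff by linarith
  have nn: "real (k $ i) + 1 - \<beta> x $ i \<ge> 0" for i
    using barycentric_bounds[OF assms(3)] by (smt (verit) of_nat_0_le_iff)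
  have "(1 / real m) *\<^sub>R (rv k + 1 - \<beta> x) \<in> H"
    using s barycentric_bounds[OF assms(3)] assms(1) nn
    by (auto simp: H_iff add_divide_distrib[symmetric])
  moreover have "tri_map (T' m k) x = bc ((1 / real m) *\<^sub>R (rv k + 1 - \<beta> x))"
    using tri_map_T'_bc[OF barycentric_H[OF assms(3)]] by (simp add: bc_barycentric assms)
  ultimately show "tri_map (T' m k) x \<in> T1" "real m * \<beta> (tri_map (T' m k) x) $ i = real (k $ i) + 1 - \<beta> x $ i"
    using assms(1) by (auto simp: T1_def barycentric_bc)
qed

lemma dist_bc_scale: "dist (bc ((1 / real m) *\<^sub>R a)) (bc ((1 / real m) *\<^sub>R b)) = norm (bc (a - b)) / real m"
  by (simp add: dist_norm bc_diff[symmetric] scaleR_right_diff_distrib[symmetric] bc_scaleR)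

text \<open>An inverted cell merely changes the sign of coordinate differences, so both kinds of
  cell are similar copies with the same ratio.\<close>

lemma dist_tri_map:
  assumes "U \<in> TT m \<union> TT' m" "x \<in> T1" "y \<in> T1"
  shows "dist (tri_map U x) (tri_map U y) = dist x y / real m"
proof -
  have d: "norm (bc (\<beta> x - \<beta> y)) = dist x y"
    using assms(2,3) by (simp add: bc_diff bc_barycentric dist_norm)
  note m = tri_map_T_bc[OF barycentric_H] tri_map_T'_bc[OF barycentric_H]
  from assms(1) consider k where "U = T m k" | k where "U = T' m k" by (auto simp: TT_def TT'_def)
  then show ?thesis
  proof cases
    case (1 k)
    have "rv k + \<beta> x - (rv k + \<beta> y) = \<beta> x - \<beta> y" by simp
    then show ?thesis
      using m(1)[OF assms(2), of m k] m(1)[OF assms(3), of m k] d 1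
      by (simp only: bc_barycentric assms dist_bc_scale)
  next
    case (2 k)
    have "rv k + 1 - \<beta> x - (rv k + 1 - \<beta> y) = - (\<beta> x - \<beta> y)" by simp
    then show ?thesis
      using m(2)[OF assms(2), of m k] m(2)[OF assms(3), of m k] d 2
      by (simp only: bc_barycentric assms dist_bc_scale linear_neg[OF linear_bc] norm_minus_cancel)
  qed
qed

lemma T_inj:
  assumes "m \<ge> 1" "k \<in> T_index m" "l \<in> T_index m" "T m k = T m l"
  shows "k = l"
proof -
  have "T m k $ 1 = T m l $ 1" using assms by simp
  then have "bc (rv k) = bc (rv l)" using assms(1) by (simp add: T_nth)
  moreover have "sum (($) (rv k)) UNIV = sum (($) (rv l)) UNIV"
    using assms(2,3) by (simp add: T_index_iff sum_3 flip: of_nat_add)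
  ultimately have "rv k = rv l" by (intro bc_inj) auto
  then show ?thesis by (simp add: vec_eq_iff)
qed

lemma T'_inj:
  assumes "m \<ge> 1" "k \<in> T'_index m" "l \<in> T'_index m" "T' m k = T' m l"
  shows "k = l"
proof -
  have "T' m k $ 1 = T' m l $ 1" using assms by simp
  then have "bc (rv k) = bc (rv l)" using assms(1) by (simp add: T'_nth bc_add)
  moreover have "sum (($) (rv k)) UNIV = sum (($) (rv l)) UNIV"
    using assms(2,3) by (simp add: T'_index_iff sum_3 flip: of_nat_add)
  ultimately have "rv k = rv l" by (intro bc_inj) auto
  then show ?thesis by (simp add: vec_eq_iff)
qed

text \<open>The vectors from vertex \<open>1\<close> to vertex \<open>2\<close> point in opposite
  directions.\<close>

lemma T_ne_T':
  assumes "m \<ge> 1"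
  shows "T m k \<noteq> T' m l"
proof
  assume eq: "T m k = T' m l"
  have "T m k $ 2 - T m k $ 1 = (1 / real m) *\<^sub>R (P 2 - P 1)"
    by (simp add: T_nth scaleR_right_diff_distrib[symmetric])
  moreover have "T' m l $ 2 - T' m l $ 1 = - ((1 / real m) *\<^sub>R (P 2 - P 1))"
    by (simp add: T'_nth scaleR_right_diff_distrib scaleR_right_distrib)
  ultimately have "(1 / real m) *\<^sub>R (P 2 - P 1) = - ((1 / real m) *\<^sub>R (P 2 - P 1))"
    using eq by metis
  then have "((1 / real m) *\<^sub>R (P 2 - P 1)) $ 1 = (- ((1 / real m) *\<^sub>R (P 2 - P 1))) $ 1" by metis
  then show False using assms by (simp add: P_vals)
qed

lemma TT_disjoint: "m \<ge> 1 \<Longrightarrow> TT m \<inter> TT' m = {}"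
  using T_ne_T' by (auto simp: TT_def TT'_def)

lemma tri_map_inj:
  assumes "m \<ge> 1" "U \<in> TT m \<union> TT' m" "x \<in> T1" "y \<in> T1" "tri_map U x = tri_map U y"
  shows "x = y"
  using dist_tri_map[OF assms(2-4)] assms by simp

lemma finite_T_index: "finite (T_index m)" "finite (T'_index m)"
proof -
  have fin: "finite {k :: nat^3. \<forall>i. k $ i \<le> m}"
  proof -
    have "{k :: nat^3. \<forall>i. k $ i \<le> m} \<subseteq> (\<lambda>f. \<chi> i. f i) ` (Pi\<^sub>E UNIV (\<lambda>_. {..m}))"
      by (auto intro!: image_eqI[where x = "($) _"] simp: PiE_def Pi_def vec_eq_iff)
    then show ?thesis by (rule finite_subset) (intro finite_imageI finite_PiE, auto)
  qed
  show "finite (T_index m)" "finite (T'_index m)"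
    by (rule finite_subset[OF _ fin], auto simp: T_index_iff T'_index_iff forall_3)+
qed

lemma tri_map_tri_image:
  assumes "\<And>i. V $ i \<in> T1" "x \<in> T1"
  shows "tri_map (tri_image U V) x = tri_map U (tri_map V x)"
proof -
  let ?a = "\<beta> x"
  have a: "?a \<in> H" using barycentric_H assms by auto
  \<comment> \<open>Barycentric coordinates of \<open>tri_map V x\<close>, as a convex combination
    of those of the vertices of \<open>V\<close>.\<close>
  let ?c = "\<Sum>i\<in>UNIV. (?a $ i) *\<^sub>R \<beta> (V $ i)"
  have c: "?c \<in> H"
  proof -
    have "(\<Sum>j\<in>UNIV. ?c $ j) = (\<Sum>i\<in>UNIV. ?a $ i * (\<Sum>j\<in>UNIV. \<beta> (V $ i) $ j))"
      by (simp add: sum_3 algebra_simps)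
    also have "\<dots> = 1" using barycentric_bounds(3)[OF assms(1)] a by (simp add: sum_3 H_iff)
    finally have "?c $ 1 + ?c $ 2 + ?c $ 3 = 1" by (simp only: sum_3)
    moreover have "0 \<le> ?c $ j" for j
      using a barycentric_bounds(1)[OF assms(1)] by (auto simp: H_iff intro!: sum_nonneg)
    ultimately show ?thesis by (simp only: H_iff) simp
  qed
  have "bc ?c = tri_map V x"
    unfolding tri_map_def linear_sum[OF linear_bc] bc_scaleR using bc_barycentric[OF assms(1)] by simp
  then have "tri_map U (tri_map V x) = (\<Sum>j\<in>UNIV. (?c $ j) *\<^sub>R (U $ j))"
    using tri_map_bc[OF c, of U] by simp
  also have "\<dots> = (\<Sum>j\<in>UNIV. \<Sum>i\<in>UNIV. (?a $ i * \<beta> (V $ i) $ j) *\<^sub>R (U $ j))"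
    by (simp add: scaleR_sum_left)
  also have "\<dots> = (\<Sum>i\<in>UNIV. (?a $ i) *\<^sub>R (\<Sum>j\<in>UNIV. (\<beta> (V $ i) $ j) *\<^sub>R (U $ j)))"
    by (subst sum.swap) (simp add: scaleR_sum_right)
  also have "\<dots> = tri_map (tri_image U V) x"
    by (simp add: tri_map_def tri_image_def)
  finally show ?thesis by simp
qed

section \<open>Contact of cells in the fractals\<close>

lemma ex_3: "(\<exists>i::3. R i) \<longleftrightarrow> R 1 \<or> R 2 \<or> R 3"
  using forall_3[of "\<lambda>i. \<not> R i"] by blast

lemma two_others_3:
  obtains j l :: 3 where "j \<noteq> i" "l \<noteq> i" "l \<noteq> j"
  using exhaust_3[of i] that[of 2 3] that[of 1 3] that[of 1 2] by auto

lemma barycentric_vertex: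
  assumes "x \<in> T1" "\<beta> x $ i = 1" "j \<noteq> i"
  shows "\<beta> x $ j = 0"
  using barycentric_bounds(3)[OF assms(1)] barycentric_bounds(1)[OF assms(1), of 1]
    barycentric_bounds(1)[OF assms(1), of 2] barycentric_bounds(1)[OF assms(1), of 3]
    exhaust_3[of i] exhaust_3[of j] assms(2,3) by auto

lemma P_eqI:
  assumes "x \<in> T1" "\<beta> x $ i = 1"
  shows "x = P i"
proof (rule barycentric_inj[OF assms(1) P_T1])
  fix j
  show "\<beta> x $ j = \<beta> (P i) $ j" using barycentric_vertex[OF assms] assms(2) by (simp add: barycentric_P)
qed

text \<open>Coordinates lie in \<open>[0, 1]\<close> and indices are integers, so a difference of
  indices forces the coordinates \<open>1\<close> and \<open>0\<close>; equal index sums force a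
  difference in each direction.\<close>

lemma parallel_cells:
  fixes k l :: "nat^3"
  assumes x: "x \<in> T1" "y \<in> T1" and kl: "k \<noteq> l" "k $ 1 + k $ 2 + k $ 3 = l $ 1 + l $ 2 + l $ 3"
    and eq: "\<And>i. real (k $ i) + \<beta> x $ i = real (l $ i) + \<beta> y $ i"
  shows "\<exists>i j. i \<noteq> j \<and> x = P i \<and> y = P j"
proof -
  have big: "\<beta> x $ i = 1 \<and> \<beta> y $ i = 0" if "k $ i < l $ i" for i
  proof -
    have "real (k $ i) + 1 \<le> real (l $ i)" using that by linarith
    then show ?thesis using eq[of i] barycentric_bounds(1,2)[OF x(1), of i]
      barycentric_bounds(1,2)[OF x(2), of i] by linarith
  qed
  have small: "\<beta> y $ i = 1 \<and> \<beta> x $ i = 0" if "l $ i < k $ i" for i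
  proof -
    have "real (l $ i) + 1 \<le> real (k $ i)" using that by linarith
    then show ?thesis using eq[of i] barycentric_bounds(1,2)[OF x(1), of i]
      barycentric_bounds(1,2)[OF x(2), of i] by linarith
  qed
  have "\<not> (\<forall>i. k $ i = l $ i)" using kl(1) by (simp add: vec_eq_iff)
  then have "(\<exists>i. k $ i < l $ i) \<and> (\<exists>j. l $ j < k $ j)"
    using kl(2) unfolding forall_3 ex_3 by linarith
  then obtain i j where "k $ i < l $ i" "l $ j < k $ j" by blast
  moreover from this have "i \<noteq> j" by auto
  ultimately show ?thesis using P_eqI[OF x(1)] P_eqI[OF x(2)] big small by metis
qed

text \<open>The \<open>n i\<close> lie between \<open>0\<close> and \<open>2\<close> and add up to
  \<open>2\<close>: either one of them is \<open>2\<close>, and both points are the same vertex, or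
  exactly one is \<open>0\<close>, and the points lie opposite on side \<open>j\<close>.\<close>

lemma opposite_cells:
  fixes n :: "3 \<Rightarrow> int"
  assumes x: "x \<in> T1" "y \<in> T1" and eq: "\<And>i. \<beta> x $ i + \<beta> y $ i = of_int (n i)"
  shows "(\<exists>i. x = P i \<and> y = P i) \<or> (\<exists>j. \<forall>i. n i = (if i = j then 0 else 1))"
proof -
  have n: "0 \<le> n i" "n i \<le> 2" for i
    using eq[of i] barycentric_bounds(1,2)[OF x(1), of i] barycentric_bounds(1,2)[OF x(2), of i] by linarith+
  have s: "n 1 + n 2 + n 3 = 2"
    using eq[of 1] eq[of 2] eq[of 3] barycentric_bounds(3)[OF x(1)] barycentric_bounds(3)[OF x(2)] by linarith
  show ?thesis
  proof (cases "\<exists>i. n i = 2")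
    case True
    then obtain i where "n i = 2" by blast
    then have "\<beta> x $ i = 1" "\<beta> y $ i = 1"
      using eq[of i] barycentric_bounds(2)[OF x(1), of i] barycentric_bounds(2)[OF x(2), of i] by linarith+
    then show ?thesis using P_eqI x by blast
  next
    case False
    have "n i = 0 \<or> n i = 1" for i
    proof -
      have "n i \<noteq> 2" using False by blast
      then show ?thesis using n[of i] by arith
    qed
    from this[of 1] this[of 2] this[of 3] s
    have "(n 1 = 0 \<and> n 2 = 1 \<and> n 3 = 1) \<or> (n 1 = 1 \<and> n 2 = 0 \<and> n 3 = 1) \<or> (n 1 = 1 \<and> n 2 = 1 \<and> n 3 = 0)"
      by auto
    then have "\<exists>j. \<forall>i. n i = (if i = j then 0 else 1)"
      by (auto simp: ex_3 forall_3)
    then show ?thesis by blast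
  qed
qed

text \<open>Index of triangle number \<open>n\<close> on side \<open>i\<close>. The two colours
  count from opposite ends, so that the exits property speaks of one number per side for
  both.\<close>

definition pos :: "nat \<Rightarrow> bool \<Rightarrow> 3 \<Rightarrow> nat \<Rightarrow> nat^3" where
  "pos m c i n = (if c then
       if i = 1 then vector [0, n, m - 1 - n] else if i = 2 then vector [n, 0, m - 1 - n] else
         vector [n, m - 1 - n, 0]
     else
       if i = 1 then vector [0, m - 1 - n, n] else if i = 2 then vector [m - 1 - n, 0, n] else
         vector [m - 1 - n, n, 0])"

lemma white_exit_at_pos: "white_exit_at m k i = T m (pos m True i (k $ i))"
  using exhaust_3[of i] by (auto simp: white_exit_at_def pos_def)

lemma yellow_exit_at_pos: "k $ i \<le> m - 1 \<Longrightarrow> yellow_exit_at m k i = T m (pos m False i (k $ i))"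
  using exhaust_3[of i] by (auto simp: yellow_exit_at_def pos_def)

lemma pos_nth:
  assumes "n \<le> m - 1"
  shows "pos m c i n $ i = 0" "pos m c i n \<in> T_index m"
    "j \<noteq> i \<Longrightarrow> pos m c i n $ j + pos m (\<not> c) i n $ j = m - 1"
  using assms exhaust_3[of i] exhaust_3[of j] by (auto simp: pos_def T_index_iff)

lemma pos_inj:
  assumes "n \<le> m - 1" "n' \<le> m - 1" "pos m c i n = pos m c i n'"
  shows "n = n'"
proof -
  have "pos m c i n $ j = pos m c i n' $ j" for j using assms by simp
  from this[of 1] this[of 2] show ?thesis
    using assms(1,2) exhaust_3[of i] by (auto simp: pos_def split: if_splits)
qed

lemma pos_surj:
  assumes "k \<in> T_index m" "k $ i = 0"
  shows "\<exists>n\<le>m - 1. k = pos m c i n"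
proof -
  define p where "p = (if i = 1 then k $ 2 else k $ 1)"
  have "k = pos m c i (if c then p else m - 1 - p) \<and> p \<le> m - 1"
    using assms exhaust_3[of i]
    by (auto simp: pos_def p_def T_index_iff vec_eq_iff forall_3)
  then show ?thesis by (intro exI[of _ "if c then p else m - 1 - p"]) auto
qed

lemma pos_opposite:
  assumes "k \<in> T_index m" "l \<in> T_index m" "k $ i = 0" "l $ i = 0" "\<And>j. j \<noteq> i \<Longrightarrow> k $ j + l $ j = m - 1"
  shows "\<exists>n\<le>m - 1. k = pos m c i n \<and> l = pos m (\<not> c) i n"
proof -
  obtain n where n: "n \<le> m - 1" "k = pos m c i n" using pos_surj[OF assms(1,3)] by blast
  have "l $ j = pos m (\<not> c) i n $ j" for j
  proof (cases "j = i")
    case False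
    show ?thesis using assms(5)[OF False] pos_nth(3)[OF n(1) False, of c] n(2) by simp
  qed (use assms(4) pos_nth(1)[OF n(1)] in simp)
  then show ?thesis using n by (auto simp: vec_eq_iff)
qed

lemma exit_triple_iff:
  "exit_triple m S k \<longleftrightarrow>
   (\<forall>i. k $ i \<le> m - 1 \<and> T m (pos m True i (k $ i)) \<in> white S \<and> T m (pos m False i (k $ i)) \<in> yellow S)"
proof -
  have "k $ i \<in> {0..m - 1} \<and> white_exit_at m k i \<in> white S \<and> yellow_exit_at m k i \<in> yellow S \<longleftrightarrow>
    k $ i \<le> m - 1 \<and> T m (pos m True i (k $ i)) \<in> white S \<and> T m (pos m False i (k $ i)) \<in> yellow S" for i
    by (cases "k $ i \<le> m - 1") (simp_all add: white_exit_at_pos yellow_exit_at_pos)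
  then show ?thesis unfolding exit_triple_def by blast
qed

text \<open>The conditions on the three components do not interact, and changing one component of a
  triple gives another triple; so uniqueness can be settled side by side.\<close>

lemma white_yellow_exits_ex1:
  "(\<exists>!k. exit_triple m S k) \<longleftrightarrow>
   (\<forall>i. \<exists>!n. n \<le> m - 1 \<and> T m (pos m True i n) \<in> white S \<and> T m (pos m False i n) \<in> yellow S)"
  (is "_ \<longleftrightarrow> (\<forall>i. \<exists>!n. ?R i n)")
proof -
  show ?thesis
    unfolding exit_triple_iff
  proof
    assume "\<exists>!k :: nat^3. \<forall>i. ?R i (k $ i)"
    then obtain k :: "nat^3" where k: "\<And>i. ?R i (k $ i)" "\<And>l. (\<forall>i. ?R i (l $ i)) \<Longrightarrow> l = k" by blast
    show "\<forall>i. \<exists>!n. ?R i n"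
    proof
      fix i
      show "\<exists>!n. ?R i n"
      proof (rule ex1I[of _ "k $ i"])
        fix n assume "?R i n"
        then have "\<forall>l. ?R l ((\<chi> j. if j = i then n else k $ j) $ l)" using k(1) by simp
        from k(2)[OF this] have "(\<chi> j. if j = i then n else k $ j) $ i = k $ i" by (rule arg_cong)
        then show "n = k $ i" by simp
      qed (rule k)
    qed
  next
    assume R: "\<forall>i. \<exists>!n. ?R i n"
    define f where "f i = (THE n. ?R i n)" for i
    have f: "?R i (f i)" for i
    proof -
      have "\<exists>!n. ?R i n" using R by (rule spec)
      then have "?R i (THE n. ?R i n)" by (rule theI')
      then show ?thesis by (simp only: f_def)
    qed
    show "\<exists>!k :: nat^3. \<forall>i. ?R i (k $ i)"
    proof (rule ex1I[of _ "\<chi> i. f i"])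
      fix l :: "nat^3" assume l: "\<forall>i. ?R i (l $ i)"
      have "l $ i = f i" for i using R l f by blast
      then show "l = (\<chi> i. f i)" by (simp add: vec_eq_iff)
    qed (use f in auto)
  qed
qed

section \<open>The two fractals as one recursive pair of compact sets\<close>

locale labyrinth =
  fixes m :: nat and S :: patterns
  assumes lps: "labyrinth_patterns_system m S"
begin

definition up :: "bool \<Rightarrow> triangle set" where "up c = (if c then white S else yellow S)"
definition dn :: "bool \<Rightarrow> triangle set" where "dn c = (if c then white' S else yellow' S)"
definition cells :: "bool \<Rightarrow> triangle set" where "cells c = up c \<union> dn c"

text \<open>Inverted triangles of one colour are subdivided according to the pattern of the other.\<close>

definition col :: "bool \<Rightarrow> triangle \<Rightarrow> bool" where "col c U = (if U \<in> TT m then c else \<not> c)"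

definition idx :: "triangle \<Rightarrow> nat^3" where
  "idx U = (if U \<in> TT m then THE k. k \<in> T_index m \<and> U = T m k else THE k. k \<in> T'_index m \<and> U = T' m k)"

lemma m: "m \<ge> 2"
  using lps by (auto simp: labyrinth_patterns_system_def patterns_system_def)

lemma up_sub: "up c \<subseteq> TT m" and dn_sub: "dn c \<subseteq> TT' m"
  using lps by (auto simp: labyrinth_patterns_system_def patterns_system_def up_def dn_def)

lemma cells_sub: "cells c \<subseteq> TT m \<union> TT' m"
  using up_sub dn_sub by (auto simp: cells_def)

lemma cells_all: "cells True = white_all S" "cells False = yellow_all S"
  by (auto simp: cells_def up_def dn_def)

lemma in_cells_iff: "U \<in> cells c \<longleftrightarrow> U \<in> TT m \<and> U \<in> up c \<or> U \<in> TT' m \<and> U \<in> dn c"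
  using up_sub dn_sub by (auto simp: cells_def)

lemma TT'_iff: "U \<in> cells c \<Longrightarrow> U \<in> TT' m \<longleftrightarrow> U \<notin> TT m"
  using cells_sub TT_disjoint[of m] m by fastforce

lemma finite_cells: "finite (cells c)"
  by (rule finite_subset[OF cells_sub]) (simp add: TT_def TT'_def finite_T_index)

lemma idx_T: "k \<in> T_index m \<Longrightarrow> idx (T m k) = k"
  using m T_inj[of m] by (auto simp: idx_def TT_def intro!: the_equality)

lemma idx_T': "k \<in> T'_index m \<Longrightarrow> idx (T' m k) = k"
proof -
  assume k: "k \<in> T'_index m"
  then have "T' m k \<in> TT' m" by (simp add: TT'_def)
  then have "T' m k \<notin> TT m" using TT_disjoint[of m] m by auto
  then show "idx (T' m k) = k"
    using k T'_inj[of m k] m by (auto simp: idx_def intro!: the_equality)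
qed

lemma idx_up: "U \<in> TT m \<Longrightarrow> idx U \<in> T_index m \<and> U = T m (idx U)"
  by (auto simp: TT_def idx_T)

lemma idx_dn: "U \<in> TT' m \<Longrightarrow> idx U \<in> T'_index m \<and> U = T' m (idx U)"
  by (auto simp: TT'_def idx_T')

lemma map_T1: "U \<in> cells c \<Longrightarrow> x \<in> T1 \<Longrightarrow> tri_map U x \<in> T1"
  using cells_sub[of c] tri_map_T(1)[OF m] tri_map_T'(1)[OF m] by (auto simp: TT_def TT'_def)

lemma map_up: "U \<in> TT m \<Longrightarrow> x \<in> T1 \<Longrightarrow> real m * \<beta> (tri_map U x) $ i = real (idx U $ i) + \<beta> x $ i"
  using tri_map_T(2)[OF m, of "idx U" x i] idx_up[of U] by simp

lemma map_dn: "U \<in> TT' m \<Longrightarrow> x \<in> T1 \<Longrightarrow> real m * \<beta> (tri_map U x) $ i = real (idx U $ i) + 1 - \<beta> x $ i"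
  using tri_map_T'(2)[OF m, of "idx U" x i] idx_dn[of U] by simp

lemma map_dist: "U \<in> cells c \<Longrightarrow> x \<in> T1 \<Longrightarrow> y \<in> T1 \<Longrightarrow> dist (tri_map U x) (tri_map U y) = dist x y / real m"
  using dist_tri_map cells_sub by blast

lemma map_inj: "U \<in> cells c \<Longrightarrow> x \<in> T1 \<Longrightarrow> y \<in> T1 \<Longrightarrow> tri_map U x = tri_map U y \<Longrightarrow> x = y"
  using tri_map_inj[of m U] cells_sub m by auto

lemma map_cont:
  assumes "U \<in> cells c"
  shows "continuous_on T1 (tri_map U)"
proof (rule continuous_onI)
  fix x :: "real^2" and e :: real assume "0 < e" "x \<in> T1"
  then show "\<exists>d>0. \<forall>x'\<in>T1. dist x' x < d \<longrightarrow> dist (tri_map U x') (tri_map U x) \<le> e"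
    using map_dist[OF assms] m by (intro exI[of _ "e * real m"]) (auto simp: divide_le_eq)
qed

text \<open>The recursion peels off the outermost cell, whereas \<open>level\<close> subdivides the
  innermost ones; \<open>frac_eq\<close> shows that the intersections agree.\<close>

primrec lev :: "nat \<Rightarrow> bool \<Rightarrow> (real^2) set" where
  "lev 0 c = T1"
| "lev (Suc n) c = (\<Union>U\<in>cells c. tri_map U ` lev n (col c U))"

definition frac :: "bool \<Rightarrow> (real^2) set" where "frac c = (\<Inter>n. lev n c)"

lemma lev_T1: "lev n c \<subseteq> T1"
proof (induction n arbitrary: c)
  case (Suc n)
  then show ?case using map_T1 by force
qed simp

lemma lev_Suc_sub: "lev (Suc n) c \<subseteq> lev n c"
proof (induction n arbitrary: c)
  case 0
  show ?case using lev_T1[of "Suc 0"] by (simp only: lev.simps(1))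
next
  case (Suc n)
  have "lev (Suc (Suc n)) c = (\<Union>U\<in>cells c. tri_map U ` lev (Suc n) (col c U))" by (rule lev.simps(2))
  also have "\<dots> \<subseteq> (\<Union>U\<in>cells c. tri_map U ` lev n (col c U))" using Suc by (intro UN_mono image_mono) auto
  finally show ?case by simp
qed

lemma lev_mono: "n \<le> k \<Longrightarrow> lev k c \<subseteq> lev n c"
  using lift_Suc_antimono_le[of "\<lambda>n. lev n c" n k] lev_Suc_sub by blast

lemma compact_lev: "compact (lev n c)"
proof (induction n arbitrary: c)
  case 0
  then show ?case using compact_T1 by simp
next
  case (Suc n)
  show ?case unfolding lev.simps
    using Suc finite_cells continuous_on_subset[OF map_cont lev_T1]
    by (intro compact_UN compact_continuous_image) auto
qed

lemma frac_T1: "frac c \<subseteq> T1"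
  using lev.simps(1) unfolding frac_def by blast

lemma compact_frac: "compact (frac c)"
  unfolding frac_def by (intro compact_Inter) (use compact_lev in auto)

text \<open>A point of the fractal lies, for every \<open>n\<close>, in some cell image of level
  \<open>n\<close>. As the cells are finitely many and the levels decrease, one cell serves all
  \<open>n\<close>, and injectivity of its map makes the preimages agree.\<close>

lemma frac_rec: "frac c = (\<Union>U\<in>cells c. tri_map U ` frac (col c U))"
proof (intro equalityI subsetI)
  fix x assume x: "x \<in> frac c"
  have "\<exists>U. U \<in> cells c \<and> x \<in> tri_map U ` lev n (col c U)" for n
  proof -
    have "x \<in> lev (Suc n) c" using x unfolding frac_def by blast
    then show ?thesis by auto
  qed
  then have "\<forall>n. \<exists>U. U \<in> cells c \<and> x \<in> tri_map U ` lev n (col c U)" by blast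
  from choice[OF this] obtain f where f: "\<And>n. f n \<in> cells c"
    "\<And>n. x \<in> tri_map (f n) ` lev n (col c (f n))" by blast
  have "\<exists>U\<in>cells c. infinite {n \<in> UNIV. f n = U}"
    using f(1) finite_cells by (intro pigeonhole_infinite_rel[of UNIV, simplified]) auto
  then obtain U where U: "U \<in> cells c" "infinite {n. f n = U}" by auto
  have *: "x \<in> tri_map U ` lev n (col c U)" for n
  proof -
    obtain k where k: "k \<ge> n" "f k = U" using U(2) by (metis (mono_tags, lifting)
      infinite_nat_iff_unbounded_le mem_Collect_eq)
    then show ?thesis using f(2)[of k] lev_mono[OF k(1)] by blast
  qed
  from *[of 0] obtain y where y: "y \<in> T1" "x = tri_map U y" by auto
  have "y \<in> lev n (col c U)" for n
  proof -
    obtain z where z: "z \<in> lev n (col c U)" "x = tri_map U z" using *[of n] by blast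
    then have "z \<in> T1" using lev_T1 by blast
    then have "y = z" using map_inj[OF U(1) y(1)] y(2) z(2) by simp
    then show ?thesis using z by simp
  qed
  then show "x \<in> (\<Union>U\<in>cells c. tri_map U ` frac (col c U))" using U(1) y(2) by (auto simp: frac_def)
next
  fix x assume "x \<in> (\<Union>U\<in>cells c. tri_map U ` frac (col c U))"
  then obtain U y where U: "U \<in> cells c" "y \<in> frac (col c U)" "x = tri_map U y" by blast
  have "x \<in> lev n c" for n
  proof (cases n)
    case 0
    have "y \<in> T1" using U(2) frac_T1 by blast
    then show ?thesis using U map_T1 0 by simp
  next
    case (Suc k)
    then show ?thesis using U by (auto simp: frac_def)
  qed
  then show "x \<in> frac c" by (simp add: frac_def)
qed

text \<open>An inverted cell cannot reach the corner, because two coordinates of the preimage would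
  have to equal \<open>1\<close>.\<close>

lemma corner_frac:
  assumes "P i \<in> frac c"
  shows "\<exists>U\<in>corner_triangles (up c). \<forall>j. j \<noteq> i \<longrightarrow> idx U $ j = 0"
proof -
  obtain U x where U: "U \<in> cells c" "x \<in> T1" "P i = tri_map U x"
    using assms frac_T1 by (subst (asm) frac_rec) blast
  show ?thesis
  proof (cases "U \<in> TT m")
    case True
    then have "U \<in> up c" using U(1) TT'_iff[OF U(1)] by (auto simp: in_cells_iff)
    moreover have "P i \<in> region U" using U by (auto simp: region_eq)
    moreover have "idx U $ j = 0" if "j \<noteq> i" for j
      using map_up[OF True U(2), of j] U(3) barycentric_P[of i j] that barycentric_bounds(1)[OF
        U(2), of j] by simp
    ultimately show ?thesis by (auto simp: corner_triangles_def)
  next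
    case False
    then have "U \<in> TT' m" using TT'_iff[OF U(1)] by simp
    then have one: "\<beta> x $ j = 1" if "j \<noteq> i" for j
      using map_dn[OF _ U(2), of U j] U(3) barycentric_P[of i j] that barycentric_bounds(2)[OF U(2),
        of j] by simp
    obtain j l :: 3 where "j \<noteq> i" "l \<noteq> i" "l \<noteq> j" by (rule two_others_3)
    then have False
      using barycentric_vertex[OF U(2) one[of j], of l] one[of l] by simp
    then show ?thesis ..
  qed
qed

text \<open>Both halves of the corners property in one equivalence: equal colours give equal
  corners, and equal corners give equal colours. Contacts of parallel cells in a vertex contradict
  the first half, those of opposite cells the second.\<close>

lemma corner_unique:
  assumes "P i \<in> frac c" "P j \<in> frac c'"
  shows "c = c' \<longleftrightarrow> i = j"
proof -
  obtain U V where U: "U \<in> corner_triangles (up c)" "\<And>l. l \<noteq> i \<Longrightarrow> idx U $ l = 0"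
    and V: "V \<in> corner_triangles (up c')" "\<And>l. l \<noteq> j \<Longrightarrow> idx V $ l = 0"
    using corner_frac[OF assms(1)] corner_frac[OF assms(2)] by blast
  have TT: "U \<in> TT m" "V \<in> TT m" using U V up_sub by (auto simp: corner_triangles_def)
  have card: "card (corner_triangles (up c)) \<le> 1" and disj:
    "corner_triangles (up True) \<inter> corner_triangles (up False) = {}"
    using lps by (auto simp: labyrinth_patterns_system_def up_def)
  have sum: "idx U $ 1 + idx U $ 2 + idx U $ 3 = m - 1" "idx V $ 1 + idx V $ 2 + idx V $ 3 = m - 1"
    using idx_up TT T_index_iff by auto
  have Ui: "idx U $ i = m - 1"
    using sum(1) U(2)[of 1] U(2)[of 2] U(2)[of 3] exhaust_3[of i] by auto
  have Vj: "idx V $ j = m - 1"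
    using sum(2) V(2)[of 1] V(2)[of 2] V(2)[of 3] exhaust_3[of j] by auto
  show ?thesis
  proof
    assume "c = c'"
    have "finite (corner_triangles (up c))"
      by (rule finite_subset[OF _ finite_cells[of c]]) (auto simp: corner_triangles_def cells_def)
    then have "U = V" using card U V \<open>c = c'\<close> by (auto simp: card_le_Suc0_iff_eq)
    then show "i = j" using Ui V(2)[of i] m by (cases "i = j") auto
  next
    assume "i = j"
    have "idx U = idx V"
      unfolding vec_eq_iff using Ui Vj U(2) V(2) \<open>i = j\<close> by metis
    then have "U = V" using idx_up TT by metis
    then show "c = c'" using U V disj by (cases c; cases c') auto
  qed
qed

section \<open>Exits of the first level and exit points\<close>

definition \<kappa> :: "3 \<Rightarrow> nat" where "\<kappa> i = (THE k. exit_triple m S k) $ i"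

definition exit :: "bool \<Rightarrow> 3 \<Rightarrow> triangle" where "exit c i = T m (pos m c i (\<kappa> i))"

text \<open>The fixed point of the map of the exit cell: in coordinates it solves
  \<open>m * x = p + x\<close>, where \<open>p\<close> is the index of the exit.\<close>

definition E :: "bool \<Rightarrow> 3 \<Rightarrow> real^2" where
  "E c i = bc ((1 / (real m - 1)) *\<^sub>R rv (pos m c i (\<kappa> i)))"

lemma \<kappa>: "\<kappa> i \<le> m - 1" "exit c i \<in> up c"
proof -
  have "\<exists>!k. exit_triple m S k" using lps by (simp add: labyrinth_patterns_system_def)
  then have "exit_triple m S (THE k. exit_triple m S k)" by (rule theI')
  then have "\<kappa> i \<le> m - 1 \<and> T m (pos m True i (\<kappa> i)) \<in> white S \<and> T m (pos m False i (\<kappa> i)) \<in> yellow S"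
    unfolding exit_triple_iff[of m S] \<kappa>_def by blast
  then show "\<kappa> i \<le> m - 1" "exit c i \<in> up c" by (auto simp: exit_def up_def)
qed

lemma \<kappa>_unique:
  assumes "n \<le> m - 1" "T m (pos m c i n) \<in> up c" "T m (pos m (\<not> c) i n) \<in> up (\<not> c)"
  shows "n = \<kappa> i"
proof -
  have "\<exists>!k. exit_triple m S k" using lps by (simp add: labyrinth_patterns_system_def)
  then have "\<exists>!n. n \<le> m - 1 \<and> T m (pos m True i n) \<in> white S \<and> T m (pos m False i n) \<in> yellow S"
    unfolding white_yellow_exits_ex1 by blast
  then show ?thesis using assms \<kappa>(1)[of i] \<kappa>(2)[of True i] \<kappa>(2)[of False i]
    by (cases c) (auto simp: up_def exit_def)
qed

lemma white_exit_eq: "white_exit m S i = exit True i"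
  by (simp add: white_exit_def exit_def \<kappa>_def white_exit_at_pos)

lemma yellow_exit_eq: "yellow_exit m S i = exit False i"
  using \<kappa>(1)[of i] by (simp add: yellow_exit_def exit_def \<kappa>_def yellow_exit_at_pos)

lemma exit_TT: "exit c i \<in> TT m" and exit_cells: "exit c i \<in> cells c"
  using \<kappa>(2) up_sub by (auto simp: cells_def)

lemma idx_exit: "idx (exit c i) = pos m c i (\<kappa> i)"
  unfolding exit_def using pos_nth(2)[OF \<kappa>(1)] by (rule idx_T)

lemma E_T1: "E c i \<in> T1" and barycentric_E: "(real m - 1) * \<beta> (E c i) $ j = real (pos m c i (\<kappa> i) $ j)"
proof -
  let ?p = "pos m c i (\<kappa> i)"
  have "?p $ 1 + ?p $ 2 + ?p $ 3 = m - 1" using pos_nth(2)[OF \<kappa>(1)] T_index_iff by blast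
  then have "real (?p $ 1) + real (?p $ 2) + real (?p $ 3) = real m - 1" using m by linarith
  then have "(1 / (real m - 1)) *\<^sub>R rv ?p \<in> H"
    using m by (auto simp: H_iff add_divide_distrib[symmetric])
  then show "E c i \<in> T1" "(real m - 1) * \<beta> (E c i) $ j = real (pos m c i (\<kappa> i) $ j)"
    using m by (auto simp: E_def T1_def barycentric_bc)
qed

lemma E_fixed: "tri_map (exit c i) (E c i) = E c i"
proof (rule barycentric_inj[OF map_T1[OF exit_cells E_T1] E_T1])
  fix j
  have "real m * \<beta> (tri_map (exit c i) (E c i)) $ j = real (pos m c i (\<kappa> i) $ j) + \<beta> (E c i) $ j"
    using map_up[OF exit_TT E_T1] by (simp add: idx_exit)
  also have "\<dots> = real m * \<beta> (E c i) $ j" using barycentric_E[of c i j] by (simp add: algebra_simps)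
  finally show "\<beta> (tri_map (exit c i) (E c i)) $ j = \<beta> (E c i) $ j" using m by simp
qed

lemma E_frac: "E c i \<in> frac c"
proof -
  have "E c i \<in> lev n c" for n
  proof (induction n)
    case 0
    then show ?case using E_T1 by simp
  next
    case (Suc n)
    have "col c (exit c i) = c" using exit_TT by (simp add: col_def)
    then have "tri_map (exit c i) (E c i) \<in> tri_map (exit c i) ` lev n (col c (exit c i))" using Suc by auto
    then show ?case using exit_cells[of c i] by (auto simp: E_fixed)
  qed
  then show ?thesis by (simp add: frac_def)
qed

lemma E_mirror: "\<beta> (E c j) $ i + \<beta> (E (\<not> c) j) $ i = (if i = j then 0 else 1)"
proof -
  have "real (pos m c j (\<kappa> j) $ i) + real (pos m (\<not> c) j (\<kappa> j) $ i) = (if i = j then 0 else real m - 1)"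
    using pos_nth(1)[OF \<kappa>(1)[of j]] pos_nth(3)[OF \<kappa>(1)[of j], where j = i and c = c] m
    by (simp flip: of_nat_add)
  then have "(real m - 1) * (\<beta> (E c j) $ i + \<beta> (E (\<not> c) j) $ i) = (real m - 1) * (if i = j then 0 else 1)"
    by (simp add: distrib_left barycentric_E)
  then show ?thesis using m by simp
qed

text \<open>A common point of two \<open>j\<close>-neighbours has, in the two cells, opposite barycentric coordinates.\<close>

definition facing :: "bool \<Rightarrow> 3 \<Rightarrow> real^2 \<Rightarrow> real^2 \<Rightarrow> bool" where
  "facing c j a b \<longleftrightarrow> a \<in> frac c \<and> b \<in> frac (\<not> c) \<and> (\<forall>i. \<beta> a $ i + \<beta> b $ i = (if i = j then 0 else 1))"

lemma facing_sym: "facing c j a b \<Longrightarrow> facing (\<not> c) j b a"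
  by (auto simp: facing_def add.commute)

text \<open>In coordinate \<open>j\<close> the cells leave no choice but \<open>b' = P j\<close>.
  Then the coordinates of \<open>a'\<close> are integers, so \<open>a'\<close> is a different corner
  of the same fractal, against \<open>corner_unique\<close>.\<close>

lemma facing_not_mixed:
  assumes f: "facing c j a b" and U: "U \<in> TT m" "a' \<in> frac c" "a = tri_map U a'"
    and V: "V \<in> TT' m" "b' \<in> frac c" "b = tri_map V b'"
  shows False
proof -
  have T1: "a' \<in> T1" "b' \<in> T1" using U V frac_T1 by auto
  note bd = barycentric_bounds(1,2)[OF T1(1)] barycentric_bounds(1,2)[OF T1(2)]
  have e: "real (idx U $ i) + \<beta> a' $ i + real (idx V $ i) + 1 - \<beta> b' $ i = (if i = j then 0 else
    real m)" for i
  proof -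
    have "real m * \<beta> a $ i + real m * \<beta> b $ i = (if i = j then 0 else real m)"
      using f by (auto simp: facing_def distrib_left[symmetric])
    then show ?thesis using map_up[OF U(1) T1(1), of i] map_dn[OF V(1) T1(2), of i] U(3) V(3) by simp
  qed
  have z: "\<beta> b' $ j = 1" "\<beta> a' $ j = 0" using e[of j] bd[of j] by auto
  then have b': "b' = P j" using P_eqI[OF T1(2)] by blast
  have zo: "\<beta> a' $ i = 0 \<or> \<beta> a' $ i = 1" if "i \<noteq> j" for i
  proof -
    define z where "z = int m - int (idx U $ i) - int (idx V $ i) - 1"
    have "\<beta> a' $ i = of_int z" using e[of i] that barycentric_P[of j i] by (simp add: b' z_def)
    moreover from this have "0 \<le> z" "z \<le> 1" using bd(1,2)[of i] by auto
    then have "z = 0 \<or> z = 1" by auto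
    ultimately show ?thesis by auto
  qed
  have "\<exists>i. i \<noteq> j \<and> \<beta> a' $ i = 1"
  proof (rule ccontr)
    assume "\<not> ?thesis"
    then have "\<beta> a' $ i = 0" for i using zo[of i] z(2) by (cases "i = j") blast+
    then show False using barycentric_bounds(3)[OF T1(1)] by simp
  qed
  then obtain i where i: "i \<noteq> j" "\<beta> a' $ i = 1" by blast
  then show False using corner_unique[of i c j c] P_eqI[OF T1(1)] U(2) V(2) b' by auto
qed

text \<open>Both points lie on side \<open>j\<close>. An inverted cell reaches that side only in a
  vertex, so both cells are upright; their positions are mirrored, hence they are the exits, and the
  preimages face each other again.\<close>

lemma facing_step:
  assumes f: "facing c j a b"
  shows "\<exists>a' b'. facing c j a' b' \<and> a = tri_map (exit c j) a'"
proof -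
  obtain U a' where U: "U \<in> cells c" "a' \<in> frac (col c U)" "a = tri_map U a'"
    using f frac_rec[of c] by (auto simp: facing_def)
  obtain V b' where V: "V \<in> cells (\<not> c)" "b' \<in> frac (col (\<not> c) V)" "b = tri_map V b'"
    using f frac_rec[of "\<not> c"] by (auto simp: facing_def)
  have T1: "a' \<in> T1" "b' \<in> T1" using U V frac_T1 by auto
  have eq: "real m * \<beta> a $ i + real m * \<beta> b $ i = (if i = j then 0 else real m)" for i
    using f by (auto simp: facing_def distrib_left[symmetric])
  note bd = barycentric_bounds(1,2)[OF T1(1)] barycentric_bounds(1,2)[OF T1(2)]
  consider (uu) "U \<in> TT m" "V \<in> TT m" | (ud) "U \<in> TT m" "V \<in> TT' m"
    | (du) "U \<in> TT' m" "V \<in> TT m" | (dd) "U \<in> TT' m" "V \<in> TT' m"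
    using TT'_iff[OF U(1)] TT'_iff[OF V(1)] by blast
  then show ?thesis
  proof cases
    case uu
    then have c: "col c U = c" "col (\<not> c) V = (\<not> c)" by (auto simp: col_def)
    have e: "real (idx U $ i) + \<beta> a' $ i + real (idx V $ i) + \<beta> b' $ i = (if i = j then 0 else real m)" for i
      using eq[of i] map_up[OF uu(1) T1(1), of i] map_up[OF uu(2) T1(2), of i] U V by simp
    define n where "n i = (if i = j then 0 else int m) - int (idx U $ i) - int (idx V $ i)" for i
    have n: "\<beta> a' $ i + \<beta> b' $ i = of_int (n i)" for i using e[of i] by (auto simp: n_def)
    from opposite_cells[OF T1 n]
    show ?thesis
    proof
      assume "\<exists>i. a' = P i \<and> b' = P i"
      then show ?thesis using corner_unique[of _ c _ "\<not> c"] U V c by auto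
    next
      assume "\<exists>l. \<forall>i. n i = (if i = l then 0 else 1)"
      then obtain l where l: "\<And>i. n i = (if i = l then 0 else 1)" by blast
      \<comment> \<open>Only the value at \<open>l\<close> fails to be positive, which identifies
        \<open>l\<close> with \<open>j\<close>.\<close>
      have "n j \<le> 0" by (simp add: n_def)
      then have "l = j" using l[of j] by (auto split: if_splits)
      have z: "idx U $ j = 0" "idx V $ j = 0" using l[of j] \<open>l = j\<close> by (auto simp: n_def)
      have o: "idx U $ i + idx V $ i = m - 1" if "i \<noteq> j" for i
        using l[of i] \<open>l = j\<close> that by (auto simp: n_def)
      obtain p where p: "p \<le> m - 1" "idx U = pos m c j p" "idx V = pos m (\<not> c) j p"
        using pos_opposite[of "idx U" m "idx V" j c] z o idx_up uu by blast
      have UV: "U = T m (pos m c j p)" "V = T m (pos m (\<not> c) j p)" using p idx_up uu by metis+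
      have "U \<in> up c" "V \<in> up (\<not> c)" using U(1) V(1) uu TT'_iff by (auto simp: in_cells_iff)
      then have "p = \<kappa> j" using \<kappa>_unique p(1) UV by blast
      then have "U = exit c j" using UV by (simp add: exit_def)
      moreover have "facing c j a' b'"
        unfolding facing_def using U V c n l \<open>l = j\<close> by auto
      ultimately show ?thesis using U(3) by blast
    qed
  next
    case ud
    then have "V \<notin> TT m" using TT'_iff[OF V(1)] by simp
    then show ?thesis using facing_not_mixed[OF f ud(1) _ U(3) ud(2) _ V(3)] U(2) V(2) ud by (simp
      add: col_def)
  next
    case du
    then have "U \<notin> TT m" using TT'_iff[OF U(1)] by simp
    then show ?thesis
      using facing_not_mixed[OF facing_sym[OF f] du(2) _ V(3) du(1) _ U(3)] U(2) V(2) du by (simp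
        add: col_def)
  next
    case dd
    then have "U \<notin> TT m" "V \<notin> TT m" using TT'_iff[OF U(1)] TT'_iff[OF V(1)] by auto
    then have c: "col c U = (\<not> c)" "col (\<not> c) V = c" by (auto simp: col_def)
    have e: "real (idx U $ j) + 1 - \<beta> a' $ j + (real (idx V $ j) + 1 - \<beta> b' $ j) = 0"
      using eq[of j] map_dn[OF dd(1) T1(1), of j] map_dn[OF dd(2) T1(2), of j] U V by simp
    then have "\<beta> a' $ j = 1" "\<beta> b' $ j = 1" using bd[of j] by auto
    then have "a' = P j" "b' = P j" using P_eqI T1 by auto
    then show ?thesis using corner_unique[of j "\<not> c" j c] U V c by auto
  qed
qed

text \<open>Iterating \<open>facing_step\<close> places \<open>a\<close> in arbitrarily deep exit
  cells, which shrink to their common fixed point.\<close>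

lemma facing_exit:
  assumes "facing c j a b"
  shows "a = E c j"
proof -
  obtain B where B: "\<And>x y. x \<in> T1 \<Longrightarrow> y \<in> T1 \<Longrightarrow> dist x y \<le> B"
    using compact_imp_bounded[OF compact_T1] unfolding bounded_two_points by blast
  have le: "dist a (E c j) \<le> B * (1 / real m) ^ n" if "facing c j a b" for n a b
    using that
  proof (induction n arbitrary: a b)
    case 0
    then have "a \<in> T1" using frac_T1 by (auto simp: facing_def)
    then show ?case using B E_T1 by simp
  next
    case (Suc n)
    obtain a' b' where a': "facing c j a' b'" "a = tri_map (exit c j) a'" using facing_step[OF
      Suc.prems] by blast
    have "a' \<in> T1" using a' frac_T1 by (auto simp: facing_def)
    then have "dist a (E c j) = dist a' (E c j) / real m"
      using map_dist[OF exit_cells[of c j] _ E_T1, of a' c j] a' by (simp add: E_fixed)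
    also have "\<dots> \<le> B * (1 / real m) ^ n / real m"
      using Suc.IH[OF a'(1)] by (intro divide_right_mono) auto
    finally show ?case by simp
  qed
  have "(\<lambda>n. B * (1 / real m) ^ n) \<longlonglongrightarrow> B * 0"
    using m by (intro tendsto_mult_left LIMSEQ_realpow_zero) auto
  then have "dist a (E c j) \<le> B * 0"
    by (rule LIMSEQ_le_const) (use le[OF assms] in auto)
  then show ?thesis by simp
qed

lemma neighbours_TT'_iff:
  assumes "U \<in> TT m" "V \<in> TT' m"
  shows "neighbours_TT' m j U V \<longleftrightarrow> (\<forall>i. idx U $ i = idx V $ i + (if i = j then 1 else 0))"
proof -
  have "neighbours_TT' m j U V \<longleftrightarrow> idx U $ j = idx V $ j + 1 \<and> (\<forall>i. i \<noteq> j \<longrightarrow> idx U $ i = idx V $ i)"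
    unfolding neighbours_TT'_def using idx_up[OF assms(1)] idx_dn[OF assms(2)] idx_T idx_T' by metis
  then show ?thesis by auto
qed

lemma neighbours_TT'_types: "neighbours_TT' m j U V \<Longrightarrow> U \<in> TT m \<and> V \<in> TT' m"
  by (auto simp: neighbours_TT'_def TT_def TT'_def)

lemma cells_meet_mixed:
  assumes U: "U \<in> cells c" "U \<in> TT m" "a \<in> frac c" and V: "V \<in> cells c" "V \<in> TT' m" "b \<in> frac (\<not> c)"
    and eq: "tri_map U a = tri_map V b"
  shows "\<exists>j. neighbours_TT' m j U V \<and> facing c j a b"
proof -
  have T1: "a \<in> T1" "b \<in> T1" using U V frac_T1 by auto
  define n where "n i = int (idx V $ i) + 1 - int (idx U $ i)" for i
  have n: "\<beta> a $ i + \<beta> b $ i = of_int (n i)" for i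
    using map_up[OF U(2) T1(1), of i] map_dn[OF V(2) T1(2), of i] eq by (simp add: n_def)
  from opposite_cells[OF T1 n]
  show ?thesis
  proof
    assume "\<exists>i. a = P i \<and> b = P i"
    then show ?thesis using corner_unique[of _ c _ "\<not> c"] U V by auto
  next
    assume "\<exists>j. \<forall>i. n i = (if i = j then 0 else 1)"
    then obtain j where j: "\<And>i. n i = (if i = j then 0 else 1)" by blast
    have "idx U $ i = idx V $ i + (if i = j then 1 else 0)" for i
      using j[of i] by (auto simp: n_def split: if_splits)
    then have "neighbours_TT' m j U V" using neighbours_TT'_iff[OF U(2) V(2)] by blast
    moreover have "facing c j a b" using U V n j by (auto simp: facing_def)
    ultimately show ?thesis by blast
  qed
qed

text \<open>Parallel cells can only touch in a vertex, which \<open>corner_unique\<close> excludes.\<close>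

lemma cells_meet:
  assumes U: "U \<in> cells c" "a \<in> frac (col c U)" and V: "V \<in> cells c" "b \<in> frac (col c V)"
    and ne: "U \<noteq> V" and eq: "tri_map U a = tri_map V b"
  shows "\<exists>j. neighbours m j U V \<and> a = E (col c U) j"
proof -
  have T1: "a \<in> T1" "b \<in> T1" using U V frac_T1 by auto
  consider (uu) "U \<in> TT m" "V \<in> TT m" | (ud) "U \<in> TT m" "V \<in> TT' m" "V \<notin> TT m"
    | (du) "U \<in> TT' m" "U \<notin> TT m" "V \<in> TT m" | (dd) "U \<in> TT' m" "V \<in> TT' m" "U \<notin> TT m" "V \<notin> TT m"
    using TT'_iff[OF U(1)] TT'_iff[OF V(1)] by blast
  then show ?thesis
  proof cases
    case uu
    have "idx U \<noteq> idx V" using ne idx_up uu by metis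
    moreover have "idx U $ 1 + idx U $ 2 + idx U $ 3 = idx V $ 1 + idx V $ 2 + idx V $ 3"
      using idx_up uu T_index_iff by metis
    moreover have "real (idx U $ i) + \<beta> a $ i = real (idx V $ i) + \<beta> b $ i" for i
      using map_up[OF uu(1) T1(1), of i] map_up[OF uu(2) T1(2), of i] eq by simp
    ultimately have "\<exists>i j. i \<noteq> j \<and> a = P i \<and> b = P j" using parallel_cells[OF T1] by blast
    then show ?thesis using corner_unique[of _ c _ c] U V uu by (auto simp: col_def)
  next
    case ud
    then show ?thesis
      using cells_meet_mixed[of U c a V b] U V eq facing_exit by (auto simp: col_def neighbours_def)
  next
    case du
    then have "\<exists>j. neighbours_TT' m j V U \<and> facing c j b a"
      using U V eq by (intro cells_meet_mixed) (auto simp: col_def)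
    then obtain j where "neighbours_TT' m j V U" "facing (\<not> c) j a b" using facing_sym by blast
    then show ?thesis using facing_exit du by (auto simp: col_def neighbours_def)
  next
    case dd
    have "idx V \<noteq> idx U" using ne idx_dn dd by metis
    moreover have "idx V $ 1 + idx V $ 2 + idx V $ 3 = idx U $ 1 + idx U $ 2 + idx U $ 3"
      using idx_dn dd T'_index_iff by metis
    moreover have "real (idx V $ i) + \<beta> a $ i = real (idx U $ i) + \<beta> b $ i" for i
      using map_dn[OF dd(1) T1(1), of i] map_dn[OF dd(2) T1(2), of i] eq by simp
    ultimately have "\<exists>i j. i \<noteq> j \<and> a = P i \<and> b = P j" using parallel_cells[OF T1] by blast
    then show ?thesis using corner_unique[of _ "\<not> c" _ "\<not> c"] U V dd by (auto simp: col_def)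
  qed
qed

text \<open>The change of coordinates across side \<open>j\<close> is the mirror relation
  \<open>E_mirror\<close> between the exits of the two colours.\<close>

lemma junction:
  assumes U: "U \<in> cells c" and V: "V \<in> cells c" and n: "neighbours m j U V"
  shows "tri_map U (E (col c U) j) = tri_map V (E (col c V) j)"
proof -
  have *: "tri_map U (E c j) = tri_map V (E (\<not> c) j)"
    if "U \<in> cells c" "V \<in> cells c" "neighbours_TT' m j U V" for U V c
  proof (rule barycentric_inj[OF map_T1[OF that(1) E_T1] map_T1[OF that(2) E_T1]])
    fix i
    have t: "U \<in> TT m" "V \<in> TT' m" using neighbours_TT'_types that by auto
    have "real m * \<beta> (tri_map U (E c j)) $ i = real m * \<beta> (tri_map V (E (\<not> c) j)) $ i"
      using map_up[OF t(1) E_T1, of c j i] map_dn[OF t(2) E_T1, of "\<not> c" j i] E_mirror[of c j i]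
        that(3)[unfolded neighbours_TT'_iff[OF t]] by (auto split: if_splits)
    then show "\<beta> (tri_map U (E c j)) $ i = \<beta> (tri_map V (E (\<not> c) j)) $ i" using m by simp
  qed
  show ?thesis
    using n *[OF U V] *[OF V U] neighbours_TT'_types[of j U V] neighbours_TT'_types[of j V U]
      TT'_iff[OF U] TT'_iff[OF V] by (auto simp: neighbours_def col_def)
qed

end

section \<open>Self-similarity of the levels\<close>

definition upR :: "patterns \<Rightarrow> bool \<Rightarrow> triangle set" where
  "upR R c = (if c then white R else yellow R)"

definition dnR :: "patterns \<Rightarrow> bool \<Rightarrow> triangle set" where
  "dnR R c = (if c then white' R else yellow' R)"

text \<open>One step of an iterated function system on pairs of sets, in which inverted cells swap
  the colours. Refinement of patterns becomes composition of these operators, and this relates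
  \<open>level\<close> to \<open>lev\<close>.\<close>

definition pieces :: "patterns \<Rightarrow> (bool \<Rightarrow> (real^2) set) \<Rightarrow> bool \<Rightarrow> (real^2) set" where
  "pieces R X c = (\<Union>U\<in>upR R c. tri_map U ` X c) \<union> (\<Union>U\<in>dnR R c. tri_map U ` X (\<not> c))"

lemma upR_refine: "upR (refine S R) c =
    substitute (upR R c) (upR S c) \<union> substitute (dnR R c) (dnR S (\<not> c))"
  and dnR_refine: "dnR (refine S R) c =
    substitute (upR R c) (dnR S c) \<union> substitute (dnR R c) (upR S (\<not> c))"
  by (auto simp: upR_def dnR_def refine_def)

lemma tri_map_substitute:
  assumes "\<And>V i. V \<in> B \<Longrightarrow> V $ i \<in> T1" "Y \<subseteq> T1"
  shows "(\<Union>D\<in>substitute A B. tri_map D ` Y) = (\<Union>U\<in>A. tri_map U ` (\<Union>V\<in>B. tri_map V ` Y))"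
proof -
  have "(\<Union>D\<in>substitute A B. tri_map D ` Y) = (\<Union>U\<in>A. \<Union>V\<in>B. tri_map (tri_image U V) ` Y)"
    unfolding substitute_def by blast
  also have "\<dots> = (\<Union>U\<in>A. \<Union>V\<in>B. (\<lambda>y. tri_map U (tri_map V y)) ` Y)"
    using assms by (intro SUP_cong image_cong refl) (auto intro!: tri_map_tri_image)
  finally show ?thesis by (simp add: image_UN image_image)
qed

lemma pieces_refine:
  assumes "\<And>V i c. V \<in> upR S c \<union> dnR S c \<Longrightarrow> V $ i \<in> T1" "\<And>c. X c \<subseteq> T1"
  shows "pieces (refine S R) X = pieces R (pieces S X)"
proof
  fix c
  have "pieces (refine S R) X c =
    (\<Union>D\<in>substitute (upR R c) (upR S c). tri_map D ` X c) \<union>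
    (\<Union>D\<in>substitute (dnR R c) (dnR S (\<not> c)). tri_map D ` X c) \<union>
    (\<Union>D\<in>substitute (upR R c) (dnR S c). tri_map D ` X (\<not> c)) \<union>
    (\<Union>D\<in>substitute (dnR R c) (upR S (\<not> c)). tri_map D ` X (\<not> c))"
    by (simp only: pieces_def upR_refine dnR_refine UN_Un Un_ac)
  also have "\<dots> = pieces R (pieces S X) c"
  proof -
    have up: "\<And>V i. V \<in> upR S c \<Longrightarrow> V $ i \<in> T1" and dn: "\<And>V i. V \<in> dnR S c \<Longrightarrow> V $ i \<in> T1" for c
      using assms(1) by blast+
    show ?thesis
      by (simp only: tri_map_substitute[OF up assms(2)] tri_map_substitute[OF dn assms(2)]
          pieces_def image_Un UN_Un_distrib Un_ac not_not)
  qed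
  finally show "pieces (refine S R) X c = pieces R (pieces S X) c" .
qed

section \<open>Composition of cells in terms of indices\<close>

lemma T_vertex_T1:
  assumes "m \<ge> 1" "l \<in> T_index m"
  shows "T m l $ i = bc ((1 / real m) *\<^sub>R (rv l + axis i 1))" "(1 / real m) *\<^sub>R (rv l + axis i 1) \<in> H"
proof -
  show "T m l $ i = bc ((1 / real m) *\<^sub>R (rv l + axis i 1))"
    by (simp add: T_nth bc_scaleR bc_add bc_axis)
  have "real (l $ 1) + real (l $ 2) + real (l $ 3) = real m - 1"
    using assms unfolding T_index_iff by linarith
  then show "(1 / real m) *\<^sub>R (rv l + axis i 1) \<in> H"
    using assms(1) exhaust_3[of i] by (auto simp: H_iff axis_def add_divide_distrib[symmetric])
qed

lemma T'_vertex_T1: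
  assumes "m \<ge> 2" "l \<in> T'_index m"
  shows "T' m l $ i = bc ((1 / real m) *\<^sub>R (rv l + 1 - axis i 1))" "(1 / real m) *\<^sub>R (rv l + 1 - axis i 1) \<in> H"
proof -
  show "T' m l $ i = bc ((1 / real m) *\<^sub>R (rv l + 1 - axis i 1))"
    by (simp only: T'_nth bc_scaleR bc_diff[of "rv l + 1"] bc_axis)
  have "real (l $ 1) + real (l $ 2) + real (l $ 3) = real m - 2"
    using assms unfolding T'_index_iff by linarith
  then show "(1 / real m) *\<^sub>R (rv l + 1 - axis i 1) \<in> H"
    using assms(1) exhaust_3[of i] by (auto simp: H_iff axis_def add_divide_distrib[symmetric])
qed

text \<open>Indices compose like digits in base \<open>m\<close>: an upright outer cell appends
  \<open>l\<close>, an inverted one the complement of \<open>l\<close>, which is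
  \<open>subix\<close>.\<close>

definition addix :: "nat \<Rightarrow> nat^3 \<Rightarrow> nat^3 \<Rightarrow> nat^3" where
  "addix m k l = (\<chi> i. m * k $ i + l $ i)"

definition subix :: "nat \<Rightarrow> nat^3 \<Rightarrow> nat^3 \<Rightarrow> nat^3" where
  "subix m k l = (\<chi> i. m * k $ i + (m - 1 - l $ i))"

lemma rv_addix: "rv (addix m k l) = real m *\<^sub>R rv k + rv l"
  by (simp add: vec_eq_iff addix_def)

lemma rv_subix:
  assumes "m \<ge> 1" "\<And>i. l $ i \<le> m - 1"
  shows "rv (subix m k l) = real m *\<^sub>R rv k + (real m - 1) *\<^sub>R 1 - rv l"
proof -
  have "real (m - 1 - l $ i) = real m - 1 - real (l $ i)" for i
    using assms(1) assms(2)[of i] by linarith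
  then show ?thesis by (simp add: vec_eq_iff subix_def)
qed

lemma T_index_le: "l \<in> T_index m \<Longrightarrow> l $ i \<le> m - 1"
  and T'_index_le: "l \<in> T'_index m \<Longrightarrow> l $ i \<le> m - 2"
  using exhaust_3[of i] by (auto simp: T_index_iff T'_index_iff)

lemma index_comp:
  assumes "M \<ge> 2" "m \<ge> 2"
  shows "k \<in> T_index M \<Longrightarrow> l \<in> T_index m \<Longrightarrow> addix m k l \<in> T_index (M * m)"
    "k \<in> T_index M \<Longrightarrow> l \<in> T'_index m \<Longrightarrow> addix m k l \<in> T'_index (M * m)"
    "k \<in> T'_index M \<Longrightarrow> l \<in> T_index m \<Longrightarrow> subix m k l \<in> T'_index (M * m)"
    "k \<in> T'_index M \<Longrightarrow> l \<in> T'_index m \<Longrightarrow> subix m k l \<in> T_index (M * m)"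
proof -
  \<comment> \<open>This form removes the truncated subtractions from the index sums.\<close>
  obtain M' m' where Mm: "M = M' + 2" "m = m' + 2" using assms by (metis le_Suc_ex add.commute)
  show "k \<in> T_index M \<Longrightarrow> l \<in> T_index m \<Longrightarrow> addix m k l \<in> T_index (M * m)"
  proof -
    assume "k \<in> T_index M" "l \<in> T_index m"
    then have s: "k $ 1 + k $ 2 + k $ 3 = M - 1" "l $ 1 + l $ 2 + l $ 3 = m - 1" by (auto simp: T_index_iff)
    have "addix m k l $ 1 + addix m k l $ 2 + addix m k l $ 3 =
      m * (k $ 1 + k $ 2 + k $ 3) + (l $ 1 + l $ 2 + l $ 3)" by (simp add: addix_def algebra_simps)
    also have "\<dots> = M * m - 1" unfolding s Mm by (simp add: algebra_simps)
    finally show ?thesis by (simp add: T_index_iff)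
  qed
  show "k \<in> T_index M \<Longrightarrow> l \<in> T'_index m \<Longrightarrow> addix m k l \<in> T'_index (M * m)"
  proof -
    assume "k \<in> T_index M" "l \<in> T'_index m"
    then have s: "k $ 1 + k $ 2 + k $ 3 = M - 1" "l $ 1 + l $ 2 + l $ 3 = m - 2"
      by (auto simp: T_index_iff T'_index_iff)
    have "addix m k l $ 1 + addix m k l $ 2 + addix m k l $ 3 =
      m * (k $ 1 + k $ 2 + k $ 3) + (l $ 1 + l $ 2 + l $ 3)" by (simp add: addix_def algebra_simps)
    also have "\<dots> = M * m - 2" unfolding s Mm by (simp add: algebra_simps)
    finally show ?thesis by (simp add: T'_index_iff)
  qed
  have *: "subix m k l $ 1 + subix m k l $ 2 + subix m k l $ 3 + (l $ 1 + l $ 2 + l $ 3) =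
      m * (k $ 1 + k $ 2 + k $ 3) + 3 * (m - 1)" if "\<And>i. l $ i \<le> m - 1"
    using that[of 1] that[of 2] that[of 3] by (simp add: subix_def algebra_simps)
  show "k \<in> T'_index M \<Longrightarrow> l \<in> T_index m \<Longrightarrow> subix m k l \<in> T'_index (M * m)"
  proof -
    assume kl: "k \<in> T'_index M" "l \<in> T_index m"
    then have s: "k $ 1 + k $ 2 + k $ 3 = M - 2" "l $ 1 + l $ 2 + l $ 3 = m - 1"
      by (auto simp: T_index_iff T'_index_iff)
    show ?thesis using *[OF T_index_le[OF kl(2)]] unfolding s T'_index_iff Mm by (simp add: algebra_simps)
  qed
  show "k \<in> T'_index M \<Longrightarrow> l \<in> T'_index m \<Longrightarrow> subix m k l \<in> T_index (M * m)"
  proof -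
    assume kl: "k \<in> T'_index M" "l \<in> T'_index m"
    then have s: "k $ 1 + k $ 2 + k $ 3 = M - 2" "l $ 1 + l $ 2 + l $ 3 = m - 2"
      by (auto simp: T'_index_iff)
    have "l $ i \<le> m - 1" for i using T'_index_le[OF kl(2), of i] by linarith
    from *[OF this] show ?thesis unfolding s T_index_iff Mm by (simp add: algebra_simps)
  qed
qed

lemma tri_image_TT:
  assumes "M \<ge> 2" "m \<ge> 2" "l \<in> T_index m"
  shows "tri_image (T M k) (T m l) = T (M * m) (addix m k l)"
proof -
  have "tri_image (T M k) (T m l) $ i = T (M * m) (addix m k l) $ i" for i
  proof -
    note v = T_vertex_T1[OF _ assms(3), of i]
    have "tri_image (T M k) (T m l) $ i = bc ((1 / real M) *\<^sub>R (rv k + (1 / real m) *\<^sub>R (rv l + axis i 1)))"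
      using v assms(2) by (simp add: tri_image_def tri_map_T_bc)
    also have "(1 / real M) *\<^sub>R (rv k + (1 / real m) *\<^sub>R (rv l + axis i 1)) =
      (1 / real (M * m)) *\<^sub>R (rv (addix m k l) + axis i 1)"
      using assms by (simp add: rv_addix vec_eq_iff field_simps)
    finally show ?thesis by (simp add: T_nth bc_scaleR bc_add bc_axis)
  qed
  then show ?thesis by (simp add: vec_eq_iff)
qed

lemma tri_image_TT':
  assumes "M \<ge> 2" "m \<ge> 2" "l \<in> T'_index m"
  shows "tri_image (T M k) (T' m l) = T' (M * m) (addix m k l)"
proof -
  have "tri_image (T M k) (T' m l) $ i = T' (M * m) (addix m k l) $ i" for i
  proof -
    note v = T'_vertex_T1[OF assms(2,3), of i]
    have "tri_image (T M k) (T' m l) $ i = bc ((1 / real M) *\<^sub>R (rv k + (1 / real m) *\<^sub>R (rv l + 1 -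
      axis i 1)))"
      using v by (simp add: tri_image_def tri_map_T_bc)
    also have "(1 / real M) *\<^sub>R (rv k + (1 / real m) *\<^sub>R (rv l + 1 - axis i 1)) =
      (1 / real (M * m)) *\<^sub>R (rv (addix m k l) + 1 - axis i 1)"
      using assms by (simp add: rv_addix vec_eq_iff field_simps)
    finally show ?thesis by (simp only: T'_nth bc_scaleR bc_diff[of "_ + 1"] bc_axis)
  qed
  then show ?thesis by (simp add: vec_eq_iff)
qed

lemma tri_image_T'T:
  assumes "M \<ge> 2" "m \<ge> 2" "l \<in> T_index m"
  shows "tri_image (T' M k) (T m l) = T' (M * m) (subix m k l)"
proof -
  have "tri_image (T' M k) (T m l) $ i = T' (M * m) (subix m k l) $ i" for i
  proof -
    note v = T_vertex_T1[OF _ assms(3), of i]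
    have "tri_image (T' M k) (T m l) $ i = bc ((1 / real M) *\<^sub>R (rv k + 1 - (1 / real m) *\<^sub>R (rv l +
      axis i 1)))"
      using v assms(2) by (simp add: tri_image_def tri_map_T'_bc)
    also have "(1 / real M) *\<^sub>R (rv k + 1 - (1 / real m) *\<^sub>R (rv l + axis i 1)) =
      (1 / real (M * m)) *\<^sub>R (rv (subix m k l) + 1 - axis i 1)"
      using assms by (subst rv_subix[OF _ T_index_le[OF assms(3)]]) (auto simp: vec_eq_iff field_simps)
    finally show ?thesis by (simp only: T'_nth bc_scaleR bc_diff[of "_ + 1"] bc_axis)
  qed
  then show ?thesis by (simp add: vec_eq_iff)
qed

lemma tri_image_T'T':
  assumes "M \<ge> 2" "m \<ge> 2" "l \<in> T'_index m"
  shows "tri_image (T' M k) (T' m l) = T (M * m) (subix m k l)"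
proof -
  have "l $ i \<le> m - 1" for i using T'_index_le[OF assms(3), of i] by linarith
  note rv = rv_subix[OF _ this, of k]
  have "tri_image (T' M k) (T' m l) $ i = T (M * m) (subix m k l) $ i" for i
  proof -
    note v = T'_vertex_T1[OF assms(2,3), of i]
    have "tri_image (T' M k) (T' m l) $ i = bc ((1 / real M) *\<^sub>R (rv k + 1 - (1 / real m) *\<^sub>R (rv l +
      1 - axis i 1)))"
      using v by (simp add: tri_image_def tri_map_T'_bc)
    also have "(1 / real M) *\<^sub>R (rv k + 1 - (1 / real m) *\<^sub>R (rv l + 1 - axis i 1)) =
      (1 / real (M * m)) *\<^sub>R (rv (subix m k l) + axis i 1)"
      using assms by (subst rv) (auto simp: vec_eq_iff field_simps)
    finally show ?thesis by (simp add: T_nth bc_scaleR bc_add bc_axis)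
  qed
  then show ?thesis by (simp add: vec_eq_iff)
qed

lemma substitute_TT:
  assumes "M \<ge> 2" "m \<ge> 2"
  shows "A \<subseteq> TT M \<Longrightarrow> B \<subseteq> TT m \<Longrightarrow> substitute A B \<subseteq> TT (M * m)"
    "A \<subseteq> TT M \<Longrightarrow> B \<subseteq> TT' m \<Longrightarrow> substitute A B \<subseteq> TT' (M * m)"
    "A \<subseteq> TT' M \<Longrightarrow> B \<subseteq> TT m \<Longrightarrow> substitute A B \<subseteq> TT' (M * m)"
    "A \<subseteq> TT' M \<Longrightarrow> B \<subseteq> TT' m \<Longrightarrow> substitute A B \<subseteq> TT (M * m)"
proof -
  show "substitute A B \<subseteq> TT (M * m)" if AB: "A \<subseteq> TT M" "B \<subseteq> TT m"
  proof
    fix D assume "D \<in> substitute A B"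
    then obtain k l where "k \<in> T_index M" "l \<in> T_index m" "D = tri_image (T M k) (T m l)"
      using AB unfolding substitute_def TT_def  by blast
    then show "D \<in> TT (M * m)"
      using index_comp(1)[OF assms] tri_image_TT[OF assms] by (auto simp: TT_def)
  qed
  show "substitute A B \<subseteq> TT' (M * m)" if AB: "A \<subseteq> TT M" "B \<subseteq> TT' m"
  proof
    fix D assume "D \<in> substitute A B"
    then obtain k l where "k \<in> T_index M" "l \<in> T'_index m" "D = tri_image (T M k) (T' m l)"
      using AB unfolding substitute_def TT_def TT'_def by blast
    then show "D \<in> TT' (M * m)"
      using index_comp(2)[OF assms] tri_image_TT'[OF assms] by (auto simp: TT'_def)
  qed
  show "substitute A B \<subseteq> TT' (M * m)" if AB: "A \<subseteq> TT' M" "B \<subseteq> TT m"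
  proof
    fix D assume "D \<in> substitute A B"
    then obtain k l where "k \<in> T'_index M" "l \<in> T_index m" "D = tri_image (T' M k) (T m l)"
      using AB unfolding substitute_def TT'_def TT_def by blast
    then show "D \<in> TT' (M * m)"
      using index_comp(3)[OF assms] tri_image_T'T[OF assms] by (auto simp: TT'_def)
  qed
  show "substitute A B \<subseteq> TT (M * m)" if AB: "A \<subseteq> TT' M" "B \<subseteq> TT' m"
  proof
    fix D assume "D \<in> substitute A B"
    then obtain k l where "k \<in> T'_index M" "l \<in> T'_index m" "D = tri_image (T' M k) (T' m l)"
      using AB unfolding substitute_def TT'_def  by blast
    then show "D \<in> TT (M * m)"
      using index_comp(4)[OF assms] tri_image_T'T'[OF assms] by (auto simp: TT_def)
  qed
qed

lemma addix_vector:
  "addix m (vector [a, b, c]) (vector [a', b', c']) = vector [m * a + a', m * b + b', m * c + c']"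
  by (simp add: addix_def vec_eq_iff forall_3)

text \<open>Reading the side from its other end complements both digits, so the same rule holds for
  both colours.\<close>

lemma pos_comp:
  assumes "M \<ge> 2" "m \<ge> 2" "a \<le> M - 1" "b \<le> m - 1"
  shows "m * a + b \<le> M * m - 1" "pos (M * m) c i (m * a + b) = addix m (pos M c i a) (pos m c i b)"
proof -
  obtain a' b' where ab: "M - 1 = a + a'" "m - 1 = b + b'"
    using assms(3,4) unfolding le_iff_add by auto
  then have Mm: "M = a + a' + 1" "m = b + b' + 1" using assms(1,2) by linarith+
  show "m * a + b \<le> M * m - 1" unfolding Mm by (simp add: algebra_simps)
  have e: "M * m - 1 - (m * a + b) = m * a' + b'" unfolding Mm by (simp add: algebra_simps)
  have e': "M - 1 - a = a'" "m - 1 - b = b'" unfolding ab by auto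
  show "pos (M * m) c i (m * a + b) = addix m (pos M c i a) (pos m c i b)"
    unfolding pos_def e e'
    by (cases c; cases "i = 1"; cases "i = 2")
      (simp_all only: if_True if_False simp_thms addix_vector mult_0_right add_0_left)
qed

context labyrinth
begin

lemma up_upR: "up c = upR S c" and dn_dnR: "dn c = dnR S c"
  by (auto simp: up_def upR_def dn_def dnR_def)

lemma vertex_T1:
  assumes "V \<in> upR S c \<union> dnR S c"
  shows "V $ i \<in> T1"
proof -
  consider l where "l \<in> T_index m" "V = T m l" | l where "l \<in> T'_index m" "V = T' m l"
    using assms up_sub[of c] dn_sub[of c] unfolding up_upR dn_dnR TT_def TT'_def by blast
  then show ?thesis
    using T_vertex_T1[of m _ i] T'_vertex_T1[of m _ i] m by cases (auto simp: T1_def)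
qed

lemma pieces_S: "pieces S X c = (\<Union>U\<in>cells c. tri_map U ` X (col c U))"
proof -
  have "U \<in> dn c \<Longrightarrow> U \<notin> TT m" "U \<in> up c \<Longrightarrow> U \<in> TT m" for U
    using up_sub dn_sub TT_disjoint[of m] m by fastforce+
  then show ?thesis unfolding pieces_def cells_def up_upR dn_dnR col_def by force
qed

lemma level_Suc: "level S (Suc (Suc n)) = refine S (level S (Suc n))"
  by (simp add: level_def)

lemma pieces_level: "(\<And>c. X c \<subseteq> T1) \<Longrightarrow> pieces (level S (Suc n)) X = (pieces S ^^ Suc n) X"
proof (induction n arbitrary: X)
  case 0
  then show ?case by (simp add: level_def)
next
  case (Suc n)
  have X: "pieces S X c \<subseteq> T1" for c unfolding pieces_S using map_T1 Suc.prems by blast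
  have "pieces (level S (Suc (Suc n))) X = pieces (level S (Suc n)) (pieces S X)"
    unfolding level_Suc by (rule pieces_refine[OF vertex_T1 Suc.prems])
  also have "\<dots> = (pieces S ^^ Suc n) (pieces S X)" by (rule Suc.IH[OF X])
  finally show ?case by (simp add: funpow_swap1)
qed

lemma lev_pieces: "lev n = (pieces S ^^ n) (\<lambda>_. T1)"
  by (induction n) (auto simp: pieces_S fun_eq_iff)

lemma frac_eq: "(\<Inter>n\<in>{1..}. pieces (level S n) (\<lambda>_. T1) c) = frac c"
proof -
  have "pieces (level S n) (\<lambda>_. T1) c = lev n c" if "n \<ge> 1" for n
    using pieces_level[of "\<lambda>_. T1" "n - 1"] that by (simp add: lev_pieces del: funpow.simps)
  then have "(\<Inter>n\<in>{1..}. pieces (level S n) (\<lambda>_. T1) c) = (\<Inter>n\<in>{1..}. lev n c)" by auto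
  also have "\<dots> = (\<Inter>n. lev n c)"
  proof
    show "(\<Inter>n\<in>{1..}. lev n c) \<subseteq> (\<Inter>n. lev n c)"
    proof (intro INT_greatest)
      fix n
      have "(\<Inter>n\<in>{1..}. lev n c) \<subseteq> lev (Suc n) c" by (rule INT_lower) simp
      then show "(\<Inter>n\<in>{1..}. lev n c) \<subseteq> lev n c" using lev_Suc_sub by blast
    qed
  qed blast
  finally show ?thesis by (simp add: frac_def)
qed

lemma white_fractal_eq: "white_fractal S = frac True"
  and yellow_fractal_eq: "yellow_fractal S = frac False"
  unfolding frac_eq[symmetric]
  by (auto simp: white_fractal_def yellow_fractal_def pieces_def region_eq upR_def dnR_def)

section \<open>Exits of the higher levels\<close>

primrec \<kappa>n :: "3 \<Rightarrow> nat \<Rightarrow> nat" where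
  "\<kappa>n i 0 = \<kappa> i"
| "\<kappa>n i (Suc n) = m * \<kappa>n i n + \<kappa> i"

text \<open>The index is shifted: \<open>exitn n\<close> is the exit of level \<open>Suc n\<close>,
  since levels start at \<open>1\<close>. All \<open>n + 1\<close> digits of its position in base
  \<open>m\<close> equal \<open>\<kappa> i\<close>.\<close>

definition exitn :: "nat \<Rightarrow> bool \<Rightarrow> 3 \<Rightarrow> triangle" where
  "exitn n c i = T (m ^ Suc n) (pos (m ^ Suc n) c i (\<kappa>n i n))"

lemma mpow: "m ^ Suc n \<ge> 2"
proof -
  have "2 * 1 \<le> m * m ^ n" using m by (intro mult_le_mono) auto
  then show ?thesis by simp
qed

lemma level_sub: "upR (level S (Suc n)) c \<subseteq> TT (m ^ Suc n)" "dnR (level S (Suc n)) c \<subseteq> TT' (m ^ Suc n)"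
proof -
  have "\<forall>c. upR (level S (Suc n)) c \<subseteq> TT (m ^ Suc n) \<and> dnR (level S (Suc n)) c \<subseteq> TT' (m ^ Suc n)"
  proof (induction n)
    case 0
    then show ?case using up_sub dn_sub by (simp add: level_def up_upR dn_dnR)
  next
    case (Suc n)
    have "m ^ Suc (Suc n) = m ^ Suc n * m" by simp
    then show ?case
      unfolding level_Suc upR_refine dnR_refine
      using Suc up_sub dn_sub substitute_TT[OF mpow m] unfolding up_upR dn_dnR by (metis Un_least)
  qed
  then show "upR (level S (Suc n)) c \<subseteq> TT (m ^ Suc n)" "dnR (level S (Suc n)) c \<subseteq> TT' (m ^ Suc n)" by auto
qed

lemma \<kappa>n_le: "\<kappa>n i n \<le> m ^ Suc n - 1"
proof (induction n)
  case 0
  then show ?case using \<kappa>(1) by simp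
next
  case (Suc n)
  then show ?case using pos_comp(1)[OF mpow m Suc \<kappa>(1)] by (simp add: mult.commute)
qed

lemma exitn_Suc: "exitn (Suc n) c i = tri_image (exitn n c i) (exit c i)"
proof -
  have "tri_image (exitn n c i) (exit c i) = T (m ^ Suc n * m) (addix m (pos (m ^ Suc n) c i (\<kappa>n i
    n)) (pos m c i (\<kappa> i)))"
    unfolding exitn_def exit_def by (rule tri_image_TT[OF mpow m pos_nth(2)[OF \<kappa>(1)]])
  also have "addix m (pos (m ^ Suc n) c i (\<kappa>n i n)) (pos m c i (\<kappa> i)) = pos (m ^ Suc n * m) c i (m *
    \<kappa>n i n + \<kappa> i)"
    by (rule pos_comp(2)[OF mpow m \<kappa>n_le \<kappa>(1), symmetric])
  finally show ?thesis by (simp add: exitn_def mult.commute)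
qed

lemma exitn_in: "exitn n c i \<in> upR (level S (Suc n)) c"
proof (induction n)
  case 0
  then show ?case using \<kappa>(2)[of c i] by (simp add: level_def exitn_def exit_def up_upR)
next
  case (Suc n)
  then show ?case
    unfolding level_Suc upR_refine exitn_Suc substitute_def using \<kappa>(2)[of c i] up_upR by blast
qed

text \<open>An upright triangle on side \<open>i\<close> cannot lie inside an inverted triangle of the previous level.\<close>

lemma side_decompose:
  assumes "n' \<le> m ^ Suc (Suc n) - 1"
    "T (m ^ Suc (Suc n)) (pos (m ^ Suc (Suc n)) c i n') \<in> upR (level S (Suc (Suc n))) c"
  shows "\<exists>a b. a \<le> m ^ Suc n - 1 \<and> b \<le> m - 1 \<and> n' = m * a + b \<and>
    T (m ^ Suc n) (pos (m ^ Suc n) c i a) \<in> upR (level S (Suc n)) c \<and> T m (pos m c i b) \<in> upR S c"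
proof -
  define M where "M = m ^ Suc n"
  have MM: "m ^ Suc (Suc n) = M * m" by (simp add: M_def)
  have M: "M \<ge> 2" unfolding M_def by (rule mpow)
  let ?L = "pos (M * m) c i n'"
  note le = assms(1)[unfolded MM]
  have L: "?L \<in> T_index (M * m)" "?L $ i = 0" using pos_nth(1,2)[OF le] by auto
  from assms(2) consider U V where "T (M * m) ?L = tri_image U V" "U \<in> upR (level S (Suc n)) c" "V \<in> upR S c"
    | U V where "T (M * m) ?L = tri_image U V" "U \<in> dnR (level S (Suc n)) c" "V \<in> dnR S (\<not> c)"
    unfolding level_Suc upR_refine substitute_def MM by blast
  then show ?thesis
  proof cases
    case (1 U V)
    obtain k where k: "k \<in> T_index M" "U = T M k" using 1(2) level_sub[of n] unfolding TT_def M_def by blast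
    obtain l where l: "l \<in> T_index m" "V = T m l" using 1(3) up_sub unfolding TT_def up_upR by blast
    have "T (M * m) ?L = T (M * m) (addix m k l)" using 1(1) k l tri_image_TT[OF M m] by simp
    then have eq: "?L = addix m k l"
      using T_inj[OF _ L(1) index_comp(1)[OF M m k(1) l(1)]] m M by simp
    have "addix m k l $ i = 0" using L(2) unfolding eq .
    then have "k $ i = 0" "l $ i = 0" using m by (auto simp: addix_def)
    then obtain a b where ab: "a \<le> M - 1" "k = pos M c i a" "b \<le> m - 1" "l = pos m c i b"
      using pos_surj[OF k(1)] pos_surj[OF l(1)] by blast
    have "?L = pos (M * m) c i (m * a + b)" using eq ab pos_comp(2)[OF M m ab(1,3)] by simp
    then have "n' = m * a + b"
      using pos_inj[OF le pos_comp(1)[OF M m ab(1,3)]] by simp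
    then show ?thesis using 1(2,3) k l ab unfolding M_def by blast
  next
    case (2 U V)
    obtain k where k: "k \<in> T'_index M" "U = T' M k" using 2(2) level_sub[of n] unfolding TT'_def
      M_def by blast
    obtain l where l: "l \<in> T'_index m" "V = T' m l" using 2(3) dn_sub unfolding TT'_def dn_dnR by blast
    have "T (M * m) ?L = T (M * m) (subix m k l)" using 2(1) k l tri_image_T'T'[OF M m] by simp
    then have eq: "?L = subix m k l"
      using T_inj[OF _ L(1) index_comp(4)[OF M m k(1) l(1)]] m M by simp
    have "subix m k l $ i = 0" using L(2) unfolding eq .
    then show ?thesis using T'_index_le[OF l(1), of i] m by (auto simp: subix_def)
  qed
qed

text \<open>The two colours share the number \<open>n'\<close>, hence also its digits in base
  \<open>m\<close>; the last digit is settled by the exits property of the first level, the others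
  by induction.\<close>

lemma \<kappa>n_unique:
  assumes "n' \<le> m ^ Suc n - 1"
    "T (m ^ Suc n) (pos (m ^ Suc n) True i n') \<in> upR (level S (Suc n)) True"
    "T (m ^ Suc n) (pos (m ^ Suc n) False i n') \<in> upR (level S (Suc n)) False"
  shows "n' = \<kappa>n i n"
  using assms
proof (induction n arbitrary: n')
  case 0
  then show ?case using \<kappa>_unique[of n' True i] by (simp add: level_def up_upR)
next
  case (Suc n)
  obtain a b where ab: "a \<le> m ^ Suc n - 1" "b \<le> m - 1" "n' = m * a + b"
    "T (m ^ Suc n) (pos (m ^ Suc n) True i a) \<in> upR (level S (Suc n)) True"
      "T m (pos m True i b) \<in> upR S True"
    using side_decompose[OF Suc.prems(1,2)] by blast
  obtain a' b' where ab': "a' \<le> m ^ Suc n - 1" "b' \<le> m - 1" "n' = m * a' + b'"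
    "T (m ^ Suc n) (pos (m ^ Suc n) False i a') \<in> upR (level S (Suc n)) False"
      "T m (pos m False i b') \<in> upR S False"
    using side_decompose[OF Suc.prems(1,3)] by blast
  have "b < m" "b' < m" using ab ab' m by auto
  then have "(m * a + b) mod m = b" "(m * a' + b') mod m = b'" "(m * a + b) div m = a"
    "(m * a' + b') div m = a'"
    by simp_all
  then have "a' = a" "b' = b" using ab(3) ab'(3) by metis+
  moreover from this have "b = \<kappa> i" using \<kappa>_unique[of b True i] ab ab' by (simp add: up_upR)
  moreover have "a = \<kappa>n i n" using Suc.IH[OF ab(1,4)] ab' \<open>a' = a\<close> by simp
  ultimately show ?case using ab(3) by simp
qed

lemma exit_triple_level:
  "exit_triple (m ^ Suc n) (level S (Suc n)) k \<longleftrightarrow> k = (\<chi> i. \<kappa>n i n)"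
proof
  assume k: "exit_triple (m ^ Suc n) (level S (Suc n)) k"
  have "k $ i = \<kappa>n i n" for i
    using k unfolding exit_triple_iff by (intro \<kappa>n_unique) (auto simp: upR_def)
  then show "k = (\<chi> i. \<kappa>n i n)" by (simp add: vec_eq_iff)
next
  assume "k = (\<chi> i. \<kappa>n i n)"
  then show "exit_triple (m ^ Suc n) (level S (Suc n)) k"
    unfolding exit_triple_iff using \<kappa>n_le exitn_in[of n True] exitn_in[of n False]
    by (simp add: exitn_def upR_def)
qed

lemma exit_level: "white_exit (m ^ Suc n) (level S (Suc n)) i = exitn n True i"
  "yellow_exit (m ^ Suc n) (level S (Suc n)) i = exitn n False i"
proof -
  have t: "(THE k. exit_triple (m ^ Suc n) (level S (Suc n)) k) = (\<chi> i. \<kappa>n i n)"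
    unfolding exit_triple_level by simp
  show "white_exit (m ^ Suc n) (level S (Suc n)) i = exitn n True i"
    unfolding white_exit_def t white_exit_at_pos by (simp add: exitn_def)
  have "yellow_exit_at (m ^ Suc n) (\<chi> i. \<kappa>n i n) i = T (m ^ Suc n) (pos (m ^ Suc n) False i ((\<chi> i.
    \<kappa>n i n) $ i))"
    by (rule yellow_exit_at_pos) (simp only: vec_lambda_beta \<kappa>n_le)
  then show "yellow_exit (m ^ Suc n) (level S (Suc n)) i = exitn n False i"
    unfolding yellow_exit_def t by (simp add: exitn_def)
qed

lemma map_exitn: "x \<in> T1 \<Longrightarrow> tri_map (exitn n c i) x = (tri_map (exit c i) ^^ Suc n) x"
proof (induction n arbitrary: x)
  case 0
  then show ?case by (simp add: exitn_def exit_def)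
next
  case (Suc n)
  have "exit c i \<in> upR S c \<union> dnR S c" using \<kappa>(2)[of c i] by (simp add: up_upR)
  then have "tri_map (exitn (Suc n) c i) x = tri_map (exitn n c i) (tri_map (exit c i) x)"
    unfolding exitn_Suc by (intro tri_map_tri_image vertex_T1 Suc.prems)
  also have "\<dots> = (tri_map (exit c i) ^^ Suc n) (tri_map (exit c i) x)"
    by (rule Suc.IH[OF map_T1[OF exit_cells Suc.prems]])
  finally show ?case by (simp add: funpow_swap1)
qed

lemma Inter_exitn: "(\<Inter>n. region (exitn n c i)) = {E c i}"
proof
  obtain B where B: "\<And>x y. x \<in> T1 \<Longrightarrow> y \<in> T1 \<Longrightarrow> dist x y \<le> B"
    using compact_imp_bounded[OF compact_T1] unfolding bounded_two_points by blast
  have it: "(tri_map (exit c i) ^^ n) x \<in> T1" "dist ((tri_map (exit c i) ^^ n) x) (E c i) \<le> B * (1 /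
    real m) ^ n"
    if "x \<in> T1" for x n
  proof (induction n)
    case (Suc n)
    show "(tri_map (exit c i) ^^ Suc n) x \<in> T1" using map_T1[OF exit_cells[of c i] Suc(1)] by simp
    have "dist ((tri_map (exit c i) ^^ Suc n) x) (E c i) = dist ((tri_map (exit c i) ^^ n) x) (E c
      i) / real m"
      using map_dist[OF exit_cells[of c i] Suc(1) E_T1[of c i]] by (simp add: E_fixed)
    also have "\<dots> \<le> B * (1 / real m) ^ n / real m" using Suc(2) by (intro divide_right_mono) auto
    finally show "dist ((tri_map (exit c i) ^^ Suc n) x) (E c i) \<le> B * (1 / real m) ^ Suc n" by simp
  qed (use that B E_T1 in auto)
  show "(\<Inter>n. region (exitn n c i)) \<subseteq> {E c i}"
  proof
    fix x assume x: "x \<in> (\<Inter>n. region (exitn n c i))"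
    have "dist x (E c i) \<le> B * (1 / real m) ^ Suc n" for n
    proof -
      obtain y where "y \<in> T1" "x = tri_map (exitn n c i) y" using x by (auto simp: region_eq)
      then show ?thesis using it(2)[of y "Suc n"] map_exitn by simp
    qed
    moreover have "(\<lambda>n. B * (1 / real m) ^ Suc n) \<longlonglongrightarrow> B * 0"
      using m by (intro tendsto_mult_left LIMSEQ_Suc LIMSEQ_realpow_zero) auto
    ultimately have "dist x (E c i) \<le> B * 0" by (intro LIMSEQ_le_const) auto
    then show "x \<in> {E c i}" by simp
  qed
  have "(tri_map (exit c i) ^^ n) (E c i) = E c i" for n by (induction n) (auto simp: E_fixed)
  then have "tri_map (exitn n c i) (E c i) = E c i" for n
    using map_exitn[OF E_T1, of n c i c i] by (simp only:)
  then have "E c i \<in> region (exitn n c i)" for n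
    using E_T1 unfolding region_eq by (metis image_eqI)
  then show "{E c i} \<subseteq> (\<Inter>n. region (exitn n c i))" by blast
qed

lemma exit_point_eq: "white_exit_point m S i = E True i" "yellow_exit_point m S i = E False i"
proof -
  have r: "{1..} = range Suc" by (auto simp: image_iff dest: Suc_le_D)
  have 1: "(\<Inter>n\<in>{1..}. region (white_exit (m ^ n) (level S n) i)) = {E True i}"
    and 2: "(\<Inter>n\<in>{1..}. region (yellow_exit (m ^ n) (level S n) i)) = {E False i}"
    unfolding r image_image exit_level by (rule Inter_exitn)+
  show "white_exit_point m S i = E True i" "yellow_exit_point m S i = E False i"
    unfolding white_exit_point_def yellow_exit_point_def 1 2 by simp_all
qed

end

section \<open>Labels along the paths\<close>

text \<open>The type \<open>{a, b}\<close> of a triangle on a path is recorded by its third index.\<close>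

definition third :: "3 \<Rightarrow> 3 \<Rightarrow> 3" where
  "third a b = (if a \<noteq> 1 \<and> b \<noteq> 1 then 1 else if a \<noteq> 2 \<and> b \<noteq> 2 then 2 else 3)"

lemma third_iff: "a \<noteq> b \<Longrightarrow> third a b = l \<longleftrightarrow> l \<noteq> a \<and> l \<noteq> b"
  using exhaust_3[of a] exhaust_3[of b] exhaust_3[of l] by (elim disjE) (simp_all add: third_def)

lemma third_ne: "a \<noteq> b \<Longrightarrow> third a b \<noteq> a" "a \<noteq> b \<Longrightarrow> third a b \<noteq> b"
  using third_iff by blast+

lemma third_sym: "third a b = third b a"
  by (auto simp: third_def)

lemma third_eq_iff: "x \<noteq> y \<Longrightarrow> a \<noteq> b \<Longrightarrow> third x y = third a b \<longleftrightarrow> {x, y} = {a, b}"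
  using exhaust_3[of a] exhaust_3[of b] exhaust_3[of x] exhaust_3[of y]
  by (elim disjE) (simp_all add: third_def doubleton_eq_iff)

lemma sum_bool_card: fixes r :: nat shows "(\<Sum>h<r. if R h then 1 else 0 :: int) = int (card {h. h < r \<and> R h})"
proof -
  have "{h \<in> {..<r}. R h} = {h. h < r \<and> R h}" by auto
  then show ?thesis using sum.inter_filter[of "{..<r}" "\<lambda>_. 1 :: int" R] by simp
qed

lemma alternating_telescope: "(\<Sum>h<r. (-1)^h * (x h + x (Suc h))) = x 0 - (-1)^r * (x r :: int)"
  by (induction r) (auto simp: algebra_simps)

lemma alternating_one: "(\<Sum>h<r. (-1)^h) = (if odd r then 1 else 0 :: int)"
  by (induction r) auto

locale label_seq =
  fixes L :: "nat \<Rightarrow> 3" and r :: nat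
  assumes odd_r: "odd r" and step: "\<And>h. h < r \<Longrightarrow> L h \<noteq> L (Suc h)" and ends: "L 0 \<noteq> L r"
begin

definition types :: "bool \<Rightarrow> 3 \<Rightarrow> nat" where
  "types e l = card {h. h < r \<and> even h = e \<and> third (L h) (L (Suc h)) = l}"

definition occ :: "bool \<Rightarrow> 3 \<Rightarrow> nat" where
  "occ e a = card {g. g < Suc r \<and> even g = e \<and> L g = a}"

text \<open>Every inner label belongs to one upright and one inverted triangle, so an alternating sum
  over the path only sees the two ends.\<close>

lemma types_diff: "int (types True l) - int (types False l) = (if l = third (L 0) (L r) then 1 else 0)"
proof -
  let ?x = "\<lambda>h. if L h = l then 1 else 0 :: int"
  have "(if third (L h) (L (Suc h)) = l then 1 else 0) = 1 - (?x h + ?x (Suc h))" if "h < r" for h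
    using third_iff[OF step[OF that], of l] step[OF that] by auto
  then have "(\<Sum>h<r. (-1)^h * (if third (L h) (L (Suc h)) = l then 1 else 0 :: int)) = (\<Sum>h<r. (-1)^h
    * (1 - (?x h + ?x (Suc h))))"
    by (intro sum.cong) auto
  also have "\<dots> = (\<Sum>h<r. (-1)^h) - (\<Sum>h<r. (-1)^h * (?x h + ?x (Suc h)))"
    by (simp add: right_diff_distrib sum_subtractf)
  also have "\<dots> = 1 - ?x 0 - ?x r"
    unfolding alternating_telescope[of ?x] alternating_one using odd_r by simp
  also have "\<dots> = (if l = third (L 0) (L r) then 1 else 0)" using third_iff[OF ends, of l] ends by auto
  also have "(\<Sum>h<r. (-1)^h * (if third (L h) (L (Suc h)) = l then 1 else 0 :: int)) =
    (\<Sum>h<r. (if even h = True \<and> third (L h) (L (Suc h)) = l then 1 else 0) -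
      (if even h = False \<and> third (L h) (L (Suc h)) = l then 1 else 0))"
    by (intro sum.cong) auto
  also have "\<dots> = int (types True l) - int (types False l)"
    unfolding sum_subtractf sum_bool_card types_def ..
  finally show ?thesis .
qed

lemma card_even: "card {h. h < r \<and> even h} = (r + 1) div 2"
proof -
  have "bij_betw (\<lambda>s. 2 * s) {..<(r + 1) div 2} {h. h < r \<and> even h}"
    by (rule bij_betwI[where g = "\<lambda>h. h div 2"]) (use odd_r in \<open>auto elim!: evenE oddE\<close>)
  then show ?thesis using bij_betw_same_card by fastforce
qed

lemma sum_types: "(\<Sum>l\<in>UNIV. types True l) = (r + 1) div 2"
proof -
  have "(\<Sum>l\<in>UNIV. types True l) = card (\<Union>l\<in>UNIV. {h. h < r \<and> even h = True \<and> third (L h) (L (Suc h)) = l})"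
    unfolding types_def by (intro card_UN_disjoint[symmetric]) auto
  also have "(\<Union>l\<in>UNIV. {h. h < r \<and> even h = True \<and> third (L h) (L (Suc h)) = l}) = {h. h < r \<and> even h}"
    by auto
  finally show ?thesis by (simp add: card_even)
qed

text \<open>As \<open>r\<close> is odd, the \<open>r + 1\<close> label positions split evenly into
  even and odd ones.\<close>

lemma occ_sum_le: "a \<noteq> b \<Longrightarrow> occ e a + occ e b \<le> (r + 1) div 2"
proof -
  assume ab: "a \<noteq> b"
  have "occ e a + occ e b = card ({g. g < Suc r \<and> even g = e \<and> L g = a} \<union> {g. g < Suc r \<and> even g = e
    \<and> L g = b})"
    unfolding occ_def using ab by (intro card_Un_disjoint[symmetric]) auto
  also have "\<dots> \<le> card {g. g < Suc r \<and> even g = e}" by (intro card_mono) auto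
  also have "\<dots> = (r + 1) div 2"
  proof (cases e)
    case True
    have "{g. g < Suc r \<and> even g = True} = {h. h < r \<and> even h}" using odd_r by (auto simp: less_Suc_eq)
    then show ?thesis using True card_even by simp
  next
    case False
    have "{g. g < Suc r \<and> even g = False} = Suc ` {h. h < r \<and> even h}"
    proof (intro equalityI subsetI)
      fix g assume "g \<in> {g. g < Suc r \<and> even g = False}"
      then show "g \<in> Suc ` {h. h < r \<and> even h}" by (cases g) auto
    qed auto
    then show ?thesis using False card_even by (simp add: card_image)
  qed
  finally show ?thesis .
qed

lemma occ_diff: "int (occ True a) - int (occ False a) = (\<Sum>g<Suc r. (-1)^g * (if L g = a then 1 else 0))"
proof -
  have "(\<Sum>g<Suc r. (-1)^g * (if L g = a then 1 else 0)) =
    (\<Sum>g<Suc r. (if even g = True \<and> L g = a then 1 else 0) - (if even g = False \<and> L g = a then 1 else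
      0 :: int))"
    by (intro sum.cong) auto
  also have "\<dots> = int (occ True a) - int (occ False a)"
    unfolding sum_subtractf sum_bool_card occ_def ..
  finally show ?thesis by simp
qed

lemma occ_0_iff: "occ e a = 0 \<longleftrightarrow> (\<forall>g\<le>r. even g = e \<longrightarrow> L g \<noteq> a)"
  by (auto simp: occ_def card_eq_0_iff less_Suc_eq_le)

text \<open>A triangle whose type does not have \<open>l\<close> as third index carries the label
  \<open>l\<close> exactly once, so \<open>l\<close> appears at every second position.
  \<open>types_diff\<close> extends the first assumption to the inverted triangles.\<close>

lemma types_0_parity:
  assumes "types True l = 0" "l \<noteq> third (L 0) (L r)" "g \<le> r"
  shows "L g = l \<longleftrightarrow> (even g \<longleftrightarrow> L 0 = l)"
proof -
  have "types False l = 0" using types_diff[of l] assms by simp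
  then have *: "third (L h) (L (Suc h)) \<noteq> l" if "h < r" for h
    using assms(1) that by (auto simp: types_def card_eq_0_iff)
  show ?thesis
    using assms(3)
  proof (induction g)
    case (Suc g)
    then have g: "g < r" by simp
    have "L g = l \<longleftrightarrow> L (Suc g) \<noteq> l" using *[OF g] third_iff[OF step[OF g], of l] step[OF g] by auto
    then show ?case using Suc by auto
  qed simp
qed

end

context labyrinth
begin

section \<open>The paths of the patterns and their labels\<close>

lemma adjacent_iff: "adjacent m U V \<longleftrightarrow> (\<exists>j. neighbours m j U V)"
  by (simp add: adjacent_def)

lemma neighbours_sym: "neighbours m j U V \<longleftrightarrow> neighbours m j V U"
  by (auto simp: neighbours_def)

lemma neighbours_cases:
  assumes "neighbours m j U V"
  shows "U \<in> TT m \<and> V \<in> TT' m \<and> V \<notin> TT m \<and> (\<forall>i. idx U $ i = idx V $ i + (if i = j then 1 else 0)) \<or>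
    U \<in> TT' m \<and> V \<in> TT m \<and> U \<notin> TT m \<and> (\<forall>i. idx V $ i = idx U $ i + (if i = j then 1 else 0))"
proof -
  have *: "U \<in> TT m \<and> V \<in> TT' m \<and> V \<notin> TT m \<and> (\<forall>i. idx U $ i = idx V $ i + (if i = j then 1 else 0))"
    if "neighbours_TT' m j U V" for U V
  proof -
    have t: "U \<in> TT m" "V \<in> TT' m" using neighbours_TT'_types[OF that] by auto
    then have "V \<notin> TT m" using TT_disjoint[of m] m by auto
    then show ?thesis using t neighbours_TT'_iff[OF t] that by blast
  qed
  show ?thesis using assms *[of U V] *[of V U] unfolding neighbours_def by blast
qed

lemma neighbours_label: "neighbours m j U V \<Longrightarrow> neighbours m l U V \<Longrightarrow> j = l"
proof (rule ccontr)
  assume a: "neighbours m j U V" "neighbours m l U V" "j \<noteq> l"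
  show False
    using neighbours_cases[OF a(1)] neighbours_cases[OF a(2)] a(3)
    by (elim disjE conjE) (auto dest!: spec[of _ j])
qed

lemma neighbours_unique:
  assumes "neighbours m j U V" "neighbours m j U V'"
  shows "V = V'"
proof -
  have "V \<in> TT m \<longleftrightarrow> V' \<in> TT m" "V \<in> TT m \<or> V \<in> TT' m" "V' \<in> TT m \<or> V' \<in> TT' m"
    using neighbours_cases[OF assms(1)] neighbours_cases[OF assms(2)] by blast+
  moreover have "idx V = idx V'"
    unfolding vec_eq_iff
    using neighbours_cases[OF assms(1)] neighbours_cases[OF assms(2)] by (metis add_right_cancel)
  ultimately show ?thesis using idx_up idx_dn by metis
qed

lemma edge_label: "neighbours m j U V \<Longrightarrow> edge_label m U V = j"
  unfolding edge_label_def using neighbours_label by blast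

sublocale tree: tree_graph "cells c" "adjacent m" for c
proof
  show "graph_tree (cells c) (adjacent m)"
    using lps by (cases c) (auto simp: labyrinth_patterns_system_def cells_all)
  show "\<And>x y. adjacent m x y \<Longrightarrow> adjacent m y x" using neighbours_sym by (auto simp: adjacent_def)
qed

definition pth :: "bool \<Rightarrow> 3 \<Rightarrow> 3 \<Rightarrow> triangle list" where
  "pth c i j = tree_path (cells c) (adjacent m) (exit c i) (exit c j)"

definition plen :: "bool \<Rightarrow> 3 \<Rightarrow> 3 \<Rightarrow> nat" where "plen c i j = length (pth c i j)"

definition lab :: "bool \<Rightarrow> 3 \<Rightarrow> 3 \<Rightarrow> nat \<Rightarrow> 3" where
  "lab c i j h = path_labels m (i, j) (pth c i j) ! h"

lemma pth: "path_from_to (cells c) (adjacent m) (exit c i) (exit c j) (pth c i j)"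
  unfolding pth_def by (rule tree.tree_path[OF exit_cells exit_cells])

lemma pth_basic:
  "pth c i j \<noteq> []" "distinct (pth c i j)" "set (pth c i j) \<subseteq> cells c"
  "pth c i j ! 0 = exit c i" "pth c i j ! (plen c i j - 1) = exit c j" "0 < plen c i j"
  using pth[of c i j]
  by (auto simp: path_from_to_def simple_path_def plen_def hd_conv_nth last_conv_nth)

lemma pth_cells: "h < plen c i j \<Longrightarrow> pth c i j ! h \<in> cells c"
  using pth_basic(3)[of c i j] by (auto simp: plen_def)

lemma pth_adjacent: "Suc h < plen c i j \<Longrightarrow> adjacent m (pth c i j ! h) (pth c i j ! Suc h)"
  using pth[of c i j] by (auto simp: path_from_to_def simple_path_def plen_def successively_conv_nth)

lemma lab_0: "lab c i j 0 = i"
  by (simp add: lab_def path_labels_def)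

lemma lab_last: "lab c i j (plen c i j) = j"
  using pth_basic(6)[of c i j]
  by (simp add: lab_def path_labels_def plen_def nth_Cons' nth_append)

lemma lab_neighbours:
  assumes "Suc h < plen c i j"
  shows "neighbours m (lab c i j (Suc h)) (pth c i j ! h) (pth c i j ! Suc h)"
proof -
  have "lab c i j (Suc h) = edge_label m (pth c i j ! h) (pth c i j ! Suc h)"
  proof -
    have "h < length (pth c i j) - 1" using assms unfolding plen_def by linarith
    then show ?thesis by (simp add: lab_def path_labels_def nth_append nth_butlast nth_tl)
  qed
  then show ?thesis using pth_adjacent[OF assms] edge_label unfolding adjacent_iff by auto
qed

lemma pth_TT: "h < plen c i j \<Longrightarrow> pth c i j ! h \<in> TT m \<longleftrightarrow> even h"
proof (induction h)
  case 0
  then show ?case using exit_TT by (simp add: pth_basic)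
next
  case (Suc h)
  then show ?case using neighbours_cases[OF lab_neighbours[OF Suc.prems]] by auto
qed

lemma odd_plen: "odd (plen c i j)"
  using pth_TT[of "plen c i j - 1" c i j] exit_TT pth_basic(5,6)[of c i j] by simp

text \<open>A common exit of two sides lies in a corner; the mirrored exits of the other colour
  would then occupy two different corners.\<close>

lemma exit_ne:
  assumes "i \<noteq> j"
  shows "exit c i \<noteq> exit c j"
proof
  assume eq: "exit c i = exit c j"
  then have "idx (exit c i) = idx (exit c j)" by simp
  then have e: "pos m c i (\<kappa> i) = pos m c j (\<kappa> j)" by (simp add: idx_exit)
  have corner: "exit (\<not> c) a \<in> corner_triangles (up (\<not> c)) \<and> idx (exit (\<not> c) a) $ b = m - 1"
    if ab: "a \<noteq> b" "pos m c a (\<kappa> a) $ b = 0" for a b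
  proof -
    let ?U = "exit (\<not> c) a"
    have b: "idx ?U $ b = m - 1" using pos_nth(3)[OF \<kappa>(1)[of a] ab(1)[symmetric], of c] ab(2) by
      (simp add: idx_exit)
    moreover have s: "idx ?U $ 1 + idx ?U $ 2 + idx ?U $ 3 = m - 1"
      using idx_up[OF exit_TT] T_index_iff by blast
    ultimately have z: "idx ?U $ l = 0" if "l \<noteq> b" for l
      using that exhaust_3[of l] exhaust_3[of b] by auto
    have "tri_map ?U (P b) = P b"
    proof (rule barycentric_inj[OF map_T1[OF exit_cells P_T1] P_T1])
      fix l
      have "real m * \<beta> (tri_map ?U (P b)) $ l = real m * \<beta> (P b) $ l"
        using map_up[OF exit_TT P_T1, of "\<not> c" a b l] b z[of l] m by (auto simp: barycentric_P)
      then show "\<beta> (tri_map ?U (P b)) $ l = \<beta> (P b) $ l" using m by simp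
    qed
    then have "P b \<in> region ?U" unfolding region_eq using P_T1 by (metis image_eqI)
    then show ?thesis using b \<kappa>(2) by (auto simp: corner_triangles_def)
  qed
  have "pos m c i (\<kappa> i) $ j = 0" "pos m c j (\<kappa> j) $ i = 0"
    using e pos_nth(1)[OF \<kappa>(1)] by metis+
  from corner[OF assms this(1)] corner[OF assms[symmetric] this(2)]
  have c2: "exit (\<not> c) i \<in> corner_triangles (up (\<not> c))" "exit (\<not> c) j \<in> corner_triangles (up (\<not> c))"
    and ij: "idx (exit (\<not> c) i) $ j = m - 1" by auto
  have "card (corner_triangles (up (\<not> c))) \<le> 1"
    using lps by (auto simp: labyrinth_patterns_system_def up_def)
  moreover have "finite (corner_triangles (up (\<not> c)))"
    by (rule finite_subset[OF _ finite_cells[of "\<not> c"]]) (auto simp: corner_triangles_def cells_def)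
  ultimately have "exit (\<not> c) i = exit (\<not> c) j" using c2 by (auto simp: card_le_Suc0_iff_eq)
  then have "idx (exit (\<not> c) j) $ j = m - 1" using ij by simp
  then show False using pos_nth(1)[OF \<kappa>(1)] m by (simp add: idx_exit)
qed

lemma plen_ge3:
  assumes "i \<noteq> j"
  shows "plen c i j \<ge> 3"
proof -
  have "plen c i j \<noteq> 1"
    using exit_ne[OF assms, of c] pth_basic(4,5)[of c i j] by auto
  moreover have "plen c i j \<noteq> 0" "plen c i j \<noteq> 2" using pth_basic(6)[of c i j] odd_plen[of c i j] by auto
  ultimately show ?thesis by linarith
qed

text \<open>An exit on side \<open>i\<close> has index \<open>0\<close> there and thus no neighbour
  across that side; inside the path a repeated label would lead back to the previous triangle by
  \<open>neighbours_unique\<close>.\<close>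

lemma lab_step:
  assumes ij: "i \<noteq> j" and h: "h < plen c i j"
  shows "lab c i j h \<noteq> lab c i j (Suc h)"
proof
  assume eq: "lab c i j h = lab c i j (Suc h)"
  let ?p = "pth c i j"
  note l3 = plen_ge3[OF ij, of c]
  consider "h = 0" | "h = plen c i j - 1" | "h \<noteq> 0" "Suc h < plen c i j" using h by linarith
  then show False
  proof cases
    case 1
    have "neighbours m i (exit c i) (?p ! 1)"
      using lab_neighbours[of 0 c i j] l3 eq 1 by (simp add: lab_0 pth_basic)
    then have "idx (exit c i) $ i = idx (?p ! 1) $ i + 1" using neighbours_cases exit_TT by fastforce
    then show False using pos_nth(1)[OF \<kappa>(1)] by (simp add: idx_exit)
  next
    case 2
    then have "lab c i j h = j" "Suc (h - 1) < plen c i j" "Suc (h - 1) = h"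
      using eq lab_last[of c i j] l3 by auto
    then have "neighbours m j (?p ! (h - 1)) (exit c j)"
      using lab_neighbours[of "h - 1" c i j] 2 pth_basic(5)[of c i j] by simp
    then have "idx (exit c j) $ j = idx (?p ! (h - 1)) $ j + 1" using neighbours_cases exit_TT by fastforce
    then show False using pos_nth(1)[OF \<kappa>(1)] by (simp add: idx_exit)
  next
    case 3
    then obtain g where g: "h = Suc g" by (cases h) auto
    have "neighbours m (lab c i j h) (?p ! h) (?p ! g)" "neighbours m (lab c i j h) (?p ! h) (?p ! Suc h)"
      using lab_neighbours[of g c i j] lab_neighbours[of h c i j] 3 g eq neighbours_sym by auto
    then have "?p ! g = ?p ! Suc h" by (rule neighbours_unique)
    then show False using pth_basic(2)[of c i j] 3 g by (simp add: nth_eq_iff_index_eq plen_def)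
  qed
qed

lemma label_seq: "i \<noteq> j \<Longrightarrow> label_seq (lab c i j) (plen c i j)"
  by standard (use odd_plen lab_step lab_0 lab_last in auto)

lemma pth_rev: "pth c j i = rev (pth c i j)"
  unfolding pth_def[of c j i]
  by (rule tree.tree_path_eq[OF path_from_to_rev[OF tree.sym pth]])

lemma plen_rev: "plen c j i = plen c i j"
  by (simp add: plen_def pth_rev[of c j i])

lemma lab_rev:
  assumes "h \<le> plen c i j"
  shows "lab c j i h = lab c i j (plen c i j - h)"
proof -
  let ?r = "plen c i j"
  consider "h = 0" | "h = ?r" | "0 < h" "h < ?r" using assms by linarith
  then show ?thesis
  proof cases
    case 1
    then show ?thesis by (simp add: lab_0 lab_last)
  next
    case 2
    then show ?thesis using lab_last[of c j i] by (simp add: plen_rev lab_0)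
  next
    case 3
    then obtain g where g: "h = Suc g" "Suc g < ?r" by (cases h) auto
    have "neighbours m (lab c j i h) (pth c j i ! g) (pth c j i ! Suc g)"
      using lab_neighbours[of g c j i] g by (simp add: plen_rev[of c j i])
    moreover have "pth c j i ! g = pth c i j ! Suc (?r - Suc (Suc g))"
      "pth c j i ! Suc g = pth c i j ! (?r - Suc (Suc g))"
      using g by (simp_all add: pth_rev[of c j i] rev_nth plen_def Suc_diff_Suc)
    moreover have "neighbours m (lab c i j (Suc (?r - Suc (Suc g)))) (pth c i j ! (?r - Suc (Suc
      g))) (pth c i j ! Suc (?r - Suc (Suc g)))"
      using g by (intro lab_neighbours) auto
    ultimately have "lab c j i h = lab c i j (Suc (?r - Suc (Suc g)))"
      using neighbours_label neighbours_sym by metis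
    then show ?thesis using g by (simp add: Suc_diff_Suc)
  qed
qed

definition cnt :: "bool \<Rightarrow> bool \<Rightarrow> 3 \<Rightarrow> 3 \<Rightarrow> 3 \<Rightarrow> nat" where
  "cnt e c i j l = card {h. h < plen c i j \<and> even h = e \<and> third (lab c i j h) (lab c i j (Suc h)) = l}"

lemma cnt_types: "i \<noteq> j \<Longrightarrow> cnt e c i j l = label_seq.types (lab c i j) (plen c i j) e l"
  by (simp add: cnt_def label_seq.types_def[OF label_seq])

lemma cnt_rev: "cnt True c j i l = cnt True c i j l"
proof -
  let ?r = "plen c i j"
  \<comment> \<open>The length is odd, so reversing the positions preserves parity and upright
    triangles correspond to upright ones.\<close>
  have "bij_betw (\<lambda>h. ?r - 1 - h) {h. h < plen c j i \<and> even h = True \<and> third (lab c j i h) (lab c j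
    i (Suc h)) = l}
    {h. h < ?r \<and> even h = True \<and> third (lab c i j h) (lab c i j (Suc h)) = l}"
  proof (rule bij_betwI[where g = "\<lambda>h. ?r - 1 - h"])
    have *: "third (lab c j i h) (lab c j i (Suc h)) = third (lab c i j (?r - 1 - h)) (lab c i j
      (Suc (?r - 1 - h)))"
      and e: "even (?r - 1 - h) = even h" if "h < ?r" for h
    proof -
      have eq: "Suc (?r - 1 - h) = ?r - h" "?r - Suc h = ?r - 1 - h" using that by auto
      have "lab c j i h = lab c i j (?r - h)" "lab c j i (Suc h) = lab c i j (?r - Suc h)"
        using that by (auto intro!: lab_rev)
      then show "third (lab c j i h) (lab c j i (Suc h)) = third (lab c i j (?r - 1 - h)) (lab c i j
        (Suc (?r - 1 - h)))"
        unfolding eq by (simp only: third_sym[of "lab c i j (?r - h)"])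
      show "even (?r - 1 - h) = even h" using that odd_plen[of c i j] by (auto simp: even_diff_nat)
    qed
    show "(\<lambda>h. ?r - 1 - h) \<in> {h. h < plen c j i \<and> even h = True \<and> third (lab c j i h) (lab c j i (Suc h)) = l}
      \<rightarrow> {h. h < ?r \<and> even h = True \<and> third (lab c i j h) (lab c i j (Suc h)) = l}"
      using * e by (auto simp: plen_rev[of c j i])
    show "(\<lambda>h. ?r - 1 - h) \<in> {h. h < ?r \<and> even h = True \<and> third (lab c i j h) (lab c i j (Suc h)) = l}
      \<rightarrow> {h. h < plen c j i \<and> even h = True \<and> third (lab c j i h) (lab c j i (Suc h)) = l}"
    proof
      fix h assume "h \<in> {h. h < ?r \<and> even h = True \<and> third (lab c i j h) (lab c i j (Suc h)) = l}"
      then show "?r - 1 - h \<in> {h. h < plen c j i \<and> even h = True \<and> third (lab c j i h) (lab c j i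
        (Suc h)) = l}"
        using *[of "?r - 1 - h"] e[of h] by (auto simp: plen_rev[of c j i])
    qed
  qed (auto simp: plen_rev[of c j i])
  then show ?thesis unfolding cnt_def by (rule bij_betw_same_card)
qed

text \<open>The pair of \<open>path_types\<close> with third index \<open>k\<close>; with it the
  rows of the matrices are indexed by a single element of type \<open>3\<close>.\<close>

definition std :: "3 \<Rightarrow> 3 \<times> 3" where
  "std k = (if k = 3 then (1, 2) else if k = 2 then (1, 3) else (2, 3))"

definition N :: "bool \<Rightarrow> 3 \<Rightarrow> 3 \<Rightarrow> nat" where
  "N c k l = cnt True c (fst (std k)) (snd (std k)) l"

lemma std: "fst (std k) \<noteq> snd (std k)" "third (fst (std k)) (snd (std k)) = k"
  using exhaust_3[of k] by (auto simp: std_def third_def)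

lemma std_cases: "i \<noteq> j \<Longrightarrow> std (third i j) = (i, j) \<or> std (third i j) = (j, i)"
  using exhaust_3[of i] exhaust_3[of j] by (auto simp: std_def third_def)

lemma cnt_N: "i \<noteq> j \<Longrightarrow> cnt True c i j l = N c (third i j) l"
  using std_cases[of i j] cnt_rev[of c i j l] by (auto simp: N_def)

lemma cnt_False:
  assumes "i \<noteq> j"
  shows "int (cnt False c i j l) = int (N c (third i j) l) - (if l = third i j then 1 else 0)"
  using label_seq.types_diff[OF label_seq[OF assms, of c], of l] cnt_N[OF assms, of c l]
  by (simp add: cnt_types[OF assms] lab_0 lab_last)

lemma N_diag: "N c k k \<ge> 1"
  using cnt_False[OF std(1)[of k], of c k] by (simp add: std)

lemma N_sum: "(\<Sum>l\<in>UNIV. N c k l) = (plen c (fst (std k)) (snd (std k)) + 1) div 2"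
  using label_seq.sum_types[OF label_seq[OF std(1)[of k], of c]]
  by (simp add: N_def cnt_types[OF std(1)])

lemma N_sum_ge2: "(\<Sum>l\<in>UNIV. N c k l) \<ge> 2"
  using plen_ge3[OF std(1)[of k], of c] N_sum[of c k] by simp

text \<open>Crossing an edge with label \<open>a\<close> lowers the \<open>a\<close>-th index on the
  way out of an upright triangle and raises it on the way out of an inverted one.\<close>

lemma idx_path:
  assumes "h < plen c i j"
  shows "int (idx (pth c i j ! h) $ a) = int (idx (exit c i) $ a) +
    (\<Sum>g<h. (-1)^(Suc g) * (if lab c i j (Suc g) = a then 1 else 0))"
  using assms
proof (induction h)
  case 0
  then show ?case by (simp add: pth_basic)
next
  case (Suc h)
  have n: "neighbours m (lab c i j (Suc h)) (pth c i j ! h) (pth c i j ! Suc h)"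
    using Suc.prems by (rule lab_neighbours)
  have "int (idx (pth c i j ! Suc h) $ a) = int (idx (pth c i j ! h) $ a) + (-1)^(Suc h) * (if lab c
    i j (Suc h) = a then 1 else 0)"
    using neighbours_cases[OF n] pth_TT[of h c i j] Suc.prems by (cases "even h") auto
  then show ?case using Suc by simp
qed

lemma displacement:
  assumes ij: "i \<noteq> j"
  shows "int (label_seq.occ (lab c i j) (plen c i j) True a) - int (label_seq.occ (lab c i j) (plen
    c i j) False a)
    = int (idx (exit c j) $ a) - int (idx (exit c i) $ a) + (if a = i then 1 else 0) - (if a = j
      then 1 else 0)"
proof -
  let ?x = "\<lambda>g. (-1)^g * (if lab c i j g = a then 1 else 0 :: int)"
  obtain s where s: "plen c i j = Suc s" using pth_basic(6)[of c i j] by (cases "plen c i j") auto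
  have "(\<Sum>g<Suc (plen c i j). ?x g) = ?x 0 + (\<Sum>g<s. ?x (Suc g)) + ?x (Suc s)"
    unfolding s by (simp only: sum.lessThan_Suc_shift[of ?x "Suc s"] sum.lessThan_Suc[of "\<lambda>g. ?x (Suc g)"])
  moreover have "(\<Sum>g<s. ?x (Suc g)) = int (idx (exit c j) $ a) - int (idx (exit c i) $ a)"
    using idx_path[of s c i j a] pth_basic(5)[of c i j] s by simp
  moreover have "?x 0 = (if a = i then 1 else 0)" by (auto simp: lab_0)
  moreover have "?x (Suc s) = - (if a = j then 1 else 0)"
    using lab_last[of c i j] odd_plen[of c i j] s by auto
  ultimately show ?thesis
    unfolding label_seq.occ_diff[OF label_seq[OF ij]] by simp
qed

text \<open>In the coordinates \<open>i\<close> and \<open>j\<close> the mirrored exits contribute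
  \<open>m - 1\<close> for both paths together; the other \<open>2\<close> in \<open>m + 1\<close>
  are the outer labels, one for each path.\<close>

lemma displacement_sum:
  assumes ij: "i \<noteq> j"
  defines "occ \<equiv> \<lambda>c. label_seq.occ (lab c i j) (plen c i j)"
  shows "int (occ True True a) + int (occ False True a) - int (occ True False a) - int (occ False False a)
    = (int m + 1) * ((if a = i then 1 else 0) - (if a = j then 1 else 0))"
proof -
  have e: "int (idx (exit True l) $ a) + int (idx (exit False l) $ a) = (if a = l then 0 else int m
    - 1)" for l
    using pos_nth(1)[OF \<kappa>(1)[of l]] pos_nth(3)[OF \<kappa>(1)[of l], where j = a and c = True] m
    by (simp add: idx_exit flip: of_nat_add)
  show ?thesis
    using displacement[OF ij, of True a] displacement[OF ij, of False a] e[of i] e[of j] ij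
    unfolding occ_def by (auto simp: algebra_simps)
qed

text \<open>As long as the label \<open>k\<close> does not occur, the \<open>k\<close>-th index
  keeps its value at the first triangle, and the whole path lies in one strip.\<close>

lemma blocked_label:
  assumes ij: "i \<noteq> j" and k: "k = third i j"
    and b: "U \<in> set (pth c i j)" "V \<in> set (pth c i j)"
      "\<not> (\<exists>K\<in>{0..m - 1}. U \<in> strip m k K \<and> V \<in> strip m k K)"
  shows "\<exists>g<plen c i j. lab c i j g = k"
proof (rule ccontr)
  assume no: "\<not> ?thesis"
  define K where "K = idx (exit c i) $ k"
  have "K \<le> m - 1" unfolding K_def using idx_up[OF exit_TT] T_index_le by blast
  moreover have "W \<in> strip m k K" if W: "W \<in> set (pth c i j)" for W
  proof -
    obtain h where h: "h < plen c i j" "W = pth c i j ! h" using W unfolding in_set_conv_nth plen_def by metis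
    have "(\<Sum>g<h. (-1)^(Suc g) * (if lab c i j (Suc g) = k then 1 else 0)) = (0::int)"
      using no h(1) by (intro sum.neutral) auto
    then have "idx W $ k = K" using idx_path[OF h(1), of k] h(2) by (simp add: K_def)
    moreover have "W \<in> TT m \<or> W \<in> TT' m" using W pth_basic(3) cells_sub by blast
    ultimately show ?thesis using idx_up idx_dn unfolding strip_def by blast
  qed
  ultimately have "K \<in> {0..m - 1}" "U \<in> strip m k K" "V \<in> strip m k K" using b(1,2) by simp_all
  then show False using b(3) by blast
qed

lemma white_path_eq: "white_path m S (i, j) = pth True i j"
  and yellow_path_eq: "yellow_path m S (i, j) = pth False i j"
  by (simp_all add: white_path_def yellow_path_def pth_def cells_all white_exit_eq yellow_exit_eq)

lemma blocked_iff_label: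
  assumes ij: "i \<noteq> j" and b: "blocked m S (i, j)"
  shows "\<exists>c. \<exists>g<plen c i j. lab c i j g = third i j"
proof -
  obtain c where "blocked_path m (i, j) (pth c i j)"
    using b unfolding blocked_def white_path_eq yellow_path_eq by blast
  then obtain k where k: "{k} = {1, 2, 3} - {i, j}"
    "\<exists>U\<in>set (pth c i j). \<exists>V\<in>set (pth c i j). \<not> (\<exists>K\<in>{0..m - 1}. U \<in> strip m k K \<and> V \<in> strip m k K)"
    unfolding blocked_path_def prod.case by (elim exE conjE)
  from k(2) obtain U V where UV: "U \<in> set (pth c i j)" "V \<in> set (pth c i j)"
    "\<not> (\<exists>K\<in>{0..m - 1}. U \<in> strip m k K \<and> V \<in> strip m k K)"
    by (elim bexE)
  have "k \<in> {1, 2, 3} - {i, j}" unfolding k(1)[symmetric] by simp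
  then have "k \<noteq> i" "k \<noteq> j" by blast+
  then have "k = third i j" using third_iff[OF ij, of k] by simp
  then show ?thesis using blocked_label[OF ij _ UV] by blast
qed

end

locale blocked_labyrinth = labyrinth +
  assumes blocked: "globally_blocked m S"
begin

lemma blocked_std: "\<exists>c. \<exists>g<plen c (fst (std k)) (snd (std k)). lab c (fst (std k)) (snd (std k)) g = k"
proof -
  have "std k \<in> set path_types" using exhaust_3[of k] by (auto simp: std_def path_types_def)
  then have "blocked m S (fst (std k), snd (std k))" using blocked by (simp add: globally_blocked_def)
  from blocked_iff_label[OF std(1) this] show ?thesis by (simp add: std)
qed

text \<open>The left side counts the even positions of both label sequences, and equally the odd
  ones. By \<open>displacement_sum\<close> the label \<open>i\<close> fills at least
  \<open>m + 1\<close> even positions and \<open>j\<close> at least \<open>m + 1\<close> odd ones;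
  the label \<open>k\<close>, present by blocking, takes one more.\<close>

lemma row_sum: "(\<Sum>l\<in>UNIV. N True k l) + (\<Sum>l\<in>UNIV. N False k l) \<ge> m + 2"
proof -
  obtain i j where ij: "std k = (i, j)" by force
  have ne: "i \<noteq> j" and k: "k \<noteq> i" "k \<noteq> j" using std[of k] third_ne[of i j] ij by auto
  let ?occ = "\<lambda>c. label_seq.occ (lab c i j) (plen c i j)"
  let ?n = "\<lambda>c. (plen c i j + 1) div 2"
  obtain c g where g: "g < plen c i j" "lab c i j g = k" using blocked_std[of k] ij by auto
  note le = label_seq.occ_sum_le[OF label_seq[OF ne]]
  have "?n True + ?n False \<ge> m + 2"
  proof (cases "even g")
    case True
    then have "?occ c True k \<noteq> 0"
      using label_seq.occ_0_iff[OF label_seq[OF ne]] g by (metis less_imp_le)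
    moreover have "?occ c True i + ?occ c True k \<le> ?n c" "?occ (\<not> c) True i + ?occ (\<not> c) True k \<le> ?n (\<not> c)"
      using le k by auto
    ultimately have "?occ c True i + ?occ (\<not> c) True i + 1 \<le> ?n c + ?n (\<not> c)" by linarith
    then have "?occ True True i + ?occ False True i + 1 \<le> ?n True + ?n False" by (cases c) auto
    moreover have "int (?occ True True i) + int (?occ False True i) \<ge> int m + 1"
      using displacement_sum[OF ne, of i] ne by simp
    ultimately show ?thesis by linarith
  next
    case False
    then have "?occ c False k \<noteq> 0"
      using label_seq.occ_0_iff[OF label_seq[OF ne]] g by (metis less_imp_le)
    moreover have "?occ c False j + ?occ c False k \<le> ?n c" "?occ (\<not> c) False j + ?occ (\<not> c) False k
      \<le> ?n (\<not> c)"
      using le k by auto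
    ultimately have "?occ c False j + ?occ (\<not> c) False j + 1 \<le> ?n c + ?n (\<not> c)" by linarith
    then have "?occ True False j + ?occ False False j + 1 \<le> ?n True + ?n False" by (cases c) auto
    moreover have "int (?occ True False j) + int (?occ False False j) \<ge> int m + 1"
      using displacement_sum[OF ne, of j] ne by simp
    ultimately show ?thesis by linarith
  qed
  then show ?thesis using ij by (simp add: N_sum)
qed

text \<open>If no triangle had the type with third index \<open>l\<close>, then \<open>l\<close> would be every other label on both
  paths, so \<open>k\<close> would only occur in places of one parity, where \<open>displacement_sum\<close> leaves no room.\<close>

lemma offdiag:
  assumes l: "l \<noteq> k"
  shows "N True k l + N False k l \<ge> 1"
proof (rule ccontr)
  assume "\<not> ?thesis"
  then have N0: "N c k l = 0" for c by (cases c) auto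
  obtain i j where ij: "std k = (i, j)" by force
  have ne: "i \<noteq> j" and kij: "k = third i j" and k: "k \<noteq> i" "k \<noteq> j"
    using std[of k] third_ne[of i j] ij by auto
  let ?occ = "\<lambda>c. label_seq.occ (lab c i j) (plen c i j)"
  note o0 = label_seq.occ_0_iff[OF label_seq[OF ne]]
  have par: "lab c i j g = l \<longleftrightarrow> (even g \<longleftrightarrow> i = l)" if "g \<le> plen c i j" for c g
  proof -
    have "label_seq.types (lab c i j) (plen c i j) True l = 0"
      using N0[of c] unfolding N_def ij cnt_types[OF ne, symmetric] by simp
    moreover have "l \<noteq> third (lab c i j 0) (lab c i j (plen c i j))"
      unfolding lab_0 lab_last using l kij by simp
    ultimately have "lab c i j g = l \<longleftrightarrow> (even g \<longleftrightarrow> lab c i j 0 = l)"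
      using that by (rule label_seq.types_0_parity[OF label_seq[OF ne]])
    then show ?thesis unfolding lab_0 .
  qed
  have "?occ c (i = l) k = 0" for c
    unfolding o0
  proof (intro allI impI)
    fix g assume "g \<le> plen c i j" "even g = (i = l)"
    then have "lab c i j g = l" using par by blast
    then show "lab c i j g \<noteq> k" using l by simp
  qed
  \<comment> \<open>By \<open>displacement_sum\<close> the label \<open>k\<close> occurs equally
    often at even and at odd positions of both paths together, so if one parity is empty, so is the
    other.\<close>
  then have "?occ c e k = 0" for c e
    using displacement_sum[OF ne, of k] k by (cases "i = l"; cases c; cases e) auto
  then have "lab c i j g \<noteq> k" if "g \<le> plen c i j" for c g
    using o0 that by blast
  then show False using blocked_std[of k] ij by (metis fst_conv less_imp_le snd_conv)
qed

end

section \<open>Positive matrices\<close>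

text \<open>Brouwer's fixed point theorem on the standard simplex, for \<open>A x\<close> divided by
  its coordinate sum; that sum becomes the eigenvalue.\<close>

lemma positive_eigenvector:
  fixes A :: "'n::finite \<Rightarrow> 'n \<Rightarrow> real"
  assumes A: "\<And>i j. A i j > 0"
  shows "\<exists>\<theta> x. (\<forall>i. x i > 0) \<and> (\<forall>i. (\<Sum>j\<in>UNIV. A i j * x j) = \<theta> * x i)"
proof -
  define \<Delta> where "\<Delta> = {x :: real^'n. (\<forall>i. 0 \<le> x $ i) \<and> (\<Sum>i\<in>UNIV. x $ i) = 1}"
  define s where "s x = (\<Sum>i\<in>UNIV. \<Sum>j\<in>UNIV. A i j * x $ j)" for x :: "real^'n"
  define f where "f x = (\<chi> i. (\<Sum>j\<in>UNIV. A i j * x $ j) / s x)" for x :: "real^'n"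
  have row: "(\<Sum>j\<in>UNIV. A i j * x $ j) > 0" if x: "x \<in> \<Delta>" for x i
  proof -
    have "\<not> (\<forall>j. x $ j = 0)"
    proof
      assume "\<forall>j. x $ j = 0"
      then have "(\<Sum>i\<in>UNIV. x $ i) = 0" by simp
      then show False using x by (simp add: \<Delta>_def)
    qed
    then obtain j where "x $ j \<noteq> 0" by blast
    then have "x $ j > 0" using x by (simp add: \<Delta>_def less_le)
    then show ?thesis using x A
      by (intro sum_pos2[of _ j]) (auto simp: \<Delta>_def less_imp_le)
  qed
  have s: "s x > 0" if x: "x \<in> \<Delta>" for x
    unfolding s_def by (rule sum_pos[OF _ _ row[OF x]]) auto
  have "compact \<Delta>"
  proof -
    have "x $ i \<le> 1" if "x \<in> \<Delta>" for x i
    proof -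
      have "x $ i \<le> (\<Sum>i\<in>UNIV. x $ i)" using that by (intro member_le_sum) (auto simp: \<Delta>_def)
      then show ?thesis using that by (simp add: \<Delta>_def)
    qed
    then have "bounded \<Delta>"
      by (intro bounded_subset[OF bounded_cbox[of 0 1]]) (auto simp: \<Delta>_def mem_box_cart)
    moreover have "closed \<Delta>"
    proof -
      have "\<Delta> = (\<Inter>i. {x. 0 \<le> x $ i}) \<inter> {x. (\<Sum>i\<in>UNIV. x $ i) = 1}" by (auto simp: \<Delta>_def)
      moreover have "closed ((\<Inter>i. {x::real^'n. 0 \<le> x $ i}) \<inter> {x. (\<Sum>i\<in>UNIV. x $ i) = 1})"
        by (intro closed_Int closed_INT ballI closed_Collect_le closed_Collect_eq continuous_intros)
      ultimately show ?thesis by simp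
    qed
    ultimately show ?thesis by (simp add: compact_eq_bounded_closed)
  qed
  moreover have "convex \<Delta>"
    unfolding convex_def \<Delta>_def
    by (auto simp: sum.distrib sum_distrib_left[symmetric])
  moreover have "\<Delta> \<noteq> {}"
  proof -
    have "(\<chi> i. 1 / real CARD('n)) \<in> \<Delta>" by (simp add: \<Delta>_def)
    then show ?thesis by blast
  qed
  moreover have "continuous_on \<Delta> f"
    unfolding f_def s_def
    by (intro continuous_on_vec_lambda continuous_intros) (use s in \<open>force simp: s_def\<close>)
  moreover have "f \<in> \<Delta> \<rightarrow> \<Delta>"
  proof
    fix x assume x: "x \<in> \<Delta>"
    have "(\<Sum>i\<in>UNIV. f x $ i) = s x / s x"
      by (simp add: f_def s_def sum_divide_distrib[symmetric])
    then show "f x \<in> \<Delta>" using s[OF x] row[OF x] by (auto simp: \<Delta>_def f_def less_imp_le)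
  qed
  ultimately obtain x where x: "x \<in> \<Delta>" "f x = x" using brouwer[of \<Delta> f] by blast
  have e: "(\<Sum>j\<in>UNIV. A i j * x $ j) = s x * x $ i" for i
  proof -
    have "f x $ i = x $ i" using x by simp
    then show ?thesis using s[OF x(1)] by (simp add: f_def field_simps)
  qed
  have "x $ i > 0" for i
    using e[of i] row[OF x(1), of i] s[OF x(1)] by (simp add: zero_less_mult_iff)
  then show ?thesis using e by (intro exI[of _ "s x"] exI[of _ "($) x"]) simp
qed

text \<open>Splitting off the identity turns the usual bound on the moduli of eigenvalues into the strict
  inequality: an eigenvalue of modulus \<open>\<theta>\<close> would have distance at most \<open>\<theta> - 1\<close> from \<open>1\<close>.\<close>

lemma eigenvalue_less:
  fixes A :: "'n::finite \<Rightarrow> 'n \<Rightarrow> real" and v :: "'n \<Rightarrow> complex"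
  assumes A: "\<And>i j. A i j \<ge> (if i = j then 1 else 0)"
    and x: "\<And>i. x i > 0" "\<And>i. (\<Sum>j\<in>UNIV. A i j * x j) = \<theta> * x i"
    and v: "v k \<noteq> 0" "\<And>i. (\<Sum>j\<in>UNIV. of_real (A i j) * v j) = w * v i" and w: "w \<noteq> of_real \<theta>"
  shows "cmod w < \<theta>"
proof -
  let ?B = "\<lambda>i j. A i j - (if i = j then 1 else 0)"
  \<comment> \<open>The least \<open>c\<close> with \<open>cmod (v i) \<le> c * x i\<close> for all
    \<open>i\<close>; the estimate is made at an index where equality holds.\<close>
  define c where "c = Max (range (\<lambda>i. cmod (v i) / x i))"
  have c: "cmod (v i) \<le> c * x i" for i
  proof -
    have "cmod (v i) / x i \<le> c" unfolding c_def by (intro Max_ge) auto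
    then show ?thesis using x(1)[of i] by (simp add: divide_le_eq)
  qed
  have "c \<in> range (\<lambda>i. cmod (v i) / x i)" unfolding c_def by (intro Max_in) auto
  then obtain i where "c = cmod (v i) / x i" by auto
  then have i: "cmod (v i) = c * x i" using x(1)[of i] by simp
  have "c * x k > 0" using c[of k] v(1) by (smt (verit) zero_less_norm_iff)
  then have "c > 0" using x(1)[of k] by (simp add: zero_less_mult_iff)
  have Bv: "(\<Sum>j\<in>UNIV. of_real (?B i j) * v j) = (w - 1) * v i"
    by (simp add: left_diff_distrib sum_subtractf v(2) if_distrib[of of_real] if_distrib[of
      "\<lambda>z. z * _"] cong: if_cong)
  have Bx: "(\<Sum>j\<in>UNIV. ?B i j * x j) = (\<theta> - 1) * x i"
    by (simp add: left_diff_distrib sum_subtractf x(2) if_distrib[of "\<lambda>z. z * _"] cong: if_cong)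
  have "cmod (w - 1) * (c * x i) = cmod (\<Sum>j\<in>UNIV. of_real (?B i j) * v j)"
    unfolding Bv norm_mult i ..
  also have "\<dots> \<le> (\<Sum>j\<in>UNIV. ?B i j * (c * x j))"
  proof (rule sum_norm_le)
    fix j
    have "0 \<le> ?B i j" using A[of i j] by simp
    then show "cmod (of_real (?B i j) * v j) \<le> ?B i j * (c * x j)"
      unfolding norm_mult norm_of_real using c[of j] by (intro mult_mono) auto
  qed
  also have "\<dots> = c * (\<Sum>j\<in>UNIV. ?B i j * x j)" by (simp add: sum_distrib_left mult_ac)
  also have "\<dots> = (\<theta> - 1) * (c * x i)" unfolding Bx by simp
  finally have le: "cmod (w - 1) \<le> \<theta> - 1" using \<open>c > 0\<close> x(1)[of i] by simp
  have "cmod w \<le> cmod (w - 1) + 1" using norm_triangle_ineq[of "w - 1" 1] by simp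
  then have "cmod w \<le> \<theta>" using le by simp
  \<comment> \<open>The disc of radius \<theta> - 1 about \<open>1\<close> meets the circle of
    radius \<theta> about \<open>0\<close> only in the point \<theta>.\<close>
  moreover have "cmod w \<noteq> \<theta>"
  proof
    assume eq: "cmod w = \<theta>"
    have "(cmod (w - 1))\<^sup>2 \<le> (\<theta> - 1)\<^sup>2" using le by (intro power_mono) auto
    moreover have "(cmod (w - 1))\<^sup>2 = (cmod w)\<^sup>2 - 2 * Re w + 1"
      unfolding cmod_power2 by (simp add: power2_eq_square algebra_simps)
    ultimately have "Re w \<ge> \<theta>" using eq by (simp add: power2_eq_square algebra_simps)
    then have "Re w = \<theta>" using complex_Re_le_cmod[of w] eq by simp
    moreover from this have "Im w = 0" using cmod_power2[of w] eq by simp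
    ultimately show False using w by (simp add: complex_eq_iff)
  qed
  ultimately show ?thesis by simp
qed

section \<open>The arcs between the exits\<close>

context labyrinth
begin

section \<open>Cell centres: separation and sparseness\<close>

lemma centre_T1: "bc (\<chi> i. 1/3) \<in> T1" "\<beta> (bc (\<chi> i. 1/3)) $ j = 1/3"
proof -
  have "(\<chi> i. 1/3) \<in> H" by (simp add: H_iff)
  then show "bc (\<chi> i. 1/3) \<in> T1" "\<beta> (bc (\<chi> i. 1/3)) $ j = 1/3"
    by (auto simp: T1_def barycentric_bc)
qed

definition inner :: "(real^2) set" where "inner = {x\<in>T1. \<forall>i. 0 < \<beta> x $ i}"

text \<open>The factor \<open>3\<close> comes from the coordinates \<open>1/3\<close> of the
  centroid, whose images under \<open>n\<close> cell maps are the centres of level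
  \<open>n\<close>.\<close>

definition lattice :: "nat \<Rightarrow> (real^2) set" where
  "lattice n = {x\<in>T1. \<forall>i. 3 * real m ^ n * \<beta> x $ i \<in> \<int>}"

lemma inner_less_1:
  assumes "x \<in> inner"
  shows "\<beta> x $ i < 1"
proof -
  have "0 < \<beta> x $ 1" "0 < \<beta> x $ 2" "0 < \<beta> x $ 3" "\<beta> x $ 1 + \<beta> x $ 2 + \<beta> x $ 3 = 1"
    using assms barycentric_bounds(3)[of x] by (auto simp: inner_def)
  then show ?thesis using exhaust_3[of i] by (elim disjE) simp_all
qed

lemma inner_map:
  assumes "U \<in> cells c" "x \<in> inner"
  shows "tri_map U x \<in> inner"
proof -
  have x: "x \<in> T1" using assms by (simp add: inner_def)
  have "0 < real m * \<beta> (tri_map U x) $ i" for i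
  proof (cases "U \<in> TT m")
    case True
    then show ?thesis using map_up[OF True x, of i] assms(2) by (simp add: inner_def add_nonneg_pos)
  next
    case False
    then have "U \<in> TT' m" using TT'_iff assms(1) by blast
    then show ?thesis using map_dn[of U x i] x inner_less_1[OF assms(2), of i] by simp
  qed
  then show ?thesis using map_T1[OF assms(1) x] m by (simp add: inner_def zero_less_mult_iff)
qed

text \<open>The index is the vector of integer parts of the scaled coordinates. The fractional parts
  add up to \<open>1\<close> in an upright cell and to \<open>2\<close> in an inverted one, which
  tells the two kinds apart.\<close>

lemma inner_inj:
  assumes U: "U \<in> cells c" "V \<in> cells c" and x: "x \<in> inner" "y \<in> inner" and eq: "tri_map U x = tri_map V y"
  shows "U = V \<and> x = y"
proof -
  have T1: "x \<in> T1" "y \<in> T1" using x by (auto simp: inner_def)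
  have b: "0 < \<beta> x $ i" "\<beta> x $ i < 1" "0 < \<beta> y $ i" "\<beta> y $ i < 1" for i
    using x inner_less_1 by (auto simp: inner_def)
  define u v where "u i = (if U \<in> TT m then \<beta> x $ i else 1 - \<beta> x $ i)"
    and "v i = (if V \<in> TT m then \<beta> y $ i else 1 - \<beta> y $ i)" for i
  have uv: "real (idx U $ i) + u i = real (idx V $ i) + v i" "0 < u i" "u i < 1" "0 < v i" "v i < 1" for i
    using b[of i] map_up[of U x i] map_dn[of U x i] map_up[of V y i] map_dn[of V y i] T1 eq
      TT'_iff[OF U(1)] TT'_iff[OF U(2)] by (auto simp: u_def v_def)
  have "idx U $ i = idx V $ i" for i
    using uv[of i] by linarith
  then have idx: "idx U = idx V" by (simp add: vec_eq_iff)
  have same: "U \<in> TT m \<longleftrightarrow> V \<in> TT m"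
  proof -
    have "u i = v i" for i using uv(1)[of i] idx by simp
    then have "u 1 + u 2 + u 3 = v 1 + v 2 + v 3" by simp
    then show ?thesis
      using barycentric_bounds(3)[OF T1(1)] barycentric_bounds(3)[OF T1(2)]
      by (cases "U \<in> TT m"; cases "V \<in> TT m") (auto simp: u_def v_def)
  qed
  have "U = V"
  proof (cases "U \<in> TT m")
    case True
    then show ?thesis using idx_up[of U] idx_up[of V] idx same by metis
  next
    case False
    then have "U \<in> TT' m" "V \<in> TT' m" using TT'_iff[OF U(1)] TT'_iff[OF U(2)] same by auto
    then show ?thesis using idx_dn[of U] idx_dn[of V] idx by metis
  qed
  then show ?thesis using map_inj[OF U(1) T1] eq by simp
qed

lemma lattice_map:
  assumes "U \<in> cells c" "x \<in> lattice n"
  shows "tri_map U x \<in> lattice (Suc n)"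
proof -
  have x: "x \<in> T1" "\<And>i. 3 * real m ^ n * \<beta> x $ i \<in> \<int>" using assms(2) by (auto simp: lattice_def)
  have "3 * real m ^ Suc n * \<beta> (tri_map U x) $ i \<in> \<int>" for i
  proof -
    have e: "3 * real m ^ Suc n * \<beta> (tri_map U x) $ i = 3 * real m ^ n * (real m * \<beta> (tri_map U x) $
      i)" by simp
    show ?thesis
    proof (cases "U \<in> TT m")
      case True
      have "3 * real m ^ n * (real (idx U $ i) + \<beta> x $ i) = of_nat (3 * m ^ n * idx U $ i) + 3 *
        real m ^ n * \<beta> x $ i"
        by (simp add: algebra_simps)
      also have "\<dots> \<in> \<int>" using x(2) by (intro Ints_add) auto
      finally show ?thesis unfolding e map_up[OF True x(1)] .
    next
      case False
      then have "U \<in> TT' m" using TT'_iff assms(1) by blast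
      have "3 * real m ^ n * (real (idx U $ i) + 1 - \<beta> x $ i) = of_nat (3 * m ^ n * (idx U $ i + 1))
        - 3 * real m ^ n * \<beta> x $ i"
        by (simp add: algebra_simps)
      also have "\<dots> \<in> \<int>" using x(2) by (intro Ints_diff) auto
      finally show ?thesis unfolding e map_dn[OF \<open>U \<in> TT' m\<close> x(1)] .
    qed
  qed
  then show ?thesis using map_T1[OF assms(1) x(1)] by (simp add: lattice_def)
qed

text \<open>Scaled by \<open>3 * m ^ n\<close>, the coordinates differ by integers, and two of them
  determine the point. The bound \<open>6 * K\<close> is this scale times the factor
  \<open>2\<close> of \<open>bc_coeff_bound\<close> times the bound on the distance.\<close>

lemma lattice_sparse:
  fixes K :: real
  defines "M \<equiv> \<lceil>6 * K\<rceil>"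
  assumes W: "W \<subseteq> lattice n" and d: "\<And>x y. x \<in> W \<Longrightarrow> y \<in> W \<Longrightarrow> dist x y \<le> K * (1 / real m) ^ n"
  shows "finite W \<and> card W \<le> card ({-M..M} \<times> {-M..M})"
proof (cases "W = {}")
  case True
  then show ?thesis by simp
next
  case False
  then obtain w where w: "w \<in> W" by blast
  define s where "s = 3 * real m ^ n"
  have s: "s > 0" using m by (simp add: s_def)
  define f where "f x = (\<lfloor>s * \<beta> x $ 2 - s * \<beta> w $ 2\<rfloor>, \<lfloor>s * \<beta> x $ 3 - s * \<beta> w $ 3\<rfloor>)" for x
  have T1: "x \<in> T1" if "x \<in> W" for x using W that by (auto simp: lattice_def)
  have int: "s * \<beta> x $ i - s * \<beta> y $ i \<in> \<int>" if "x \<in> W" "y \<in> W" for x y i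
    using W that by (intro Ints_diff) (auto simp: lattice_def s_def)
  have bound: "\<bar>s * \<beta> x $ i - s * \<beta> w $ i\<bar> \<le> 6 * K" if x: "x \<in> W" and i: "i = 2 \<or> i = 3" for x i
  proof -
    have z: "(\<beta> x - \<beta> w) $ 1 + (\<beta> x - \<beta> w) $ 2 + (\<beta> x - \<beta> w) $ 3 = 0"
      using barycentric_bounds(3)[OF T1[OF x]] barycentric_bounds(3)[OF T1[OF w]] by simp
    have "norm (bc (\<beta> x - \<beta> w)) = dist x w"
      by (simp add: bc_diff bc_barycentric T1 x w dist_norm)
    then have "\<bar>(\<beta> x - \<beta> w) $ i\<bar> \<le> 2 * (K * (1 / real m) ^ n)"
      using bc_coeff_bound[OF z] d[OF x w] i by fastforce
    then have "s * \<bar>(\<beta> x - \<beta> w) $ i\<bar> \<le> s * (2 * (K * (1 / real m) ^ n))"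
      using s by (intro mult_left_mono) auto
    also have "\<dots> = 6 * K" using m by (simp add: s_def power_divide)
    finally show ?thesis using s by (simp add: abs_mult right_diff_distrib[symmetric])
  qed
  have "f ` W \<subseteq> {-M..M} \<times> {-M..M}"
  proof (rule image_subsetI)
    fix x assume x: "x \<in> W"
    have *: "-M \<le> \<lfloor>z\<rfloor> \<and> \<lfloor>z\<rfloor> \<le> M" if "\<bar>z\<bar> \<le> 6 * K" for z :: real
      using that unfolding M_def by linarith
    show "f x \<in> {-M..M} \<times> {-M..M}"
      unfolding f_def using *[OF bound[OF x, of 2]] *[OF bound[OF x, of 3]] by auto
  qed
  moreover have "inj_on f W"
  proof (rule inj_onI)
    fix x y assume xy: "x \<in> W" "y \<in> W" "f x = f y"
    have fl: "z = z'" if "z \<in> \<int>" "z' \<in> \<int>" "\<lfloor>z\<rfloor> = \<lfloor>z'\<rfloor>" for z z' :: real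
      using that by (auto elim!: Ints_cases)
    have fe: "\<lfloor>s * \<beta> x $ 2 - s * \<beta> w $ 2\<rfloor> = \<lfloor>s * \<beta> y $ 2 - s * \<beta> w $ 2\<rfloor>"
      "\<lfloor>s * \<beta> x $ 3 - s * \<beta> w $ 3\<rfloor> = \<lfloor>s * \<beta> y $ 3 - s * \<beta> w $ 3\<rfloor>"
      using xy(3) unfolding f_def by (simp_all only: prod.inject)
    note fl[OF int[OF xy(1) w] int[OF xy(2) w] fe(1)] fl[OF int[OF xy(1) w] int[OF xy(2) w] fe(2)]
    then have e: "\<beta> x $ 2 = \<beta> y $ 2" "\<beta> x $ 3 = \<beta> y $ 3" using s by auto
    then have "\<beta> x $ 1 = \<beta> y $ 1"
      using barycentric_bounds(3)[OF T1[OF xy(1)]] barycentric_bounds(3)[OF T1[OF xy(2)]] by simp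
    then have "\<beta> x $ i = \<beta> y $ i" for i using e exhaust_3[of i] by auto
    then show "x = y" using barycentric_inj T1 xy by blast
  qed
  ultimately show ?thesis
    using inj_on_finite[of f W "{-M..M} \<times> {-M..M}"] card_inj_on_le[of f W "{-M..M} \<times> {-M..M}"] by simp
qed

definition tri_diam :: real where
  "tri_diam = (SOME B. \<forall>x\<in>T1. \<forall>y\<in>T1. dist x y \<le> B)"

lemma tri_diam: "x \<in> T1 \<Longrightarrow> y \<in> T1 \<Longrightarrow> dist x y \<le> tri_diam"
proof -
  have "\<exists>B. \<forall>x\<in>T1. \<forall>y\<in>T1. dist x y \<le> B"
    using compact_imp_bounded[OF compact_T1] unfolding bounded_two_points by blast
  then have "\<forall>x\<in>T1. \<forall>y\<in>T1. dist x y \<le> tri_diam" unfolding tri_diam_def by (rule someI_ex)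
  then show "x \<in> T1 \<Longrightarrow> y \<in> T1 \<Longrightarrow> dist x y \<le> tri_diam" by blast
qed

section \<open>Cutting an arc between exits into arcs between exits\<close>

definition nxt :: "bool \<times> 3 \<times> 3 \<Rightarrow> nat \<Rightarrow> bool \<times> 3 \<times> 3" where
  "nxt = (\<lambda>(c, i, j) h. (col c (pth c i j ! h), lab c i j h, lab c i j (Suc h)))"

text \<open>Ordered pairs, because a path may cross a cell of given type in either
  direction.\<close>

definition states :: "(bool \<times> 3 \<times> 3) set" where
  "states = {(c, i, j). i \<noteq> j}"

lemma col_pth: "h < plen c i j \<Longrightarrow> col c (pth c i j ! h) = (if even h then c else \<not> c)"
  using pth_TT by (simp add: col_def)

text \<open>\<open>tree_arc\<close> for the cells of the first level, with the contacts supplied by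
  \<open>cells_meet\<close>. The outer ends fit the same form, since an exit point is fixed by the
  map of its exit cell.\<close>

lemma arc_decompose:
  fixes g :: "real \<Rightarrow> real^2"
  assumes ij: "i \<noteq> j" and g: "continuous_on {a..b} g" "inj_on g {a..b}" "a \<le> b" "g ` {a..b} \<subseteq> frac c"
    "g a = E c i" "g b = E c j"
  shows "\<exists>t. t 0 = a \<and> t (plen c i j) = b \<and>
    (\<forall>h<plen c i j. a \<le> t h \<and> t h \<le> t (Suc h) \<and> t (Suc h) \<le> b \<and>
      g ` {t h..t (Suc h)} \<subseteq> tri_map (pth c i j ! h) ` frac (col c (pth c i j ! h)) \<and>
      g (t h) = tri_map (pth c i j ! h) (E (col c (pth c i j ! h)) (lab c i j h)) \<and>
      g (t (Suc h)) = tri_map (pth c i j ! h) (E (col c (pth c i j ! h)) (lab c i j (Suc h))))"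
proof -
  let ?F = "\<lambda>U. tri_map U ` frac (col c U)"
  let ?J = "\<lambda>U V. tri_map U (E (col c U) (edge_label m U V))"
  let ?p = "pth c i j"
  have cl: "closed (?F U)" if "U \<in> cells c" for U
    using that by (intro compact_imp_closed compact_continuous_image compact_frac
        continuous_on_subset[OF map_cont frac_T1])
  have meet: "\<exists>l. neighbours m l U V \<and> x = tri_map U (E (col c U) l)"
    if UV: "U \<in> cells c" "V \<in> cells c" "U \<noteq> V" and x: "x \<in> ?F U" "x \<in> ?F V" for U V x
  proof -
    obtain a' b' where "a' \<in> frac (col c U)" "b' \<in> frac (col c V)" "x = tri_map U a'"
      "tri_map U a' = tri_map V b'"
      using x by auto
    then show ?thesis using cells_meet[OF UV(1) _ UV(2) _ UV(3)] by blast
  qed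
  have irr: "\<not> adjacent m U U" for U
    unfolding adjacent_def using neighbours_cases by fastforce
  have colE: "col c (exit c l) = c" for l using exit_TT by (simp add: col_def)
  have "\<exists>t. t 0 = a \<and> t (length ?p) = b \<and>
    (\<forall>h<length ?p. a \<le> t h \<and> t h \<le> t (Suc h) \<and> t (Suc h) \<le> b \<and> g ` {t h..t (Suc h)} \<subseteq> ?F (?p ! h)) \<and>
    (\<forall>h. Suc h < length ?p \<longrightarrow> g (t (Suc h)) = ?J (?p ! h) (?p ! Suc h) \<and>
       g (t (Suc h)) \<in> ?F (?p ! h) \<inter> ?F (?p ! Suc h))"
  proof (rule tree.tree_arc[OF finite_cells irr cl _ _ pth g(1-3)])
    show "?F U \<inter> ?F V \<subseteq> {?J U V}" if UV: "U \<in> cells c" "V \<in> cells c" "adjacent m U V" for U V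
    proof
      fix x assume "x \<in> ?F U \<inter> ?F V"
      moreover have "U \<noteq> V" using irr UV by blast
      ultimately obtain l where "neighbours m l U V" "x = tri_map U (E (col c U) l)"
        using meet[OF UV(1,2)] by blast
      then show "x \<in> {?J U V}" using edge_label by simp
    qed
    show "?F U \<inter> ?F V = {}" if "U \<in> cells c" "V \<in> cells c" "U \<noteq> V" "\<not> adjacent m U V" for U V
      using meet[OF that(1-3)] that(4) unfolding adjacent_def by blast
    show "g ` {a..b} \<subseteq> (\<Union>U\<in>cells c. ?F U)" using g(4) frac_rec[of c] by simp
    show "g a \<in> ?F (exit c i)" "g b \<in> ?F (exit c j)"
      unfolding g(5,6) colE using E_frac E_fixed by (metis image_eqI)+
  qed
  then obtain t where t: "t 0 = a" "t (plen c i j) = b"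
    "\<And>h. h < plen c i j \<Longrightarrow> a \<le> t h \<and> t h \<le> t (Suc h) \<and> t (Suc h) \<le> b \<and> g ` {t h..t (Suc h)} \<subseteq> ?F (?p ! h)"
    "\<And>h. Suc h < plen c i j \<Longrightarrow> g (t (Suc h)) = ?J (?p ! h) (?p ! Suc h)"
    unfolding plen_def by blast
  have right: "g (t (Suc h)) = tri_map (?p ! h) (E (col c (?p ! h)) (lab c i j (Suc h)))" if h:
    "h < plen c i j" for h
  proof (cases "Suc h < plen c i j")
    case True
    then show ?thesis using t(4)[OF True] edge_label[OF lab_neighbours[OF True]] by simp
  next
    case False
    then have "Suc h = plen c i j" "h = plen c i j - 1" using h by auto
    then have "?p ! h = exit c j" "lab c i j (Suc h) = j" "g (t (Suc h)) = E c j"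
      using pth_basic(5)[of c i j] lab_last[of c i j] t(2) g(6) by simp_all
    then show ?thesis by (simp add: colE E_fixed)
  qed
  have left: "g (t h) = tri_map (?p ! h) (E (col c (?p ! h)) (lab c i j h))" if h: "h < plen c i j" for h
  proof (cases h)
    case 0
    then show ?thesis using t(1) g(5) by (simp add: pth_basic lab_0 colE E_fixed)
  next
    case (Suc k)
    have "Suc k < plen c i j" using h Suc by simp
    then have "tri_map (?p ! k) (E (col c (?p ! k)) (lab c i j (Suc k))) =
      tri_map (?p ! Suc k) (E (col c (?p ! Suc k)) (lab c i j (Suc k)))"
      by (intro junction[OF pth_cells pth_cells lab_neighbours]) auto
    then show ?thesis using right[of k] h Suc by simp
  qed
  show ?thesis using t(1,2,3) left right by (intro exI[of _ t]) auto
qed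

text \<open>Any parameter interval is allowed, so that the pieces of an arc are of the same kind
  without reparametrisation.\<close>

definition exit_arc :: "bool \<Rightarrow> 3 \<Rightarrow> 3 \<Rightarrow> (real^2) set \<Rightarrow> bool" where
  "exit_arc c i j A \<longleftrightarrow> A \<subseteq> frac c \<and> (\<exists>(g :: real \<Rightarrow> real^2) a b. a \<le> b \<and> continuous_on {a..b} g \<and>
    inj_on g {a..b} \<and>
     g a = E c i \<and> g b = E c j \<and> g ` {a..b} = A)"

lemma exit_arc_pieces:
  assumes ij: "i \<noteq> j" and A: "exit_arc c i j A"
  shows "\<exists>B. (\<forall>h<plen c i j. exit_arc (col c (pth c i j ! h)) (lab c i j h) (lab c i j (Suc h)) (B h)) \<and>
    A = (\<Union>h<plen c i j. tri_map (pth c i j ! h) ` B h)"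
proof -
  obtain g :: "real \<Rightarrow> real^2" and a b :: real where g: "a \<le> b" "continuous_on {a..b} g"
    "inj_on g {a..b}" "g a = E c i" "g b = E c j"
    "g ` {a..b} = A" and Ac: "A \<subseteq> frac c" using A unfolding exit_arc_def by blast
  let ?U = "\<lambda>h. pth c i j ! h" and ?c = "\<lambda>h. col c (pth c i j ! h)"
  obtain t where t: "t 0 = a" "t (plen c i j) = b"
    "\<And>h. h < plen c i j \<Longrightarrow> a \<le> t h \<and> t h \<le> t (Suc h) \<and> t (Suc h) \<le> b \<and>
      g ` {t h..t (Suc h)} \<subseteq> tri_map (?U h) ` frac (?c h) \<and>
      g (t h) = tri_map (?U h) (E (?c h) (lab c i j h)) \<and>
      g (t (Suc h)) = tri_map (?U h) (E (?c h) (lab c i j (Suc h)))"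
    using arc_decompose[OF ij g(2,3,1) _ g(4,5)] g(6) Ac by blast
  \<comment> \<open>The piece of \<open>g\<close> in cell \<open>h\<close>, pulled back by the cell
    map; it is continuous because that map scales all distances by the same factor.\<close>
  define k where "k h s = (THE y. y \<in> T1 \<and> tri_map (?U h) y = g s)" for h s
  have keq: "k h s = y" if "h < plen c i j" "y \<in> T1" "tri_map (?U h) y = g s" for h s y
    unfolding k_def using that map_inj[OF pth_cells[OF that(1)]] by (intro the_equality) auto
  have kin: "k h s \<in> frac (?c h) \<and> tri_map (?U h) (k h s) = g s" if h: "h < plen c i j" and s:
    "s \<in> {t h..t (Suc h)}" for h s
  proof -
    obtain y where y: "y \<in> frac (?c h)" "g s = tri_map (?U h) y" using t(3)[OF h] s by blast
    then have "k h s = y" using keq[OF h, of y s] frac_T1 by auto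
    then show ?thesis using y by simp
  qed
  have piece: "exit_arc (?c h) (lab c i j h) (lab c i j (Suc h)) (k h ` {t h..t (Suc h)})"
    if h: "h < plen c i j" for h
    unfolding exit_arc_def
  proof (intro conjI exI)
    note U = pth_cells[OF h]
    have sub: "{t h..t (Suc h)} \<subseteq> {a..b}" using t(3)[OF h] by auto
    show "k h ` {t h..t (Suc h)} \<subseteq> frac (?c h)" using kin[OF h] by blast
    show "t h \<le> t (Suc h)" using t(3)[OF h] by simp
    have dk: "dist (k h s) (k h s') = real m * dist (g s) (g s')"
      if s: "s \<in> {t h..t (Suc h)}" "s' \<in> {t h..t (Suc h)}" for s s'
    proof -
      have "k h s \<in> T1" "k h s' \<in> T1" using kin[OF h] s frac_T1 by blast+
      then have "dist (g s) (g s') = dist (k h s) (k h s') / real m"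
        using map_dist[OF U] kin[OF h] s by metis
      then show ?thesis using m by simp
    qed
    show "continuous_on {t h..t (Suc h)} (k h)"
      unfolding continuous_on_iff
    proof (intro ballI allI impI)
      fix s and e :: real assume s: "s \<in> {t h..t (Suc h)}" "0 < e"
      have "continuous_on {t h..t (Suc h)} g" using g(2) sub by (rule continuous_on_subset)
      moreover have "0 < e / real m" using s(2) m by simp
      ultimately obtain \<delta> where d: "\<delta> > 0" "\<And>s'. s' \<in> {t h..t (Suc h)} \<Longrightarrow> dist s' s < \<delta> \<Longrightarrow> dist (g s')
        (g s) < e / real m"
        unfolding continuous_on_iff using s(1) by blast
      have "dist (k h s') (k h s) < e" if "s' \<in> {t h..t (Suc h)}" "dist s' s < \<delta>" for s'
        using d(2)[OF that] dk[OF that(1) s(1)] m by (simp add: field_simps)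
      then show "\<exists>d>0. \<forall>s'\<in>{t h..t (Suc h)}. dist s' s < d \<longrightarrow> dist (k h s') (k h s) < e"
        using d(1) by blast
    qed
    show "inj_on (k h) {t h..t (Suc h)}"
    proof (rule inj_onI)
      fix s s' assume s: "s \<in> {t h..t (Suc h)}" "s' \<in> {t h..t (Suc h)}" "k h s = k h s'"
      then have "g s = g s'" using kin[OF h] by metis
      then show "s = s'" using g(3) s sub by (auto dest: inj_onD)
    qed
    show "k h (t h) = E (?c h) (lab c i j h)" "k h (t (Suc h)) = E (?c h) (lab c i j (Suc h))"
      using keq[OF h E_T1] t(3)[OF h] by auto
  qed rule
  have "A = (\<Union>h<plen c i j. tri_map (?U h) ` k h ` {t h..t (Suc h)})"
  proof (intro equalityI subsetI)
    fix x assume "x \<in> A"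
    then obtain s where s: "s \<in> {a..b}" "x = g s" using g(6) by auto
    have "\<exists>h<n. s \<in> {t h..t (Suc h)}" if "n \<le> plen c i j" "0 < n" "s \<in> {a..t n}" for n
      using that
    proof (induction n)
      case (Suc n)
      show ?case
      proof (cases "s \<le> t n \<and> 0 < n")
        case True
        then show ?thesis using Suc by (auto intro: less_SucI)
      next
        case False
        then have "t n \<le> s" using Suc.prems t(1) by (cases "n = 0") auto
        then show ?thesis using Suc.prems by (intro exI[of _ n]) auto
      qed
    qed simp
    then obtain h where h: "h < plen c i j" "s \<in> {t h..t (Suc h)}"
      using s t(2) pth_basic(6)[of c i j] by blast
    then have "x = tri_map (?U h) (k h s)" using kin s by simp
    then show "x \<in> (\<Union>h<plen c i j. tri_map (?U h) ` k h ` {t h..t (Suc h)})" using h by blast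
  next
    fix x assume "x \<in> (\<Union>h<plen c i j. tri_map (?U h) ` k h ` {t h..t (Suc h)})"
    then obtain h s where h: "h < plen c i j" "s \<in> {t h..t (Suc h)}" "x = tri_map (?U h) (k h s)" by auto
    then have "x = g s" "s \<in> {a..b}" using kin t(3)[OF h(1)] by auto
    then show "x \<in> A" using g(6) by blast
  qed
  then show ?thesis using piece by (intro exI[of _ "\<lambda>h. k h ` {t h..t (Suc h)}"]) auto
qed

end

context blocked_labyrinth
begin

section \<open>The positive eigenvector and the durations\<close>

definition M :: "3 \<Rightarrow> 3 \<Rightarrow> real" where
  "M k l = real (N True k l) + real (N False k l) - (if k = l then 1 else 0)"

lemma M_ge1: "M k l \<ge> 1"
  using N_diag[of True k] N_diag[of False k] offdiag[of l k] by (cases "k = l") (auto simp: M_def)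

lemma M_row: "(\<Sum>l\<in>UNIV. M k l) \<ge> real m + 1"
proof -
  have "(\<Sum>l\<in>UNIV. M k l) = real ((\<Sum>l\<in>UNIV. N True k l) + (\<Sum>l\<in>UNIV. N False k l)) - 1"
    by (simp add: M_def sum.distrib sum_subtractf)
  then show ?thesis using row_sum[of k] by linarith
qed

definition perron :: "real \<times> (3 \<Rightarrow> real)" where
  "perron = (SOME (t, x). (\<forall>k. x k > 0) \<and> (\<forall>k. (\<Sum>l\<in>UNIV. M k l * x l) = t * x k))"

definition \<theta> :: real where "\<theta> = fst perron"
definition z :: "3 \<Rightarrow> real" where "z = snd perron"

lemma z: "z k > 0" "(\<Sum>l\<in>UNIV. M k l * z l) = \<theta> * z k"
proof -
  have "0 < M k l" for k l using M_ge1[of k l] by linarith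
  from positive_eigenvector[of M, OF this]
  have "\<exists>p. case p of (t, x) \<Rightarrow> (\<forall>k. x k > 0) \<and> (\<forall>k. (\<Sum>l\<in>UNIV. M k l * x l) = t * x k)"
    by simp
  then have "case perron of (t, x) \<Rightarrow> (\<forall>k. x k > 0) \<and> (\<forall>k. (\<Sum>l\<in>UNIV. M k l * x l) = t * x k)"
    unfolding perron_def by (rule someI_ex)
  then show "z k > 0" "(\<Sum>l\<in>UNIV. M k l * z l) = \<theta> * z k"
    unfolding \<theta>_def z_def by (auto simp: case_prod_beta)
qed

text \<open>At the smallest entry of \<open>z\<close> the eigenvector equation bounds \<theta> below
  by the row sum.\<close>

lemma \<theta>: "\<theta> \<ge> real m + 1"
proof -
  have "Min (range z) \<in> range z" by (intro Min_in) auto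
  then obtain k where "Min (range z) = z k" by (elim rangeE)
  then have k: "z k \<le> z l" for l using Min_le[of "range z" "z l"] by simp
  have "(real m + 1) * z k \<le> (\<Sum>l\<in>UNIV. M k l) * z k" using M_row z(1)[of k] by (intro mult_right_mono) auto
  also have "\<dots> \<le> (\<Sum>l\<in>UNIV. M k l * z l)"
    unfolding sum_distrib_right using k M_ge1 by (intro sum_mono mult_left_mono) (auto intro:
      order_trans[of 0 1])
  finally have "(real m + 1) * z k \<le> \<theta> * z k" using z(2) by simp
  then show ?thesis using z(1)[of k] by simp
qed

text \<open>Inverted triangles carry the weights of the other colour and are counted by \<open>N c k l - [l = k]\<close>;
  with \<open>weight c k + weight (\<not> c) k = z k\<close> the eigenvector equation for the weights reduces to this
  formula.\<close>

definition weight :: "bool \<Rightarrow> 3 \<Rightarrow> real" where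
  "weight c k = ((\<Sum>l\<in>UNIV. real (N c k l) * z l) - z k) / (\<theta> - 1)"

lemma \<theta>_gt1: "\<theta> > 1" using \<theta> m by simp

lemma weight_sum: "weight c k + weight (\<not> c) k = z k"
proof -
  have "(\<Sum>l\<in>UNIV. real (N True k l) * z l) + (\<Sum>l\<in>UNIV. real (N False k l) * z l) = (\<Sum>l\<in>UNIV. M k l *
    z l) + z k"
    by (simp add: M_def left_diff_distrib distrib_right sum.distrib sum_subtractf if_distrib[of
      "\<lambda>x. x * _"] cong: if_cong)
  then have "weight True k + weight False k = ((\<theta> - 1) * z k) / (\<theta> - 1)"
    unfolding weight_def add_divide_distrib[symmetric] z(2) by (simp add: algebra_simps)
  then have "weight True k + weight False k = z k" using \<theta>_gt1 by simp
  then show ?thesis by (cases c) auto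
qed

text \<open>The matrix with entries \<open>N c k l - [l = k]\<close> is nonnegative by
  \<open>N_diag\<close>, and by \<open>N_sum_ge2\<close> none of its rows vanishes.\<close>

lemma weight_pos: "weight c k > 0"
proof -
  have "(\<Sum>l\<in>UNIV. real (N c k l) * z l) > z k"
  proof -
    let ?f = "\<lambda>l. (real (N c k l) - (if l = k then 1 else 0)) * z l"
    have nn: "?f l \<ge> 0" for l using z(1)[of l] N_diag[of c k] by (intro mult_nonneg_nonneg) auto
    have "(\<Sum>l\<in>UNIV. ?f l) = (\<Sum>l\<in>UNIV. real (N c k l) * z l) - z k"
      by (simp add: left_diff_distrib sum_subtractf if_distrib[of "\<lambda>x. x * _"] cong: if_cong)
    moreover have "(\<Sum>l\<in>UNIV. ?f l) \<noteq> 0"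
    proof
      assume "(\<Sum>l\<in>UNIV. ?f l) = 0"
      then have "?f l = 0" for l using nn by (simp add: sum_nonneg_eq_0_iff)
      then have "real (N c k l) - (if l = k then 1 else 0) = 0" for l
        using z(1)[of l] by (metis less_irrefl mult_eq_0_iff)
      then have "real (N c k l) = (if l = k then 1 else 0)" for l by (simp only: right_minus_eq)
      then have "(\<Sum>l\<in>UNIV. real (N c k l)) = 1" by simp
      then have "real (\<Sum>l\<in>UNIV. N c k l) = 1" unfolding of_nat_sum .
      then have "(\<Sum>l\<in>UNIV. N c k l) = 1" unfolding of_nat_eq_1_iff .
      then show False using N_sum_ge2[of c k] by simp
    qed
    moreover have "(\<Sum>l\<in>UNIV. ?f l) \<ge> 0" using nn by (intro sum_nonneg) auto
    ultimately show ?thesis by linarith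
  qed
  then show ?thesis using \<theta>_gt1 by (simp add: weight_def)
qed

definition dur :: "bool \<times> 3 \<times> 3 \<Rightarrow> real" where
  "dur = (\<lambda>(c, i, j). weight c (third i j))"

text \<open>Pieces in upright triangles keep the colour, those in inverted ones switch it. Grouped
  by type they are counted by \<open>N\<close> and, by \<open>cnt_False\<close>, by \<open>N\<close>
  minus the identity.\<close>

lemma dur_sum:
  assumes ij: "i \<noteq> j"
  shows "(\<Sum>h<plen c i j. dur (nxt (c, i, j) h)) = \<theta> * dur (c, i, j)"
proof -
  let ?k = "third i j" and ?t = "\<lambda>h. third (lab c i j h) (lab c i j (Suc h))"
  have "dur (nxt (c, i, j) h) = (\<Sum>l\<in>UNIV. (if even h = True \<and> ?t h = l then 1 else 0) * weight c l
      + (if even h = False \<and> ?t h = l then 1 else 0) * weight (\<not> c) l)" if "h < plen c i j" for h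
    using that by (simp add: dur_def nxt_def col_pth sum.distrib if_distrib[of "\<lambda>x. x * _"] cong: if_cong)
  then have "(\<Sum>h<plen c i j. dur (nxt (c, i, j) h)) =
    (\<Sum>h<plen c i j. \<Sum>l\<in>UNIV. (if even h = True \<and> ?t h = l then 1 else 0) * weight c l
      + (if even h = False \<and> ?t h = l then 1 else 0) * weight (\<not> c) l)"
    by (intro sum.cong) auto
  also have "\<dots> = (\<Sum>l\<in>UNIV. (\<Sum>h<plen c i j. if even h = True \<and> ?t h = l then 1 else 0) * weight c l
      + (\<Sum>h<plen c i j. if even h = False \<and> ?t h = l then 1 else 0) * weight (\<not> c) l)"
    by (subst sum.swap) (simp add: sum.distrib sum_distrib_right)
  also have "\<dots> = (\<Sum>l\<in>UNIV. real (cnt True c i j l) * weight c l + real (cnt False c i j l) * weight (\<not> c) l)"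
  proof -
    have card: "(\<Sum>h<plen c i j. if R h then 1 else 0 :: real) = real (card {h. h < plen c i j \<and> R h})" for R
    proof -
      have "{h \<in> {..<plen c i j}. R h} = {h. h < plen c i j \<and> R h}" by auto
      then show ?thesis using sum.inter_filter[of "{..<plen c i j}" "\<lambda>_. 1 :: real" R] by simp
    qed
    show ?thesis unfolding cnt_def card ..
  qed
  also have "\<dots> = (\<Sum>l\<in>UNIV. real (N c ?k l) * (weight c l + weight (\<not> c) l) - (if l = ?k then 1 else
    0) * weight (\<not> c) l)"
  proof (rule sum.cong)
    fix l
    have "real (cnt False c i j l) = real (N c ?k l) - (if l = ?k then 1 else 0)"
      using cnt_False[OF ij, of c l] by (auto simp: of_int_eq_iff[symmetric, where 'a = real] simp
        del: of_int_eq_iff split: if_splits)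
    then show "real (cnt True c i j l) * weight c l + real (cnt False c i j l) * weight (\<not> c) l =
      real (N c ?k l) * (weight c l + weight (\<not> c) l) - (if l = ?k then 1 else 0) * weight (\<not> c) l"
      by (simp only: cnt_N[OF ij]) (simp add: algebra_simps)
  qed simp
  also have "\<dots> = (\<Sum>l\<in>UNIV. real (N c ?k l) * z l) - weight (\<not> c) ?k"
    unfolding weight_sum sum_subtractf by (simp add: if_distrib[of "\<lambda>x. x * _"] cong: if_cong)
  also have "(\<Sum>l\<in>UNIV. real (N c ?k l) * z l) = (\<theta> - 1) * weight c ?k + z ?k"
    using \<theta>_gt1 by (simp add: weight_def)
  also have "z ?k = weight c ?k + weight (\<not> c) ?k" by (rule weight_sum[symmetric])
  finally show ?thesis by (simp add: dur_def algebra_simps)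
qed

text \<open>The count in \<open>lattice_sparse\<close> for \<open>K = 2 * tri_diam + 1\<close>, the
  constant that \<open>sparse\<close> prescribes.\<close>

definition Bound :: nat where
  "Bound = card ({- \<lceil>6 * (2 * tri_diam + 1)\<rceil>..\<lceil>6 * (2 * tri_diam + 1)\<rceil>} \<times>
    {- \<lceil>6 * (2 * tri_diam + 1)\<rceil>..\<lceil>6 * (2 * tri_diam + 1)\<rceil>})"

sublocale curves: separated_curve_system states "\<lambda>(c, i, j). plen c i j"
  "\<lambda>(c, i, j) h. tri_map (pth c i j ! h)"
  nxt dur \<theta> "real m" T1 "\<lambda>(c, i, j). E c i" "\<lambda>(c, i, j). E c j" tri_diam
  "bc (\<chi> i. 1/3)" inner lattice Bound
proof (unfold_locales, goal_cases)
  case 1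
  show ?case by simp
next
  case (2 q h)
  then show ?case using lab_step by (auto simp: states_def nxt_def)
next
  case (3 q)
  show ?case using pth_basic(6) by (cases q) simp
next
  case (4 q)
  show ?case using weight_pos by (cases q) (simp add: dur_def)
next
  case (5 q)
  then show ?case using dur_sum by (auto simp: states_def)
next
  case 6
  show ?case by (rule \<theta>_gt1)
next
  case 7
  show ?case using m by simp
next
  case 8
  show ?case by (rule compact_imp_closed[OF compact_T1])
next
  case 9
  show ?case by (rule convex_T1)
next
  case (10 x y)
  then show ?case by (rule tri_diam)
next
  case (11 q h x)
  then show ?case using map_T1[OF pth_cells] by (auto split: prod.splits)
next
  case (12 q h x y)
  then show ?case using map_dist[OF pth_cells] by (auto split: prod.splits)
next
  case (13 q)
  then show ?case using E_T1 by (auto split: prod.splits)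
next
  case (14 q)
  then show ?case using E_T1 by (auto split: prod.splits)
next
  case (15 q)
  then show ?case
    using exit_TT by (auto simp: nxt_def pth_basic lab_0 col_def E_fixed split: prod.splits)
next
  case (16 q)
  obtain c i j where q: "q = (c, i, j)" by (cases q)
  have "Suc (plen c i j - 1) = plen c i j" using pth_basic(6)[of c i j] by simp
  then show ?case
    using exit_TT[of c j] pth_basic(5)[of c i j] lab_last[of c i j] by (simp add: q nxt_def col_def E_fixed)
next
  case (17 q h)
  obtain c i j where q: "q = (c, i, j)" by (cases q)
  have h: "Suc h < plen c i j" using 17 q by simp
  have "tri_map (pth c i j ! h) (E (col c (pth c i j ! h)) (lab c i j (Suc h))) =
    tri_map (pth c i j ! Suc h) (E (col c (pth c i j ! Suc h)) (lab c i j (Suc h)))"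
    using h by (intro junction[OF pth_cells pth_cells lab_neighbours]) auto
  then show ?case by (simp add: q nxt_def)
next
  case 18
  show ?case unfolding inner_def mem_Collect_eq centre_T1(2) using centre_T1(1) by simp
next
  case 19
  show ?case by (auto simp: inner_def)
next
  case (20 q h x)
  then show ?case using inner_map[OF pth_cells] by (auto split: prod.splits)
next
  case (21 q h h' x y)
  obtain c i j where q: "q = (c, i, j)" by (cases q)
  have h: "h < plen c i j" "h' < plen c i j" using 21 q by auto
  have "pth c i j ! h = pth c i j ! h' \<and> x = y"
    using 21 q by (intro inner_inj[OF pth_cells[OF h(1)] pth_cells[OF h(2)]]) auto
  then show ?case using pth_basic(2)[of c i j] h by (simp add: nth_eq_iff_index_eq plen_def)
next
  case 22
  show ?case unfolding lattice_def mem_Collect_eq centre_T1(2) using centre_T1(1) by simp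
next
  case (23 q h n x)
  then show ?case using lattice_map[OF pth_cells] by (auto split: prod.splits)
next
  case (24 W n)
  then show ?case unfolding Bound_def by (intro lattice_sparse) auto
qed

abbreviation arcset :: "bool \<Rightarrow> 3 \<Rightarrow> 3 \<Rightarrow> (real^2) set" where
  "arcset c i j \<equiv> curves.curve_set (c, i, j)"

section \<open>Existence, uniqueness and dimension of the arcs\<close>

lemma arcset_rec:
  "i \<noteq> j \<Longrightarrow> arcset c i j =
    (\<Union>h<plen c i j. tri_map (pth c i j ! h) ` arcset (col c (pth c i j ! h)) (lab c i j h) (lab c i
      j (Suc h)))"
  using curves.curve_set_rec[of "(c, i, j)"] by (simp add: states_def nxt_def)

lemma arcset_frac:
  assumes "i \<noteq> j"
  shows "arcset c i j \<subseteq> frac c"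
proof -
  have "arcset c i j \<subseteq> lev n c" if "i \<noteq> j" for n c i j
    using that
  proof (induction n arbitrary: c i j)
    case 0
    then show ?case using curves.curve_set_X[of "(c, i, j)"] by (simp add: states_def)
  next
    case (Suc n)
    have "tri_map (pth c i j ! h) ` arcset (col c (pth c i j ! h)) (lab c i j h) (lab c i j (Suc h))
      \<subseteq> lev (Suc n) c"
      if h: "h < plen c i j" for h
      using Suc.IH[OF lab_step[OF Suc.prems h]] pth_cells[OF h] by fastforce
    then show ?case unfolding arcset_rec[OF Suc.prems] by blast
  qed
  then show ?thesis using assms unfolding frac_def by blast
qed

text \<open>Both sets obey the same recursion, the arc by \<open>exit_arc_pieces\<close> and the
  curve by \<open>arcset_rec\<close>. Each step divides the bound on their mutual distance by
  \<open>m\<close>, and both are closed.\<close>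

lemma exit_arc_unique:
  assumes "i \<noteq> j" "exit_arc c i j A"
  shows "A = arcset c i j"
proof -
  have T1: "A \<subseteq> T1" if "exit_arc c i j A" for c i j A
    using that frac_T1 by (auto simp: exit_arc_def)
  have DT1: "arcset c i j \<subseteq> T1" if "i \<noteq> j" for c i j using arcset_frac[OF that] frac_T1 by blast
  have ne: "A \<noteq> {}" if "exit_arc c i j A" for c i j A using that unfolding exit_arc_def by auto
  have Dne: "arcset c i j \<noteq> {}" if "i \<noteq> j" for c i j
    using curves.dpos[of "(c, i, j)"] that by (auto simp: curves.curve_set_def states_def)
  have close: "(\<forall>x\<in>A. \<exists>y\<in>arcset c i j. dist x y \<le> tri_diam * (1 / real m) ^ n) \<and>
    (\<forall>y\<in>arcset c i j. \<exists>x\<in>A. dist x y \<le> tri_diam * (1 / real m) ^ n)"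
    if "i \<noteq> j" "exit_arc c i j A" for n c i j A
    using that
  proof (induction n arbitrary: c i j A)
    case 0
    have "dist x y \<le> tri_diam" if "x \<in> A" "y \<in> arcset c i j" for x y
      using that T1[OF 0(2)] DT1[OF 0(1)] by (intro tri_diam) auto
    then show ?case using ne[OF 0(2)] Dne[OF 0(1), of c] by fastforce
  next
    case (Suc n)
    let ?U = "\<lambda>h. pth c i j ! h"
    obtain B where B: "\<And>h. h < plen c i j \<Longrightarrow> exit_arc (col c (?U h)) (lab c i j h) (lab c i j (Suc h)) (B h)"
      and A: "A = (\<Union>h<plen c i j. tri_map (?U h) ` B h)"
      using exit_arc_pieces[OF Suc.prems] by blast
    let ?D = "\<lambda>h. arcset (col c (?U h)) (lab c i j h) (lab c i j (Suc h))"
    note IH = Suc.IH[OF lab_step[OF Suc.prems(1)] B]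
    have d: "dist (tri_map (?U h) x) (tri_map (?U h) y) \<le> tri_diam * (1 / real m) ^ Suc n"
      if h: "h < plen c i j" and "x \<in> B h" "y \<in> ?D h" "dist x y \<le> tri_diam * (1 / real m) ^ n" for h x y
    proof -
      have "x \<in> T1" "y \<in> T1" using that T1[OF B[OF h]] DT1[OF lab_step[OF Suc.prems(1) h]] by auto
      then have "dist (tri_map (?U h) x) (tri_map (?U h) y) = dist x y / real m"
        using map_dist[OF pth_cells[OF h]] by blast
      also have "\<dots> \<le> tri_diam * (1 / real m) ^ n / real m" using that by (intro divide_right_mono) auto
      finally show ?thesis by simp
    qed
    show ?case
    proof (intro conjI ballI)
      fix x assume "x \<in> A"
      then obtain h x' where h: "h < plen c i j" "x' \<in> B h" "x = tri_map (?U h) x'" using A by auto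
      then obtain y' where "y' \<in> ?D h" "dist x' y' \<le> tri_diam * (1 / real m) ^ n" using IH[OF h(1)
        h(1)] by blast
      then show "\<exists>y\<in>arcset c i j. dist x y \<le> tri_diam * (1 / real m) ^ Suc n"
        using d[OF h(1,2)] h arcset_rec[OF Suc.prems(1), of c] by blast
    next
      fix y assume "y \<in> arcset c i j"
      then obtain h y' where h: "h < plen c i j" "y' \<in> ?D h" "y = tri_map (?U h) y'"
        using arcset_rec[OF Suc.prems(1), of c] by blast
      then obtain x' where "x' \<in> B h" "dist x' y' \<le> tri_diam * (1 / real m) ^ n" using IH[OF h(1)
        h(1)] by blast
      then show "\<exists>x\<in>A. dist x y \<le> tri_diam * (1 / real m) ^ Suc n"
        using d[OF h(1)] h A by blast
    qed
  qed
  have small: "\<exists>n. tri_diam * (1 / real m) ^ n < e" if "e > 0" for e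
  proof -
    have "(\<lambda>n. tri_diam * (1 / real m) ^ n) \<longlonglongrightarrow> tri_diam * 0"
      using m by (intro tendsto_mult_left LIMSEQ_realpow_zero) auto
    then have "eventually (\<lambda>n. tri_diam * (1 / real m) ^ n < e) sequentially"
      using that by (intro order_tendstoD(2)) auto
    then show ?thesis by (auto simp: eventually_sequentially)
  qed
  have "closed A"
    using assms(2) by (auto simp: exit_arc_def intro!: compact_imp_closed compact_continuous_image)
  moreover have "closed (arcset c i j)"
    using curves.curve_set_closed[of "(c, i, j)"] assms(1) by (simp add: states_def)
  moreover have "A \<subseteq> closure (arcset c i j)"
  proof
    fix x assume x: "x \<in> A"
    show "x \<in> closure (arcset c i j)"
      unfolding closure_approachable
    proof (intro allI impI)
      fix e :: real assume "0 < e"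
      then obtain n where n: "tri_diam * (1 / real m) ^ n < e" using small by blast
      obtain y where y: "y \<in> arcset c i j" "dist x y \<le> tri_diam * (1 / real m) ^ n"
        using close[OF assms] x by blast
      then have "dist y x < e" using n by (simp add: dist_commute)
      then show "\<exists>y\<in>arcset c i j. dist y x < e" using y(1) by blast
    qed
  qed
  moreover have "arcset c i j \<subseteq> closure A"
  proof
    fix y assume y: "y \<in> arcset c i j"
    show "y \<in> closure A"
      unfolding closure_approachable
    proof (intro allI impI)
      fix e :: real assume "0 < e"
      then obtain n where n: "tri_diam * (1 / real m) ^ n < e" using small by blast
      obtain x where x: "x \<in> A" "dist x y \<le> tri_diam * (1 / real m) ^ n"
        using close[OF assms] y by blast
      then have "dist x y < e" using n by simp
      then show "\<exists>x\<in>A. dist x y < e" using x(1) by blast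
    qed
  qed
  ultimately show ?thesis by (simp add: closure_closed)
qed

lemma arc_exit_arc:
  "arc_between (frac c) (E c i) (E c j) A \<Longrightarrow> exit_arc c i j A"
  unfolding arc_between_def exit_arc_def arc_def path_def pathstart_def pathfinish_def path_image_def
  by (metis zero_le_one)

text \<open>A common exit point would be a contact of two different upright cells, but by
  \<open>cells_meet\<close> only cells of opposite kinds touch.\<close>

lemma E_ne:
  assumes "i \<noteq> j"
  shows "E c i \<noteq> E c j"
proof
  assume eq: "E c i = E c j"
  have "tri_map (exit c i) (E c i) = tri_map (exit c j) (E c j)" using E_fixed eq by metis
  moreover have "col c (exit c l) = c" for l using exit_TT by (simp add: col_def)
  ultimately have "\<exists>l. neighbours m l (exit c i) (exit c j) \<and> E c i = E (col c (exit c i)) l"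
    using E_frac by (intro cells_meet[OF exit_cells _ exit_cells _ exit_ne[OF assms]]) auto
  then obtain l where "neighbours m l (exit c i) (exit c j)" by blast
  then show False using neighbours_cases exit_TT by blast
qed

text \<open>\<open>path_contains_arc\<close> yields an arc inside the curve, and
  \<open>exit_arc_unique\<close> turns the inclusion into equality.\<close>

lemma arc_between_arcset:
  assumes ij: "i \<noteq> j"
  shows "arc_between (frac c) (E c i) (E c j) (arcset c i j)"
proof -
  let ?q = "(c, i, j)"
  have q: "?q \<in> states" using ij by (simp add: states_def)
  define p where "p t = curves.curve ?q (dur ?q * t)" for t
  note d = curves.dpos[OF q]
  have "path p"
    unfolding path_def p_def
    by (rule continuous_on_compose2[OF curves.continuous_curve[OF q]])
      (use d in \<open>auto intro!: continuous_intros simp: mult_le_cancel_left1\<close>)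
  moreover have "pathstart p = E c i" "pathfinish p = E c j"
    using curves.matched_curve q unfolding curves.matched_def pathstart_def pathfinish_def p_def by auto
  moreover have img: "path_image p \<subseteq> arcset c i j"
    unfolding path_image_def p_def curves.curve_set_def
    using d by (auto simp: mult_le_cancel_left1 intro!: imageI)
  ultimately obtain g where g: "arc g" "path_image g \<subseteq> path_image p" "pathstart g = E c i"
    "pathfinish g = E c j"
    using path_contains_arc[of p "E c i" "E c j"] E_ne[OF ij] by blast
  have sub: "path_image g \<subseteq> frac c" using g(2) img arcset_frac[OF ij] by blast
  then have "arc_between (frac c) (E c i) (E c j) (path_image g)"
    unfolding arc_between_def using g by blast
  moreover from this have "path_image g = arcset c i j" using exit_arc_unique[OF ij arc_exit_arc] by blast
  ultimately show ?thesis by simp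
qed

lemma hausdorff_dim_arcset: "i \<noteq> j \<Longrightarrow> hausdorff_dim (arcset c i j) = ereal (log (real m) \<theta>)"
  using curves.hausdorff_dim_curve[of "(c, i, j)"] by (simp add: states_def)

lemma arcs_between_exits:
  assumes "i \<noteq> j"
  shows "(\<exists>!A. arc_between (frac c) (E c i) (E c j) A) \<and>
    (\<forall>A. arc_between (frac c) (E c i) (E c j) A \<longrightarrow> hausdorff_dim A = ereal (log (real m) \<theta>))"
proof -
  have eq: "A = arcset c i j" if "arc_between (frac c) (E c i) (E c j) A" for A
    using exit_arc_unique[OF assms arc_exit_arc[OF that]] .
  show ?thesis
  proof (intro conjI ex1I allI impI)
    show "arc_between (frac c) (E c i) (E c j) (arcset c i j)" by (rule arc_between_arcset[OF assms])
    show "A = arcset c i j" if "arc_between (frac c) (E c i) (E c j) A" for A using that by (rule eq)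
    show "hausdorff_dim A = ereal (log (real m) \<theta>)" if "arc_between (frac c) (E c i) (E c j) A" for A
      unfolding eq[OF that] by (rule hausdorff_dim_arcset[OF assms])
  qed
qed

text \<open>Row and column \<open>r\<close> of the path matrices belong to the type with third index \<open>ix r\<close>.\<close>

definition ix :: "nat \<Rightarrow> 3" where
  "ix r = (if r = 0 then 3 else if r = 1 then 2 else 1)"

lemma path_types_nth: "r < 3 \<Longrightarrow> path_types ! r = std (ix r)"
  by (auto simp: path_types_def std_def ix_def less_Suc_eq numeral_3_eq_3)

section \<open>The path matrices and the dominant eigenvalue\<close>

lemma count_type_N:
  assumes "r < 3" "s < 3"
  shows "count_type m (up c) (path_types ! r)
    (if c then white_path m S (path_types ! r) else yellow_path m S (path_types ! r)) (path_types !
      s) = N c (ix r) (ix s)"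
proof -
  obtain i j a b where p: "std (ix r) = (i, j)" "std (ix s) = (a, b)" by (metis surj_pair)
  have ij: "i \<noteq> j" and ab: "a \<noteq> b" "third a b = ix s" using std[of "ix r"] std[of "ix s"] p by auto
  have U: "pth c i j ! h \<in> up c \<longleftrightarrow> even h" if "h < plen c i j" for h
    using pth_TT[OF that] pth_cells[OF that] TT'_iff[OF pth_cells[OF that]] up_sub[of c] by (auto
      simp: in_cells_iff)
  have eq: "{h. h < length (pth c i j) \<and> pth c i j ! h \<in> up c \<and> path_vertex_type m (i, j) (pth c i
    j) h = {a, b}} =
    {h. h < plen c i j \<and> even h = True \<and> third (lab c i j h) (lab c i j (Suc h)) = ix s}"
    using U third_eq_iff[OF lab_step[OF ij] ab(1)] ab(2)
    by (auto simp: plen_def path_vertex_type_def lab_def[symmetric])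
  have "(if c then white_path m S (i, j) else yellow_path m S (i, j)) = pth c i j"
    by (cases c) (simp_all add: white_path_eq yellow_path_eq)
  then show ?thesis
    unfolding path_types_nth[OF assms(1)] path_types_nth[OF assms(2)] p
    by (simp only: count_type_def prod.case eq) (simp add: N_def cnt_def p)
qed

definition total_matrix :: "complex mat" where
  "total_matrix = white_path_matrix m S + yellow_path_matrix m S - 1\<^sub>m 3"

lemma total_matrix: "total_matrix \<in> carrier_mat 3 3"
  "r < 3 \<Longrightarrow> s < 3 \<Longrightarrow> total_matrix $$ (r, s) = complex_of_real (M (ix r) (ix s))"
proof -
  show "total_matrix \<in> carrier_mat 3 3"
    unfolding total_matrix_def by (rule minus_carrier_mat) simp
  assume rs: "r < 3" "s < 3"
  have "ix r = ix s \<longleftrightarrow> r = s" using rs by (auto simp: ix_def)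
  then show "total_matrix $$ (r, s) = complex_of_real (M (ix r) (ix s))"
    using rs count_type_N[OF rs, of True] count_type_N[OF rs, of False]
    by (simp add: total_matrix_def white_path_matrix_def yellow_path_matrix_def M_def up_def)
qed

text \<open>The positions \<open>0\<close>, \<open>1\<close>, \<open>2\<close> for
  \<open>l = 3\<close>, \<open>2\<close>, \<open>1\<close> invert \<open>ix\<close>; the sum over
  \<open>l\<close> is the form in which \<open>eigenvalue_less\<close> expects the equation.\<close>

lemma total_matrix_mult:
  assumes "v \<in> carrier_vec 3" "r < 3"
  shows "vec_index (total_matrix *\<^sub>v v) r =
    (\<Sum>l\<in>UNIV. complex_of_real (M (ix r) l) * vec_index v (if l = 3 then 0 else if l = 2 then 1 else 2))"
proof -
  have "vec_index (total_matrix *\<^sub>v v) r = (\<Sum>s<3. total_matrix $$ (r, s) * vec_index v s)"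
    using assms total_matrix(1) by (simp add: scalar_prod_def atLeast0LessThan)
  also have "\<dots> = (\<Sum>s<3. complex_of_real (M (ix r) (ix s)) * vec_index v s)"
    using total_matrix(2)[OF assms(2)] by (intro sum.cong) auto
  finally show ?thesis by (simp add: sum_3 ix_def numeral_3_eq_3 numeral_2_eq_2)
qed

lemma dominant: "dominant_eigenvalue total_matrix (complex_of_real \<theta>)"
  unfolding dominant_eigenvalue_def
proof (intro conjI allI impI)
  have dim: "dim_row total_matrix = 3" using total_matrix(1) by auto
  let ?x = "Matrix.vec 3 (\<lambda>r. complex_of_real (z (ix r)))"
  have "total_matrix *\<^sub>v ?x = complex_of_real \<theta> \<cdot>\<^sub>v ?x"
  proof (rule eq_vecI)
    fix r assume "r < dim_vec (complex_of_real \<theta> \<cdot>\<^sub>v ?x)"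
    then have r: "r < 3" by simp
    have "vec_index (total_matrix *\<^sub>v ?x) r = complex_of_real (\<Sum>l\<in>UNIV. M (ix r) l * z l)"
      unfolding total_matrix_mult[OF vec_carrier r] by (simp add: sum_3 ix_def)
    then show "vec_index (total_matrix *\<^sub>v ?x) r = vec_index (complex_of_real \<theta> \<cdot>\<^sub>v ?x) r"
      using r z(2)[of "ix r"] by simp
  qed (simp add: dim)
  moreover have "?x \<noteq> 0\<^sub>v 3"
  proof
    assume "?x = 0\<^sub>v 3"
    then have "vec_index ?x 0 = vec_index (0\<^sub>v 3) 0" by simp
    then show False using z(1)[of "ix 0"] by simp
  qed
  ultimately show "eigenvalue total_matrix (complex_of_real \<theta>)"
    unfolding eigenvalue_def eigenvector_def dim by (intro exI[of _ ?x]) simp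
  fix w assume w: "eigenvalue total_matrix w \<and> w \<noteq> complex_of_real \<theta>"
  then obtain v where v: "v \<in> carrier_vec 3" "v \<noteq> 0\<^sub>v 3" "total_matrix *\<^sub>v v = w \<cdot>\<^sub>v v"
    unfolding eigenvalue_def eigenvector_def dim by blast
  define u where "u l = vec_index v (if l = 3 then 0 else if l = 2 then 1 else 2)" for l :: 3
  have ui: "u (ix r) = vec_index v r" if "r < 3" for r using that by (auto simp: u_def ix_def
    less_Suc_eq numeral_3_eq_3 numeral_2_eq_2)
  have surj: "\<exists>r<3. ix r = l" for l
  proof -
    have "ix 2 = 1" "ix 1 = 2" "ix 0 = 3" by (simp_all add: ix_def)
    moreover have "(2::nat) < 3" "(1::nat) < 3" "(0::nat) < 3" by simp_all
    ultimately show ?thesis using exhaust_3[of l] by metis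
  qed
  have "\<exists>r<3. vec_index v r \<noteq> 0"
  proof (rule ccontr)
    assume "\<not> ?thesis"
    then have "v = 0\<^sub>v 3" using v(1) by (intro eq_vecI) auto
    then show False using v(2) by simp
  qed
  then obtain k where "u k \<noteq> 0" using ui by metis
  moreover have "(\<Sum>l\<in>UNIV. complex_of_real (M k l) * u l) = w * u k" for k
  proof -
    obtain r where r: "r < 3" "ix r = k" using surj by blast
    have "(\<Sum>l\<in>UNIV. complex_of_real (M k l) * u l) = vec_index (total_matrix *\<^sub>v v) r"
      unfolding total_matrix_mult[OF v(1) r(1)] u_def r(2) ..
    also have "\<dots> = w * u k" using v(1,3) r ui[OF r(1)] by simp
    finally show ?thesis .
  qed
  moreover have "M k l \<ge> (if k = l then 1 else 0)" for k l using M_ge1[of k l] by (cases "k = l") auto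
  ultimately have "cmod w < \<theta>" using w z by (intro eigenvalue_less[of M z \<theta> u k w]) auto
  then show "cmod w < cmod (complex_of_real \<theta>)" by simp
qed

end

theorem theorem8p5:
  fixes m :: nat and S :: patterns
  assumes "labyrinth_patterns_system m S"
    and "globally_blocked m S"
  shows "\<exists>\<theta>::real. \<theta> > 0 \<and>
    dominant_eigenvalue (white_path_matrix m S + yellow_path_matrix m S - 1\<^sub>m 3) (complex_of_real \<theta>) \<and>
    log (real m) \<theta> > 1 \<and>
    (\<forall>i j. i \<noteq> j \<longrightarrow>
      (\<exists>!A. arc_between (white_fractal S) (white_exit_point m S i) (white_exit_point m S j) A) \<and>
      (\<forall>A. arc_between (white_fractal S) (white_exit_point m S i) (white_exit_point m S j) A \<longrightarrow>
           hausdorff_dim A = ereal (log (real m) \<theta>)) \<and>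
      (\<exists>!A. arc_between (yellow_fractal S) (yellow_exit_point m S i) (yellow_exit_point m S j) A) \<and>
      (\<forall>A. arc_between (yellow_fractal S) (yellow_exit_point m S i) (yellow_exit_point m S j) A \<longrightarrow>
           hausdorff_dim A = ereal (log (real m) \<theta>)))"
proof -
  interpret blocked_labyrinth m S by standard (use assms in auto)
  have "log (real m) \<theta> > 1" using m \<theta> by (subst less_log_iff) auto
  then show ?thesis
    unfolding white_fractal_eq yellow_fractal_eq exit_point_eq
    using dominant[unfolded total_matrix_def] \<theta>_gt1 arcs_between_exits
    by (intro exI[of _ \<theta>]) auto
qed

end
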